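(* Let $\mathcal U=(U_i)_{i\in I}$ be an open covering of a manifold $N$, and let $\mathbf G\xrightarrow{\rho}\mathbf H$ be a crossed module of Lie groups with action map $j:\mathbf H\to \mathrm{Aut}(\mathbf G)$. (1) Let $(\mathcal U,\bullet,\star)$ be an adapted Lie groupoid $\mathbf G\to\mathbf H$-extension of the Čech groupoid $N[\mathcal U]$. Define $(\lambda,\mathbf g)\in C^\infty(\coprod_{i,j\in I}U_{ij},\mathbf H)\times C^\infty(\coprod_{i,j,k\in I}U_{ijk},\mathbf G)$ by gluing together the families of maps $\lambda_{ij}:U_{ij}\to\mathbf H$ and $\mathbf g_{ijk}:U_{ijk}\to\mathbf G$ defined by $$(e,x_{ij})\star(x_j,e)=(x_i,\lambda_{ij}(x))\quad \forall i,j\in I,\ x\in U_{ij},\qquad (e,x_{ij})\bullet(e,x_{jk})=(\mathbf g_{ijk}(x),x_{ik})\quad\forall i,j,k\in I,\ x\in U_{ijk}.$$ Then $(\lambda,\mathbf g)$ is a non-Abelian $1$-cocycle w.r.t. $\mathcal U$ with values in $\mathbf G\to\mathbf H$. (2) Given a non-Abelian $1$-cocycle $(\lambda,\mathbf g)$ w.r.t. $\mathcal U$ with values in $\mathbf G\to\mathbf H$, define (all functions being evaluated at $x$): (a) a Lie groupoid structure $\bullet$ on $\mathcal R=\mathbf G\times\coprod_{i,j\in I}U_{ij}$ by $$(g,x_{ij})\bullet(g',x_{jk}):=(g\,\lambda_{ij}(g')\,\mathbf g_{ijk},x_{ik}),\qquad (g,x_{ij})^{-1}:=(\lambda_{ij}^{-1}(g^{-1}\mathbf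 g_{iji}^{-1}),x_{ji}),$$ where $\lambda_{ij}(g')$ is shorthand for $j(\lambda_{ij})(g')$; (b) a map $\phi:\mathcal R\to N[\mathcal U]$ by $(g,x_{ij})\mapsto x_{ij}$; (c) a structure $\star$ of principal $\mathbf H$-bundle over the Lie groupoid $\mathcal R\rightrightarrows\coprod_{i\in I}U_i$ on $P:=\coprod_{i\in I}U_i\times\mathbf H$ by $(g,x_{ij})\star(x_j,h)=(x_i,\rho(g)\lambda_{ij}h)$; (d) a map $\chi:P\to \mathrm{Band}(\mathcal R\to N[\mathcal U])$ by $(x_i,h)\mapsto (j(h),x_i)$, i.e. $\chi(x_i,h)$ is the isomorphism $g\mapsto (h(g),x_{ii})$ from $\mathbf G$ onto the fiber of the kernel over $x_i$. Then $(\mathcal U,\bullet,\star)$ is an adapted Lie groupoid $\mathbf G\to\mathbf H$-extension of the Čech groupoid $N[\mathcal U]$. (3) The procedures in (1) and (2) are inverse to each other.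
   Context: **Crossed module.** A crossed module of (finite-dimensional) Lie groups $\mathbf G\xrightarrow{\rho}\mathbf H$ consists of Lie groups $\mathbf G,\mathbf H$ and Lie group homomorphisms $\rho:\mathbf G\to\mathbf H$ and $j:\mathbf H\to\mathrm{Aut}(\mathbf G)$ such that, writing $h(g):=j(h)(g)$, one has $\rho(h(g))=h\rho(g)h^{-1}$ and $\rho(g)(g')=gg'g^{-1}$ for all $g,g'\in\mathbf G$, $h\in\mathbf H$. The neutral elements of $\mathbf G$ and $\mathbf H$ are both denoted $e$. **Lie groupoids.** In a Lie groupoid $\Gamma\rightrightarrows M$ with source $s$, target $t$ and unit map $\epsilon$, the product $xx'$ is defined when $t(x)=s(x')$. A left action of $\Gamma\rightrightarrows M$ on a surjective submersion $\pi:P\to M$ is a smooth map $\Gamma\times_{t,M,\pi}P\to P$, $(\gamma,p)\mapsto\gamma\cdot p$, with $\pi(\gamma\cdot p)=s(\gamma)$, compatible with products and units. **Čech groupoid.** For an open cover $\mathcal U=(U_i)_{i\in I}$ of $N$, put $U_{ij}=U_i\cap U_j$, $U_{ijk}=U_i\cap U_j\cap U_k$; $x_i$ (resp. $x_{ij}$) denotes $x$ seen as an element of the component $U_i$ (resp. $U_{ij}$) of a disjoint union indexed by $I$ (resp. by ordered pairs). The Čech groupoid $N[\mathcal U]$ is $\coprod_{i,j}U_{ij}\rightrightarrows\coprod_iU_i$ with $s(x_{ij})=x_i$, $t(x_{ij})=x_j$, $x_{ij}\bullet x_{jk}=x_{ik}$, unit $x_i\mapsto x_{ii}$, inverse $x_{ij}^{-1}=x_{ji}$.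 **Extensions.** A Lie groupoid extension $\mathcal R\xrightarrow{\phi}\mathcal G$ consists of Lie groupoids $\mathcal R,\mathcal G$ over the same manifold $M$ and a groupoid morphism $\phi$ over $\mathrm{id}_M$ which is a surjective submersion. Its kernel is $K=\phi^{-1}(\epsilon(M))$, a bundle of Lie groups over $M$. It is a Lie groupoid $\mathbf G$-extension if $K$ is a locally trivial bundle of Lie groups with typical fiber $\mathbf G$. Its band is $\mathrm{Band}(\mathcal R\to\mathcal G)=\coprod_{m\in M}\mathrm{Isom}(\mathbf G,K_m)$ (Lie group isomorphisms), with its natural structure of principal right $\mathrm{Aut}(\mathbf G)$-bundle over $M$ ($b\cdot\alpha=b\circ\alpha$), on which $\mathcal R$ acts on the left by $(r\cdot b)(g)=r\,b(g)\,r^{-1}$ for $b\in\mathrm{Isom}(\mathbf G,K_{t(r)})$. A principal $\mathbf H$-bundle over a Lie groupoid $\mathcal R\rightrightarrows M$ is a (right) principal $\mathbf H$-bundle $P\xrightarrow{\pi} M$ with a left action of $\mathcal R\rightrightarrows M$ commuting with the $\mathbf H$-action. A Lie groupoid $\mathbf G\to\mathbf H$-extension of $\mathcal G\rightrightarrows M$ is a triple $(\mathcal R\to\mathcal G,P\to M,\chi)$ where $\mathcal R\to\mathcal G$ is a Lie groupoid $\mathbf G$-extension, $P\to M$ is a principal $\mathbf H$-bundle over $\mathcal R\rightrightarrows M$, and $\chi:P\to\mathrm{Band}(\mathcal R\to\mathcal G)$ is a smooth map over $\mathrm{id}_M$ with $\chi(r\cdot p\cdot h)=r\cdot\chi(p)\cdot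 j(h)$, such that $p\cdot\rho(g)=\chi(p)(g)\cdot p$ for all $p\in P,g\in\mathbf G$ (on the right, $\chi(p)(g)\in K_{\pi(p)}\subset\mathcal R$ acts on $p$). **Adapted extensions.** A $\mathbf G\to\mathbf H$-extension $(\mathcal R\xrightarrow{\phi}N[\mathcal U],P\to\coprod_iU_i,\chi)$ of $N[\mathcal U]$ is adapted if: (1) $\mathcal R=\mathbf G\times\coprod_{i,j}U_{ij}$ as a manifold and $\phi$ is the projection on the second component; (2) $P=\coprod_iU_i\times\mathbf H$ with right action $(x_i,h)\cdot h'=(x_i,hh')$; (3) $\chi(x_i,h)$ is the element $g\mapsto(h(g),x_{ii})$ of the band over $x_i$; (4) the product of $\mathcal R$ satisfies $(g,x_{ii})(g',x_{ij})=(gg',x_{ij})$ for all $i,j\in I$, $x\in U_{ij}$, $g,g'\in\mathbf G$. Such an extension is determined by, and denoted as, the triple $(\mathcal U,\bullet,\star)$, where $\bullet$ is the product of $\mathcal R$ and $\star$ the action of $\mathcal R$ on $P$. **Non-Abelian $1$-cocycles.** A non-Abelian $1$-cocycle w.r.t. $\mathcal U$ with values in $\mathbf G\to\mathbf H$ is a pair $(\lambda,\mathbf g)\in C^\infty(\coprod_{i,j}U_{ij},\mathbf H)\times C^\infty(\coprod_{i,j,k}U_{ijk},\mathbf G)$ whose restrictions $\lambda_{ij}$, $\mathbf g_{ijk}$ satisfy, for all indices (and at all points of the relevant intersections), $\rho(\mathbf g_{ijk})\lambda_{ik}=\lambda_{ij}\lambda_{jk}$, $\ \mathbf g_{ijk}\mathbf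 g_{ikl}=\lambda_{ij}(\mathbf g_{jkl})\mathbf g_{ijl}$, $\ \mathbf g_{iij}=e$. *)

theory Defs
  imports "HOL-Analysis.Analysis" "HOL-Algebra.Bij"
begin

section \<open>Smooth maps between finite-dimensional normed spaces\<close>

text \<open>Model spaces of charts. The class \<^class>\<open>euclidean_space\<close> would exclude dimension 0, hence
  discrete Lie groups and the trivial group.\<close>

class finite_dim_normed = real_normed_vector +
  assumes finite_dim: "\<exists>B. finite B \<and> (\<forall>x. \<exists>c. x = (\<Sum>b\<in>B. c b *\<^sub>R b))"

lemma finite_dim_normed_iff_span:
  fixes B :: "'a::real_vector set"
  assumes "finite B"
  shows "(\<forall>x. \<exists>c. x = (\<Sum>b\<in>B. c b *\<^sub>R b)) \<longleftrightarrow> span B = UNIV"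
  unfolding span_finite[OF assms] by (auto simp: set_eq_iff image_iff)

instance euclidean_space \<subseteq> finite_dim_normed
proof
  show "\<exists>B :: 'a set. finite B \<and> (\<forall>x. \<exists>c. x = (\<Sum>b\<in>B. c b *\<^sub>R b))"
    by (rule exI[of _ Basis], rule conjI[OF finite_Basis],
        rule finite_dim_normed_iff_span[OF finite_Basis, THEN iffD2, OF span_Basis])
qed

instance prod :: (finite_dim_normed, finite_dim_normed) finite_dim_normed
proof
  obtain B :: "'a set" where B: "finite B" "span B = UNIV"
    using finite_dim finite_dim_normed_iff_span by metis
  obtain C :: "'b set" where C: "finite C" "span C = UNIV"
    using finite_dim finite_dim_normed_iff_span by metis
  have fin: "finite (B \<times> {0} \<union> {0} \<times> C)"
    using B C by simp
  have "(x, y) \<in> span (B \<times> {0} \<union> {0} \<times> C)" for x :: 'a and y :: 'b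
  proof -
    have "span (B \<times> {0 :: 'b}) = span ((\<lambda>u. (u, 0)) ` B)"
      by (rule arg_cong[of _ _ span]) auto
    also have "\<dots> = (\<lambda>u. (u, 0)) ` span B"
      by (intro linear_span_image linearI) auto
    finally have 1: "(x, 0) \<in> span (B \<times> {0 :: 'b})"
      using B by simp
    have "span ({0 :: 'a} \<times> C) = span ((\<lambda>u. (0, u)) ` C)"
      by (rule arg_cong[of _ _ span]) auto
    also have "\<dots> = (\<lambda>u. (0, u)) ` span C"
      by (intro linear_span_image linearI) auto
    finally have 2: "(0, y) \<in> span ({0 :: 'a} \<times> C)"
      using C by simp
    have "(x, 0) \<in> span (B \<times> {0} \<union> {0} \<times> C)" "(0, y) \<in> span (B \<times> {0} \<union> {0} \<times> C)"
      by (rule subsetD[OF span_mono[OF Un_upper1] 1], rule subsetD[OF span_mono[OF Un_upper2] 2])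
    from span_add[OF this] show ?thesis by simp
  qed
  then have "span (B \<times> {0} \<union> {0} \<times> C) = (UNIV :: ('a \<times> 'b) set)"
    by (metis UNIV_eq_I surj_pair)
  from finite_dim_normed_iff_span[OF fin, THEN iffD2, OF this] fin
  show "\<exists>B :: ('a \<times> 'b) set. finite B \<and> (\<forall>x. \<exists>c. x = (\<Sum>b\<in>B. c b *\<^sub>R b))"
    by (intro exI conjI)
qed

text \<open>Class \<open>C\<^sup>k\<close> via iterated directional derivatives, which in finite dimension agrees with the
  definition via iterated total derivatives. To be used on open sets only.\<close>

primrec Ck_on ::
  "nat \<Rightarrow> 'a::finite_dim_normed set \<Rightarrow> ('a \<Rightarrow> 'b::finite_dim_normed) \<Rightarrow> bool"
where
  "Ck_on 0 S f \<longleftrightarrow> continuous_on S f"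
| "Ck_on (Suc k) S f \<longleftrightarrow>
     (\<forall>x\<in>S. f differentiable (at x)) \<and> (\<forall>v. Ck_on k S (\<lambda>x. frechet_derivative f (at x) v))"

definition smooth_on ::
  "'a::finite_dim_normed set \<Rightarrow> ('a \<Rightarrow> 'b::finite_dim_normed) \<Rightarrow> bool"
where
  "smooth_on S f \<longleftrightarrow> (\<forall>k. Ck_on k S f)"


section \<open>Manifolds\<close>

record ('a, 'e) manifold =
  mtop :: "'a topology"
  atlas :: "('a set \<times> ('a \<Rightarrow> 'e)) set"

abbreviation points :: "('a, 'e) manifold \<Rightarrow> 'a set"
  where "points M \<equiv> topspace (mtop M)"

text \<open>Manifolds are Hausdorff but not required to be second countable: the index set of an open
  cover is arbitrary, and a disjoint union of uncountably many manifolds has to be a manifold. The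
  atlas need not be maximal.\<close>

definition smooth_manifold :: "('a, 'e::finite_dim_normed) manifold \<Rightarrow> bool" where
  "smooth_manifold M \<longleftrightarrow>
     Hausdorff_space (mtop M) \<and>
     (\<forall>(U, \<phi>) \<in> atlas M. openin (mtop M) U \<and> open (\<phi> ` U) \<and>
        homeomorphic_map (subtopology (mtop M) U) (top_of_set (\<phi> ` U)) \<phi>) \<and>
     \<Union> (fst ` atlas M) = points M \<and>
     (\<forall>(U, \<phi>) \<in> atlas M. \<forall>(V, \<psi>) \<in> atlas M. smooth_on (\<phi> ` (U \<inter> V)) (\<psi> \<circ> inv_into U \<phi>))"

definition prod_manifold ::
  "('a, 'e) manifold \<Rightarrow> ('b, 'f) manifold \<Rightarrow> ('a \<times> 'b, 'e \<times> 'f) manifold"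
where
  "prod_manifold M N =
     \<lparr>mtop = prod_topology (mtop M) (mtop N),
      atlas = {(U \<times> V, map_prod \<phi> \<psi>) | U \<phi> V \<psi>. (U, \<phi>) \<in> atlas M \<and> (V, \<psi>) \<in> atlas N}\<rparr>"

definition sum_manifold :: "'i set \<Rightarrow> ('i \<Rightarrow> ('a, 'e) manifold) \<Rightarrow> ('i \<times> 'a, 'e) manifold" where
  "sum_manifold I M =
     \<lparr>mtop = sum_topology (\<lambda>i. mtop (M i)) I,
      atlas = {({i} \<times> V, \<phi> \<circ> snd) | i V \<phi>. i \<in> I \<and> (V, \<phi>) \<in> atlas (M i)}\<rparr>"

definition open_submanifold :: "('a, 'e) manifold \<Rightarrow> 'a set \<Rightarrow> ('a, 'e) manifold" where
  "open_submanifold M U =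
     \<lparr>mtop = subtopology (mtop M) U,
      atlas = {(V \<inter> U, \<phi>) | V \<phi>. (V, \<phi>) \<in> atlas M}\<rparr>"

text \<open>Smoothness on an arbitrary subset \<open>S\<close> of \<open>M\<close>: in charts, \<open>f\<close> locally extends to a smooth map on
  an open set. If \<open>S\<close> is an embedded submanifold (a fibre product along a submersion, the kernel of
  a submersive groupoid morphism, ...), this is smoothness for the submanifold structure of \<open>S\<close>.\<close>

definition smooth_on_subset ::
  "('a, 'e::finite_dim_normed) manifold \<Rightarrow> 'a set \<Rightarrow> ('b, 'f::finite_dim_normed) manifold
     \<Rightarrow> ('a \<Rightarrow> 'b) \<Rightarrow> bool"
where
  "smooth_on_subset M S N f \<longleftrightarrow>
     S \<subseteq> points M \<and> f ` S \<subseteq> points N \<and>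
     (\<forall>p\<in>S. \<exists>(U, \<phi>) \<in> atlas M. \<exists>(V, \<psi>) \<in> atlas N. \<exists>W F.
        p \<in> U \<and> open W \<and> \<phi> p \<in> W \<and> W \<subseteq> \<phi> ` U \<and> smooth_on W F \<and>
        (\<forall>q \<in> S \<inter> U. \<phi> q \<in> W \<longrightarrow> f q \<in> V \<and> \<psi> (f q) = F (\<phi> q)))"

abbreviation smooth_map ::
  "('a, 'e::finite_dim_normed) manifold \<Rightarrow> ('b, 'f::finite_dim_normed) manifold
     \<Rightarrow> ('a \<Rightarrow> 'b) \<Rightarrow> bool"
  where "smooth_map M N f \<equiv> smooth_on_subset M (points M) N f"

text \<open>Diffeomorphism between (submanifolds supported on) subsets \<open>S\<close> of \<open>M\<close> and \<open>T\<close> of \<open>N\<close>.\<close>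

definition diffeo_on ::
  "('a, 'e::finite_dim_normed) manifold \<Rightarrow> 'a set
     \<Rightarrow> ('b, 'f::finite_dim_normed) manifold \<Rightarrow> 'b set \<Rightarrow> ('a \<Rightarrow> 'b) \<Rightarrow> bool"
where
  "diffeo_on M S N T f \<longleftrightarrow>
     bij_betw f S T \<and> smooth_on_subset M S N f \<and> smooth_on_subset N T M (inv_into S f)"

definition surjective_submersion ::
  "('a, 'e::finite_dim_normed) manifold \<Rightarrow> ('b, 'f::finite_dim_normed) manifold
     \<Rightarrow> ('a \<Rightarrow> 'b) \<Rightarrow> bool"
where
  "surjective_submersion M N f \<longleftrightarrow>
     smooth_map M N f \<and> f ` points M = points N \<and>
     (\<forall>p\<in>points M. \<exists>(U, \<phi>) \<in> atlas M. \<exists>(V, \<psi>) \<in> atlas N. p \<in> U \<and> f p \<in> V \<and>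
        surj (frechet_derivative (\<psi> \<circ> f \<circ> inv_into U \<phi>) (at (\<phi> p))))"


section \<open>Lie groups and crossed modules\<close>

record ('a, 'e) lie_group_data = "'a monoid" +
  mfd :: "('a, 'e) manifold"

definition lie_group :: "('g, 'e::finite_dim_normed) lie_group_data \<Rightarrow> bool" where
  "lie_group G \<longleftrightarrow>
     group G \<and> smooth_manifold (mfd G) \<and> carrier G = points (mfd G) \<and>
     smooth_map (prod_manifold (mfd G) (mfd G)) (mfd G) (\<lambda>(x, y). x \<otimes>\<^bsub>G\<^esub> y) \<and>
     smooth_map (mfd G) (mfd G) (\<lambda>x. inv\<^bsub>G\<^esub> x)"

text \<open>The automorphism group of \<open>G\<close> as a Lie group; like \<^const>\<open>AutoGroup\<close>, it consists of functions that
  are extensional on the carrier.\<close>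

definition lie_Aut :: "('g, 'e::finite_dim_normed) lie_group_data \<Rightarrow> ('g \<Rightarrow> 'g) monoid" where
  "lie_Aut G = (AutoGroup G)
     \<lparr>carrier := {a \<in> auto G. diffeo_on (mfd G) (carrier G) (mfd G) (carrier G) a}\<rparr>"

text \<open>A map \<open>f\<close> into \<open>Aut(G)\<close>, or into a bundle whose fibres are spaces of Lie group isomorphisms from \<open>G\<close>
  onto subgroups contained in \<open>R\<close>, is smooth iff \<open>(x, g) \<mapsto> f(x)(g)\<close> is smooth. When \<open>Aut(G)\<close> is a
  finite-dimensional Lie group this is smoothness for its manifold structure, and for the induced
  manifold structure of the bundle.\<close>

definition smooth_family ::
  "('a, 'e::finite_dim_normed) manifold \<Rightarrow> ('g, 'f::finite_dim_normed) lie_group_data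
     \<Rightarrow> ('r, 'd::finite_dim_normed) manifold \<Rightarrow> ('a \<Rightarrow> 'g \<Rightarrow> 'r) \<Rightarrow> bool"
where
  "smooth_family M G R f \<longleftrightarrow> smooth_map (prod_manifold M (mfd G)) R (\<lambda>(x, g). f x g)"

definition crossed_module ::
  "('g, 'd::finite_dim_normed) lie_group_data \<Rightarrow> ('h, 'e::finite_dim_normed) lie_group_data
     \<Rightarrow> ('g \<Rightarrow> 'h) \<Rightarrow> ('h \<Rightarrow> 'g \<Rightarrow> 'g) \<Rightarrow> bool"
where
  "crossed_module G H \<rho> j \<longleftrightarrow>
     lie_group G \<and> lie_group H \<and>
     \<rho> \<in> hom G H \<and> smooth_map (mfd G) (mfd H) \<rho> \<and>
     j \<in> hom H (lie_Aut G) \<and> smooth_family (mfd H) G (mfd G) j \<and>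
     (\<forall>g\<in>carrier G. \<forall>h\<in>carrier H. \<rho> (j h g) = h \<otimes>\<^bsub>H\<^esub> \<rho> g \<otimes>\<^bsub>H\<^esub> inv\<^bsub>H\<^esub> h) \<and>
     (\<forall>g\<in>carrier G. \<forall>g'\<in>carrier G. j (\<rho> g) g' = g \<otimes>\<^bsub>G\<^esub> g' \<otimes>\<^bsub>G\<^esub> inv\<^bsub>G\<^esub> g)"


section \<open>Lie groupoids\<close>

record ('r, 'd, 'm, 'e) groupoid =
  arrows :: "('r, 'd) manifold"
  objects :: "('m, 'e) manifold"
  src :: "'r \<Rightarrow> 'm"
  tgt :: "'r \<Rightarrow> 'm"
  gunit :: "'m \<Rightarrow> 'r"
  ginv :: "'r \<Rightarrow> 'r"
  gmul :: "'r \<Rightarrow> 'r \<Rightarrow> 'r"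

text \<open>Diagrammatic convention: the product of \<open>x\<close> and \<open>y\<close> is defined when \<open>t(x) = s(y)\<close>.\<close>

definition composable :: "('r, 'd, 'm, 'e) groupoid \<Rightarrow> ('r \<times> 'r) set" where
  "composable R = {(x, y). x \<in> points (arrows R) \<and> y \<in> points (arrows R) \<and> tgt R x = src R y}"

definition lie_groupoid ::
  "('r, 'd::finite_dim_normed, 'm, 'e::finite_dim_normed) groupoid \<Rightarrow> bool"
where
  "lie_groupoid R \<longleftrightarrow>
     smooth_manifold (arrows R) \<and> smooth_manifold (objects R) \<and>
     surjective_submersion (arrows R) (objects R) (src R) \<and>
     surjective_submersion (arrows R) (objects R) (tgt R) \<and>
     smooth_map (objects R) (arrows R) (gunit R) \<and>
     smooth_map (arrows R) (arrows R) (ginv R) \<and>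
     smooth_on_subset (prod_manifold (arrows R) (arrows R)) (composable R) (arrows R)
       (\<lambda>(x, y). gmul R x y) \<and>
     (\<forall>(x, y) \<in> composable R. src R (gmul R x y) = src R x \<and> tgt R (gmul R x y) = tgt R y) \<and>
     (\<forall>x y z. (x, y) \<in> composable R \<and> (y, z) \<in> composable R \<longrightarrow>
        gmul R (gmul R x y) z = gmul R x (gmul R y z)) \<and>
     (\<forall>m\<in>points (objects R). src R (gunit R m) = m \<and> tgt R (gunit R m) = m) \<and>
     (\<forall>x\<in>points (arrows R). gmul R (gunit R (src R x)) x = x \<and> gmul R x (gunit R (tgt R x)) = x) \<and>
     (\<forall>x\<in>points (arrows R). src R (ginv R x) = tgt R x \<and> tgt R (ginv R x) = src R x \<and>
        gmul R x (ginv R x) = gunit R (src R x) \<and> gmul R (ginv R x) x = gunit R (tgt R x))"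

definition groupoid_action ::
  "('r, 'd::finite_dim_normed, 'm, 'e::finite_dim_normed) groupoid
     \<Rightarrow> ('p, 'f::finite_dim_normed) manifold \<Rightarrow> ('p \<Rightarrow> 'm) \<Rightarrow> ('r \<Rightarrow> 'p \<Rightarrow> 'p) \<Rightarrow> bool"
where
  "groupoid_action R P \<pi> act \<longleftrightarrow>
     surjective_submersion P (objects R) \<pi> \<and>
     smooth_on_subset (prod_manifold (arrows R) P)
       {(r, p). r \<in> points (arrows R) \<and> p \<in> points P \<and> tgt R r = \<pi> p} P (\<lambda>(r, p). act r p) \<and>
     (\<forall>r\<in>points (arrows R). \<forall>p\<in>points P. tgt R r = \<pi> p \<longrightarrow> \<pi> (act r p) = src R r) \<and>
     (\<forall>(r, r') \<in> composable R. \<forall>p\<in>points P. tgt R r' = \<pi> p \<longrightarrow>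
        act (gmul R r r') p = act r (act r' p)) \<and>
     (\<forall>p\<in>points P. act (gunit R (\<pi> p)) p = p)"

definition principal_bundle ::
  "('h, 'd::finite_dim_normed) lie_group_data \<Rightarrow> ('p, 'e::finite_dim_normed) manifold
     \<Rightarrow> ('m, 'f::finite_dim_normed) manifold \<Rightarrow> ('p \<Rightarrow> 'm) \<Rightarrow> ('p \<Rightarrow> 'h \<Rightarrow> 'p) \<Rightarrow> bool"
where
  "principal_bundle H P M \<pi> ract \<longleftrightarrow>
     smooth_manifold P \<and> smooth_manifold M \<and> smooth_map P M \<pi> \<and>
     smooth_map (prod_manifold P (mfd H)) P (\<lambda>(p, h). ract p h) \<and>
     (\<forall>p\<in>points P. ract p \<one>\<^bsub>H\<^esub> = p) \<and>
     (\<forall>p\<in>points P. \<forall>h\<in>carrier H. \<forall>h'\<in>carrier H. ract (ract p h) h' = ract p (h \<otimes>\<^bsub>H\<^esub> h')) \<and>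
     (\<forall>p\<in>points P. \<forall>h\<in>carrier H. \<pi> (ract p h) = \<pi> p) \<and>
     (\<forall>m\<in>points M. \<exists>V \<Psi>. openin (mtop M) V \<and> m \<in> V \<and>
        diffeo_on (prod_manifold M (mfd H)) (V \<times> carrier H) P {p \<in> points P. \<pi> p \<in> V} \<Psi> \<and>
        (\<forall>v\<in>V. \<forall>h\<in>carrier H. \<pi> (\<Psi> (v, h)) = v \<and>
           (\<forall>h'\<in>carrier H. ract (\<Psi> (v, h)) h' = \<Psi> (v, h \<otimes>\<^bsub>H\<^esub> h'))))"

definition principal_bundle_over_groupoid ::
  "('h, 'd::finite_dim_normed) lie_group_data
     \<Rightarrow> ('r, 'c::finite_dim_normed, 'm, 'f::finite_dim_normed) groupoid
     \<Rightarrow> ('p, 'e::finite_dim_normed) manifold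
     \<Rightarrow> ('p \<Rightarrow> 'm) \<Rightarrow> ('p \<Rightarrow> 'h \<Rightarrow> 'p) \<Rightarrow> ('r \<Rightarrow> 'p \<Rightarrow> 'p) \<Rightarrow> bool"
where
  "principal_bundle_over_groupoid H R P \<pi> ract lact \<longleftrightarrow>
     principal_bundle H P (objects R) \<pi> ract \<and> groupoid_action R P \<pi> lact \<and>
     (\<forall>r\<in>points (arrows R). \<forall>p\<in>points P. \<forall>h\<in>carrier H. tgt R r = \<pi> p \<longrightarrow>
        lact r (ract p h) = ract (lact r p) h)"


section \<open>Extensions\<close>

definition lie_groupoid_extension ::
  "('r, 'd::finite_dim_normed, 'm, 'e::finite_dim_normed) groupoid
     \<Rightarrow> ('c, 'f::finite_dim_normed, 'm, 'e) groupoid \<Rightarrow> ('r \<Rightarrow> 'c) \<Rightarrow> bool"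
where
  "lie_groupoid_extension R C \<phi> \<longleftrightarrow>
     lie_groupoid R \<and> lie_groupoid C \<and> objects R = objects C \<and>
     surjective_submersion (arrows R) (arrows C) \<phi> \<and>
     (\<forall>r\<in>points (arrows R). src C (\<phi> r) = src R r \<and> tgt C (\<phi> r) = tgt R r) \<and>
     (\<forall>(r, r') \<in> composable R. \<phi> (gmul R r r') = gmul C (\<phi> r) (\<phi> r'))"

definition kernel_fibre ::
  "('r, 'd, 'm, 'e) groupoid \<Rightarrow> ('c, 'f, 'm, 'e) groupoid \<Rightarrow> ('r \<Rightarrow> 'c) \<Rightarrow> 'm \<Rightarrow> 'r monoid"
where
  "kernel_fibre R C \<phi> m =
     \<lparr>carrier = {r \<in> points (arrows R). \<phi> r = gunit C m}, mult = gmul R, one = gunit R m\<rparr>"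

text \<open>Isomorphisms of Lie groups from \<open>G\<close> onto \<open>K\<close>, where the carrier of \<open>K\<close> is contained in \<open>R\<close>.\<close>

definition lie_Isom ::
  "('g, 'd::finite_dim_normed) lie_group_data \<Rightarrow> ('r, 'e::finite_dim_normed) manifold
     \<Rightarrow> 'r monoid \<Rightarrow> ('g \<Rightarrow> 'r) set"
where
  "lie_Isom G R K =
     {b \<in> iso G K. b \<in> extensional (carrier G) \<and> diffeo_on (mfd G) (carrier G) R (carrier K) b}"

definition lie_groupoid_G_extension ::
  "('g, 'b::finite_dim_normed) lie_group_data
     \<Rightarrow> ('r, 'd::finite_dim_normed, 'm, 'e::finite_dim_normed) groupoid
     \<Rightarrow> ('c, 'f::finite_dim_normed, 'm, 'e) groupoid \<Rightarrow> ('r \<Rightarrow> 'c) \<Rightarrow> bool"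
where
  "lie_groupoid_G_extension G R C \<phi> \<longleftrightarrow>
     lie_groupoid_extension R C \<phi> \<and>
     (\<forall>m\<in>points (objects R). \<exists>V \<Phi>. openin (mtop (objects R)) V \<and> m \<in> V \<and>
        diffeo_on (prod_manifold (objects R) (mfd G)) (V \<times> carrier G)
          (arrows R) (\<Union>v\<in>V. carrier (kernel_fibre R C \<phi> v)) \<Phi> \<and>
        (\<forall>v\<in>V. (\<lambda>g. \<Phi> (v, g)) \<in> iso G (kernel_fibre R C \<phi> v)))"

definition Band ::
  "('g, 'b::finite_dim_normed) lie_group_data
     \<Rightarrow> ('r, 'd::finite_dim_normed, 'm, 'e) groupoid
     \<Rightarrow> ('c, 'f, 'm, 'e) groupoid \<Rightarrow> ('r \<Rightarrow> 'c) \<Rightarrow> ('m \<times> ('g \<Rightarrow> 'r)) set"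
where
  "Band G R C \<phi> =
     (SIGMA m : points (objects R). lie_Isom G (arrows R) (kernel_fibre R C \<phi> m))"

definition band_ract ::
  "('g, 'b) lie_group_data \<Rightarrow> 'm \<times> ('g \<Rightarrow> 'r) \<Rightarrow> ('g \<Rightarrow> 'g) \<Rightarrow> 'm \<times> ('g \<Rightarrow> 'r)"
where
  "band_ract G b a = (fst b, compose (carrier G) (snd b) a)"

definition band_lact ::
  "('g, 'b) lie_group_data \<Rightarrow> ('r, 'd, 'm, 'e) groupoid
     \<Rightarrow> 'r \<Rightarrow> 'm \<times> ('g \<Rightarrow> 'r) \<Rightarrow> 'm \<times> ('g \<Rightarrow> 'r)"
where
  "band_lact G R r b =
     (src R r, \<lambda>g\<in>carrier G. gmul R (gmul R r (snd b g)) (ginv R r))"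

record ('g, 'h, 'r, 'd, 'm, 'e, 'c, 'p, 'f) extension =
  ext_groupoid :: "('r, 'd, 'm, 'e) groupoid"
  ext_prj :: "'r \<Rightarrow> 'c"
  ext_bundle :: "('p, 'f) manifold"
  ext_bundle_prj :: "'p \<Rightarrow> 'm"
  ext_ract :: "'p \<Rightarrow> 'h \<Rightarrow> 'p"
  ext_lact :: "'r \<Rightarrow> 'p \<Rightarrow> 'p"
  ext_chi :: "'p \<Rightarrow> 'm \<times> ('g \<Rightarrow> 'r)"

definition gh_extension ::
  "('g, 'a::finite_dim_normed) lie_group_data \<Rightarrow> ('h, 'b::finite_dim_normed) lie_group_data
     \<Rightarrow> ('g \<Rightarrow> 'h) \<Rightarrow> ('h \<Rightarrow> 'g \<Rightarrow> 'g)
     \<Rightarrow> ('c, 'k::finite_dim_normed, 'm, 'e::finite_dim_normed) groupoid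
     \<Rightarrow> ('g, 'h, 'r, 'd::finite_dim_normed, 'm, 'e, 'c, 'p, 'f::finite_dim_normed) extension \<Rightarrow> bool"
where
  "gh_extension G H \<rho> j C E \<longleftrightarrow>
     lie_groupoid_G_extension G (ext_groupoid E) C (ext_prj E) \<and>
     principal_bundle_over_groupoid H (ext_groupoid E) (ext_bundle E) (ext_bundle_prj E)
       (ext_ract E) (ext_lact E) \<and>
     (\<forall>p\<in>points (ext_bundle E). ext_chi E p \<in> Band G (ext_groupoid E) C (ext_prj E) \<and>
        fst (ext_chi E p) = ext_bundle_prj E p) \<and>
     smooth_family (ext_bundle E) G (arrows (ext_groupoid E)) (\<lambda>p. snd (ext_chi E p)) \<and>
     (\<forall>r\<in>points (arrows (ext_groupoid E)). \<forall>p\<in>points (ext_bundle E). \<forall>h\<in>carrier H.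
        tgt (ext_groupoid E) r = ext_bundle_prj E p \<longrightarrow>
        ext_chi E (ext_ract E (ext_lact E r p) h)
          = band_ract G (band_lact G (ext_groupoid E) r (ext_chi E p)) (j h)) \<and>
     (\<forall>p\<in>points (ext_bundle E). \<forall>g\<in>carrier G.
        ext_ract E p (\<rho> g) = ext_lact E (snd (ext_chi E p) g) p)"


section \<open>The Cech groupoid of an open cover\<close>

definition open_cover :: "('x, 'e) manifold \<Rightarrow> 'i set \<Rightarrow> ('i \<Rightarrow> 'x set) \<Rightarrow> bool" where
  "open_cover N I U \<longleftrightarrow> (\<forall>i\<in>I. openin (mtop N) (U i)) \<and> (\<Union>i\<in>I. U i) = points N"

text \<open>The points \<open>x\<^sub>i\<close>, \<open>x\<^sub>i\<^sub>j\<close> and \<open>x\<^sub>i\<^sub>j\<^sub>k\<close> of the disjoint unions are \<open>(i, x)\<close>, \<open>((i, j), x)\<close> and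
  \<open>((i, j, k), x)\<close>.\<close>

definition cover1 ::
  "('x, 'e) manifold \<Rightarrow> 'i set \<Rightarrow> ('i \<Rightarrow> 'x set) \<Rightarrow> ('i \<times> 'x, 'e) manifold"
where
  "cover1 N I U = sum_manifold I (\<lambda>i. open_submanifold N (U i))"

definition cover2 ::
  "('x, 'e) manifold \<Rightarrow> 'i set \<Rightarrow> ('i \<Rightarrow> 'x set) \<Rightarrow> (('i \<times> 'i) \<times> 'x, 'e) manifold"
where
  "cover2 N I U = sum_manifold (I \<times> I) (\<lambda>(i, k). open_submanifold N (U i \<inter> U k))"

definition cover3 ::
  "('x, 'e) manifold \<Rightarrow> 'i set \<Rightarrow> ('i \<Rightarrow> 'x set) \<Rightarrow> (('i \<times> 'i \<times> 'i) \<times> 'x, 'e) manifold"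
where
  "cover3 N I U = sum_manifold (I \<times> I \<times> I) (\<lambda>(i, k, l). open_submanifold N (U i \<inter> U k \<inter> U l))"

definition cech ::
  "('x, 'e) manifold \<Rightarrow> 'i set \<Rightarrow> ('i \<Rightarrow> 'x set) \<Rightarrow> (('i \<times> 'i) \<times> 'x, 'e, 'i \<times> 'x, 'e) groupoid"
where
  "cech N I U =
     \<lparr>arrows = cover2 N I U, objects = cover1 N I U,
      src = (\<lambda>((i, k), x). (i, x)), tgt = (\<lambda>((i, k), x). (k, x)),
      gunit = (\<lambda>(i, x). ((i, i), x)), ginv = (\<lambda>((i, k), x). ((k, i), x)),
      gmul = (\<lambda>((i, k), x) ((k', l), x'). ((i, l), x))\<rparr>"


section \<open>Adapted extensions and non-Abelian 1-cocycles\<close>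

type_synonym ('x, 'e, 'i, 'g, 'a, 'h, 'b) cech_extension =
  "('g, 'h, 'g \<times> ('i \<times> 'i) \<times> 'x, 'a \<times> 'e, 'i \<times> 'x, 'e, ('i \<times> 'i) \<times> 'x,
    ('i \<times> 'x) \<times> 'h, 'e \<times> 'b) extension"

definition adapted_extension ::
  "('g, 'a::finite_dim_normed) lie_group_data \<Rightarrow> ('h, 'b::finite_dim_normed) lie_group_data
     \<Rightarrow> ('g \<Rightarrow> 'h) \<Rightarrow> ('h \<Rightarrow> 'g \<Rightarrow> 'g)
     \<Rightarrow> ('x, 'e::finite_dim_normed) manifold \<Rightarrow> 'i set \<Rightarrow> ('i \<Rightarrow> 'x set)
     \<Rightarrow> ('x, 'e, 'i, 'g, 'a, 'h, 'b) cech_extension \<Rightarrow> bool"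
where
  "adapted_extension G H \<rho> j N I U E \<longleftrightarrow>
     gh_extension G H \<rho> j (cech N I U) E \<and>
     arrows (ext_groupoid E) = prod_manifold (mfd G) (cover2 N I U) \<and>
     (\<forall>r\<in>points (arrows (ext_groupoid E)). ext_prj E r = snd r) \<and>
     ext_bundle E = prod_manifold (cover1 N I U) (mfd H) \<and>
     (\<forall>p\<in>points (ext_bundle E). ext_bundle_prj E p = fst p) \<and>
     (\<forall>i\<in>I. \<forall>x\<in>U i. \<forall>h\<in>carrier H. \<forall>h'\<in>carrier H.
        ext_ract E ((i, x), h) h' = ((i, x), h \<otimes>\<^bsub>H\<^esub> h')) \<and>
     (\<forall>i\<in>I. \<forall>x\<in>U i. \<forall>h\<in>carrier H.
        ext_chi E ((i, x), h) = ((i, x), \<lambda>g\<in>carrier G. (j h g, ((i, i), x)))) \<and>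
     (\<forall>i\<in>I. \<forall>k\<in>I. \<forall>x \<in> U i \<inter> U k. \<forall>g\<in>carrier G. \<forall>g'\<in>carrier G.
        gmul (ext_groupoid E) (g, ((i, i), x)) (g', ((i, k), x)) = (g \<otimes>\<^bsub>G\<^esub> g', ((i, k), x)))"

definition nonabelian_cocycle ::
  "('g, 'a::finite_dim_normed) lie_group_data \<Rightarrow> ('h, 'b::finite_dim_normed) lie_group_data
     \<Rightarrow> ('g \<Rightarrow> 'h) \<Rightarrow> ('h \<Rightarrow> 'g \<Rightarrow> 'g)
     \<Rightarrow> ('x, 'e::finite_dim_normed) manifold \<Rightarrow> 'i set \<Rightarrow> ('i \<Rightarrow> 'x set)
     \<Rightarrow> (('i \<times> 'i) \<times> 'x \<Rightarrow> 'h) \<Rightarrow> (('i \<times> 'i \<times> 'i) \<times> 'x \<Rightarrow> 'g) \<Rightarrow> bool"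
where
  "nonabelian_cocycle G H \<rho> j N I U lam \<gamma> \<longleftrightarrow>
     smooth_map (cover2 N I U) (mfd H) lam \<and>
     smooth_map (cover3 N I U) (mfd G) \<gamma> \<and>
     (\<forall>i\<in>I. \<forall>k\<in>I. \<forall>l\<in>I. \<forall>x \<in> U i \<inter> U k \<inter> U l.
        \<rho> (\<gamma> ((i, k, l), x)) \<otimes>\<^bsub>H\<^esub> lam ((i, l), x) = lam ((i, k), x) \<otimes>\<^bsub>H\<^esub> lam ((k, l), x)) \<and>
     (\<forall>i\<in>I. \<forall>k\<in>I. \<forall>l\<in>I. \<forall>n\<in>I. \<forall>x \<in> U i \<inter> U k \<inter> U l \<inter> U n.
        \<gamma> ((i, k, l), x) \<otimes>\<^bsub>G\<^esub> \<gamma> ((i, l, n), x)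
          = j (lam ((i, k), x)) (\<gamma> ((k, l, n), x)) \<otimes>\<^bsub>G\<^esub> \<gamma> ((i, k, n), x)) \<and>
     (\<forall>i\<in>I. \<forall>k\<in>I. \<forall>x \<in> U i \<inter> U k. \<gamma> ((i, i, k), x) = \<one>\<^bsub>G\<^esub>)"

definition cocycle_lambda ::
  "('g, 'a) lie_group_data \<Rightarrow> ('h, 'b) lie_group_data
     \<Rightarrow> ('x, 'e, 'i, 'g, 'a, 'h, 'b) cech_extension \<Rightarrow> ('i \<times> 'i) \<times> 'x \<Rightarrow> 'h"
where
  "cocycle_lambda G H E =
     (\<lambda>((i, k), x). snd (ext_lact E (\<one>\<^bsub>G\<^esub>, ((i, k), x)) ((k, x), \<one>\<^bsub>H\<^esub>)))"

definition cocycle_g ::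
  "('g, 'a) lie_group_data
     \<Rightarrow> ('x, 'e, 'i, 'g, 'a, 'h, 'b) cech_extension \<Rightarrow> ('i \<times> 'i \<times> 'i) \<times> 'x \<Rightarrow> 'g"
where
  "cocycle_g G E =
     (\<lambda>((i, k, l), x). fst (gmul (ext_groupoid E) (\<one>\<^bsub>G\<^esub>, ((i, k), x)) (\<one>\<^bsub>G\<^esub>, ((k, l), x))))"

definition cocycle_groupoid ::
  "('g, 'a) lie_group_data \<Rightarrow> ('h, 'b) lie_group_data \<Rightarrow> ('h \<Rightarrow> 'g \<Rightarrow> 'g)
     \<Rightarrow> ('x, 'e) manifold \<Rightarrow> 'i set \<Rightarrow> ('i \<Rightarrow> 'x set)
     \<Rightarrow> (('i \<times> 'i) \<times> 'x \<Rightarrow> 'h) \<Rightarrow> (('i \<times> 'i \<times> 'i) \<times> 'x \<Rightarrow> 'g)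
     \<Rightarrow> ('g \<times> ('i \<times> 'i) \<times> 'x, 'a \<times> 'e, 'i \<times> 'x, 'e) groupoid"
where
  "cocycle_groupoid G H j N I U lam \<gamma> =
     \<lparr>arrows = prod_manifold (mfd G) (cover2 N I U), objects = cover1 N I U,
      src = (\<lambda>(g, ((i, k), x)). (i, x)), tgt = (\<lambda>(g, ((i, k), x)). (k, x)),
      gunit = (\<lambda>(i, x). (\<one>\<^bsub>G\<^esub>, ((i, i), x))),
      ginv = (\<lambda>(g, ((i, k), x)).
        (j (inv\<^bsub>H\<^esub> lam ((i, k), x)) (inv\<^bsub>G\<^esub> g \<otimes>\<^bsub>G\<^esub> inv\<^bsub>G\<^esub> \<gamma> ((i, k, i), x)), ((k, i), x))),
      gmul = (\<lambda>(g, ((i, k), x)) (g', ((k', l), x')).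
        (g \<otimes>\<^bsub>G\<^esub> j (lam ((i, k), x)) g' \<otimes>\<^bsub>G\<^esub> \<gamma> ((i, k, l), x), ((i, l), x)))\<rparr>"

definition cocycle_extension ::
  "('g, 'a) lie_group_data \<Rightarrow> ('h, 'b) lie_group_data \<Rightarrow> ('g \<Rightarrow> 'h) \<Rightarrow> ('h \<Rightarrow> 'g \<Rightarrow> 'g)
     \<Rightarrow> ('x, 'e) manifold \<Rightarrow> 'i set \<Rightarrow> ('i \<Rightarrow> 'x set)
     \<Rightarrow> (('i \<times> 'i) \<times> 'x \<Rightarrow> 'h) \<Rightarrow> (('i \<times> 'i \<times> 'i) \<times> 'x \<Rightarrow> 'g)
     \<Rightarrow> ('x, 'e, 'i, 'g, 'a, 'h, 'b) cech_extension"
where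
  "cocycle_extension G H \<rho> j N I U lam \<gamma> =
     \<lparr>ext_groupoid = cocycle_groupoid G H j N I U lam \<gamma>,
      ext_prj = snd,
      ext_bundle = prod_manifold (cover1 N I U) (mfd H),
      ext_bundle_prj = fst,
      ext_ract = (\<lambda>((i, x), h) h'. ((i, x), h \<otimes>\<^bsub>H\<^esub> h')),
      ext_lact = (\<lambda>(g, ((i, k), x)) ((k', x'), h).
        ((i, x), \<rho> g \<otimes>\<^bsub>H\<^esub> lam ((i, k), x) \<otimes>\<^bsub>H\<^esub> h)),
      ext_chi = (\<lambda>((i, x), h). ((i, x), \<lambda>g\<in>carrier G. (j h g, ((i, i), x))))\<rparr>"

text \<open>Structure maps are total functions, of which only the values on the relevant manifolds and fibre
  products matter; so equality of extensions means that all data agree there.\<close>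

definition same_groupoid ::
  "('r, 'd, 'm, 'e) groupoid \<Rightarrow> ('r, 'd, 'm, 'e) groupoid \<Rightarrow> bool"
where
  "same_groupoid R S \<longleftrightarrow>
     arrows R = arrows S \<and> objects R = objects S \<and>
     (\<forall>r\<in>points (arrows R). src R r = src S r \<and> tgt R r = tgt S r \<and> ginv R r = ginv S r) \<and>
     (\<forall>m\<in>points (objects R). gunit R m = gunit S m) \<and>
     (\<forall>(r, r') \<in> composable R. gmul R r r' = gmul S r r')"

definition same_extension ::
  "('h, 'b) lie_group_data
     \<Rightarrow> ('g, 'h, 'r, 'd, 'm, 'e, 'c, 'p, 'f) extension
     \<Rightarrow> ('g, 'h, 'r, 'd, 'm, 'e, 'c, 'p, 'f) extension \<Rightarrow> bool"
where
  "same_extension H E F \<longleftrightarrow>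
     same_groupoid (ext_groupoid E) (ext_groupoid F) \<and> ext_bundle E = ext_bundle F \<and>
     (\<forall>r\<in>points (arrows (ext_groupoid E)). ext_prj E r = ext_prj F r) \<and>
     (\<forall>p\<in>points (ext_bundle E).
        ext_bundle_prj E p = ext_bundle_prj F p \<and> ext_chi E p = ext_chi F p) \<and>
     (\<forall>p\<in>points (ext_bundle E). \<forall>h\<in>carrier H. ext_ract E p h = ext_ract F p h) \<and>
     (\<forall>r\<in>points (arrows (ext_groupoid E)). \<forall>p\<in>points (ext_bundle E).
        tgt (ext_groupoid E) r = ext_bundle_prj E p \<longrightarrow> ext_lact E r p = ext_lact F r p)"

end

theory Submission
  imports Defs
begin

text \<open>The kernel axioms of an adapted extension give \<open>(g, x\<^sub>i\<^sub>j) = (g, x\<^sub>i\<^sub>i) \<bullet> (e, x\<^sub>i\<^sub>j)\<close>, and equivariance of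
  \<open>\<chi>\<close> shows that conjugation by \<open>(e, x\<^sub>i\<^sub>j)\<close> acts on the kernel through \<open>\<lambda>\<^sub>i\<^sub>j\<close>. Hence \<open>\<bullet>\<close> and \<open>\<star>\<close> are
  given by the formulas of part (2). Associativity of \<open>\<bullet>\<close>, its compatibility with \<open>\<star>\<close>, and the
  unit law then translate into the three cocycle identities, and conversely. Smoothness reduces to
  the chain rule in charts, where a map into a disjoint union of open subsets of \<open>N\<close> is smooth iff
  its index is locally constant and its point of \<open>N\<close> depends smoothly on the argument.\<close>

section \<open>Smooth calculus in finite-dimensional normed spaces\<close>

text \<open>On the analytic side the obstacle is dimension 0: the calculus runs over
  \<open>finite_dim_normed\<close>, where no basis is part of the structure, so continuity of
  coordinate functionals must be proved before the chain rule can be expanded. On the algebraic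
  side, a cocycle is normalised only by g_iik = e; the relations \<lambda>_ii = e and g_ikk = e, on
  which units and inverses rest, are derived from this and the other two identities. Conversely, the
  conditions that define an adapted extension leave its source, target, unit, inverse and action
  implicit: source and target are read off from \<phi>, the unit from condition (4) and the unit
  law, the inverse from its uniqueness. How the kernel acts on P is read off from p \<rho>(g) =
  \<chi>(p)(g) p at p = (x_i, h), with h^{-1}(g) in place of g: the arrow (g, x_ii) multiplies the
  fibre on the left by \<rho>(g).\<close>

lemma finite_dim_normed_basis:
  obtains B :: "'a::finite_dim_normed set"
  where "finite B" "independent B" "span B = UNIV"
proof -
  obtain A :: "'a set" where A: "finite A" "span A = UNIV"
    using finite_dim finite_dim_normed_iff_span by metis
  obtain B where "B \<subseteq> A" "independent B" "A \<subseteq> span B"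
    using maximal_independent_subset by blast
  then show thesis
    using A that finite_subset span_minimal[OF _ subspace_span] by (metis top.extremum_uniqueI)
qed

text \<open>On the compact set of coefficient vectors with absolute sum 1 the continuous function
  \<open>norm (T c)\<close> is positive by independence, hence has a positive minimum; scaling gives
  the bound for all \<open>c\<close>. This is the half of the equivalence of norms that makes
  coordinates bounded.\<close>

lemma independent_sum_lower_bound:
  fixes B :: "'a::real_normed_vector set"
  assumes "finite B" "independent B"
  obtains e where "e > 0" "\<And>c. e * (\<Sum>b\<in>B. \<bar>c b\<bar>) \<le> norm (\<Sum>b\<in>B. c b *\<^sub>R b)"
proof -
  \<comment> \<open>Coefficients are functions on the whole type, since this is where the product
    topology lives. Bounding all of them by 1, also outside \<open>B\<close>, makes the cube compact
    by Tychonoff.\<close>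
  define K where "K = PiE UNIV (\<lambda>_. {-1..1::real}) \<inter> {c. (\<Sum>b\<in>B. \<bar>c b\<bar>) = 1}"
  define T where "T = (\<lambda>c. \<Sum>b\<in>B. c b *\<^sub>R b)"
  have "compact (PiE (UNIV :: 'a set) (\<lambda>_. {-1..1::real}))"
    using compactin_PiE[of "\<lambda>_. euclideanreal" UNIV "\<lambda>_. {-1..1::real}"]
    by (simp add: euclidean_product_topology)
  moreover have "closed {c :: 'a \<Rightarrow> real. (\<Sum>b\<in>B. \<bar>c b\<bar>) = 1}"
    by (intro closed_Collect_eq continuous_intros) auto
  ultimately have "compact K"
    unfolding K_def by (intro compact_Int_closed)
  have cont: "continuous_on K (\<lambda>c. norm (T c))"
    unfolding T_def
    by (intro continuous_intros continuous_on_subset[OF continuous_on_product_coordinates]) auto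
  have pos: "norm (T c) > 0" if "c \<in> K" for c
  proof -
    have "\<exists>b\<in>B. c b \<noteq> 0"
      using that unfolding K_def by (force intro: ccontr)
    then show ?thesis
      using assms unfolding T_def by (auto simp: dependent_finite)
  qed
  have "\<exists>e>0. \<forall>c\<in>K. e \<le> norm (T c)"
  proof (cases "K = {}")
    case False
    then obtain d where d: "d \<in> K" "\<And>c. c \<in> K \<Longrightarrow> norm (T d) \<le> norm (T c)"
      using continuous_attains_inf[OF \<open>compact K\<close> _ cont] by auto
    show ?thesis
      by (rule exI[of _ "norm (T d)"]) (use pos d in simp)
  next
    \<comment> \<open>This is the case of empty \<open>B\<close>, where any positive constant
      does.\<close>
    case True
    then show ?thesis
      using zero_less_one by blast
  qed
  then obtain e where e: "e > 0" "\<And>c. c \<in> K \<Longrightarrow> e \<le> norm (T c)" by blast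
  show thesis
  proof (rule that[OF e(1)])
    fix c :: "'a \<Rightarrow> real"
    define s where "s = (\<Sum>b\<in>B. \<bar>c b\<bar>)"
    show "e * (\<Sum>b\<in>B. \<bar>c b\<bar>) \<le> norm (\<Sum>b\<in>B. c b *\<^sub>R b)"
    proof (cases "s = 0")
      case False
      then have "s > 0"
        unfolding s_def by (metis abs_ge_zero order_le_less sum_nonneg)
      have abs_le: "\<bar>c b\<bar> \<le> s" if "b \<in> B" for b
        unfolding s_def using assms(1) that by (intro member_le_sum) auto
      then have le: "c b \<le> s" "- s \<le> c b" if "b \<in> B" for b
        using abs_le[OF that] by linarith+
      \<comment> \<open>The normalised coefficients are set to 0 outside \<open>B\<close>, so that
        they lie in the cube; the sum over \<open>B\<close> does not see this.\<close>
      have "(\<lambda>b. if b \<in> B then c b / s else 0) \<in> K"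
        using \<open>s > 0\<close> le unfolding K_def
        by (auto simp: field_simps sum_divide_distrib[symmetric] s_def[symmetric])
      from e(2)[OF this] have "e \<le> norm ((1 / s) *\<^sub>R T c)"
        by (simp add: T_def scaleR_sum_right)
      then show ?thesis
        using \<open>s > 0\<close> by (simp add: T_def s_def[symmetric] field_simps)
    qed (simp add: s_def[symmetric])
  qed
qed

text \<open>A single coefficient is at most the absolute sum, so the lower bound \<open>e\<close>
  for independent sums bounds every coordinate functional by \<open>1 / e\<close>.\<close>

lemma finite_dim_normed_coordinates:
  obtains B :: "'a::finite_dim_normed set" and c :: "'a \<Rightarrow> 'a \<Rightarrow> real"
  where "finite B" "\<And>b. bounded_linear (c b)" "\<And>x. (\<Sum>b\<in>B. c b x *\<^sub>R b) = x"
proof -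
  obtain B :: "'a set" where B: "finite B" "independent B" "span B = UNIV"
    using finite_dim_normed_basis by blast
  obtain e where e: "e > 0" "\<And>c. e * (\<Sum>b\<in>B. \<bar>c b\<bar>) \<le> norm (\<Sum>b\<in>B. c b *\<^sub>R b)"
    using independent_sum_lower_bound B by metis
  have sum: "(\<Sum>b\<in>B. representation B x b *\<^sub>R b) = x" for x
    using B by (intro sum_representation_eq) auto
  have "bounded_linear (\<lambda>x. representation B x b)" for b
  proof (rule bounded_linear_intro[where K = "1 / e"])
    fix x
    show "norm (representation B x b) \<le> norm x * (1 / e)"
    proof (cases "b \<in> B")
      case True
      then have "e * \<bar>representation B x b\<bar> \<le> e * (\<Sum>b\<in>B. \<bar>representation B x b\<bar>)"
        using e(1) B(1) by (intro mult_left_mono member_le_sum) auto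
      also have "\<dots> \<le> norm x"
        using e(2)[of "representation B x"] sum by simp
      finally show ?thesis
        using e(1) by (simp add: field_simps)
    next
      case False
      then show ?thesis
        using representation_ne_zero[of B x b] e(1) by (cases "representation B x b = 0") auto
    qed
  qed (simp_all add: representation_add[OF B(2)] representation_scale[OF B(2)] B(3))
  then show thesis
    by (rule that[of B "\<lambda>b x. representation B x b", OF B(1) _ sum])
qed

section \<open>Closure properties of the classes C^k\<close>

lemma Ck_on_cong:
  assumes "open S" "\<And>x. x \<in> S \<Longrightarrow> f x = g x" "Ck_on k S f"
  shows "Ck_on k S g"
  using assms(2,3)
proof (induction k arbitrary: f g)
  case 0
  then show ?case
    using continuous_on_cong by (metis Ck_on.simps(1))
next
  case (Suc k)
  have D: "(g has_derivative frechet_derivative f (at x)) (at x)" if "x \<in> S" for x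
  proof -
    have "(f has_derivative frechet_derivative f (at x)) (at x)"
      using Suc.prems(2) that by (simp add: frechet_derivative_works)
    then show ?thesis
      using has_derivative_transform_within_open[OF _ \<open>open S\<close> that] Suc.prems(1) by blast
  qed
  then have "frechet_derivative f (at x) v = frechet_derivative g (at x) v" if "x \<in> S" for x v
    using frechet_derivative_at that by metis
  then have "Ck_on k S (\<lambda>x. frechet_derivative g (at x) v)" for v
    using Suc.IH[of "\<lambda>x. frechet_derivative f (at x) v"] Suc.prems(2) by simp
  then show ?case
    using D by (auto intro: differentiableI)
qed

text \<open>Allows a derivative to be given by a formula \<open>f'\<close>; uniqueness of
  derivatives replaces \<open>frechet_derivative\<close>, and openness of \<open>S\<close> lets
  \<open>Ck_on_cong\<close> carry the formula through all higher orders.\<close>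

lemma Ck_on_SucI:
  assumes "\<And>x. x \<in> S \<Longrightarrow> (f has_derivative f' x) (at x)"
    and "\<And>v. Ck_on k S (\<lambda>x. f' x v)" and "open S"
  shows "Ck_on (Suc k) S f"
proof -
  have "f' x v = frechet_derivative f (at x) v" if "x \<in> S" for x v
    using frechet_derivative_at[OF assms(1)[OF that]] by simp
  then have "Ck_on k S (\<lambda>x. frechet_derivative f (at x) v)" for v
    by (intro Ck_on_cong[OF assms(3) _ assms(2)[of v]])
  then show ?thesis
    using assms(1) by (auto intro: differentiableI)
qed

lemma Ck_on_has_derivative:
  assumes "Ck_on (Suc k) S f" "x \<in> S"
  shows "(f has_derivative frechet_derivative f (at x)) (at x)"
  using assms by (simp add: frechet_derivative_works)

lemma Ck_on_frechet_derivative: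
  "Ck_on (Suc k) S f \<Longrightarrow> Ck_on k S (\<lambda>x. frechet_derivative f (at x) v)"
  by simp

lemma Ck_on_imp_continuous_on: "Ck_on k S f \<Longrightarrow> continuous_on S f"
  by (cases k)
    (auto intro!: continuous_at_imp_continuous_on dest: differentiable_imp_continuous_within)

lemma Ck_on_Suc_imp: "Ck_on (Suc k) S f \<Longrightarrow> Ck_on k S f"
proof (induction k arbitrary: f)
  case 0
  show ?case
    using Ck_on_imp_continuous_on[OF 0] by simp
next
  case (Suc k)
  show ?case
    using Suc.prems Suc.IH by (subst (asm) Ck_on.simps(2), subst Ck_on.simps(2)) blast
qed

declare Ck_on.simps(2) [simp del]

lemma Ck_on_subset: "Ck_on k S f \<Longrightarrow> T \<subseteq> S \<Longrightarrow> Ck_on k T f"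
  by (induction k arbitrary: f) (auto simp: Ck_on.simps(2) intro: continuous_on_subset)

lemma Ck_on_const: "open S \<Longrightarrow> Ck_on k S (\<lambda>x. c)"
proof (induction k arbitrary: c)
  case (Suc k)
  then show ?case
    by (intro Ck_on_SucI[where f' = "\<lambda>x v. 0"]) auto
qed auto

lemma Ck_on_bounded_linear:
  assumes "bounded_linear L" "open S"
  shows "Ck_on k S L"
proof (cases k)
  case 0
  then show ?thesis
    using assms by (simp add: linear_continuous_on)
next
  case (Suc l)
  show ?thesis unfolding Suc
    using assms
    by (intro Ck_on_SucI[where f' = "\<lambda>x. L"]) (auto intro: bounded_linear_imp_has_derivative Ck_on_const)
qed

lemma Ck_on_bounded_linear_compose:
  assumes "bounded_linear L" "open S" "Ck_on k S f"
  shows "Ck_on k S (\<lambda>x. L (f x))"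
  using assms(3)
proof (induction k arbitrary: f)
  case 0
  then show ?case
    using assms by (simp add: bounded_linear.continuous_on)
next
  case (Suc k)
  show ?case
    by (rule Ck_on_SucI[where f' = "\<lambda>x v. L (frechet_derivative f (at x) v)"])
      (use assms Suc in \<open>auto intro: bounded_linear.has_derivative Ck_on_has_derivative
        Ck_on_frechet_derivative\<close>)
qed

lemma Ck_on_add:
  assumes "open S" "Ck_on k S f" "Ck_on k S g"
  shows "Ck_on k S (\<lambda>x. f x + g x)"
  using assms(2,3)
proof (induction k arbitrary: f g)
  case 0
  then show ?case
    by (simp add: continuous_on_add)
next
  case (Suc k)
  show ?case
    by (rule Ck_on_SucI[where
          f' = "\<lambda>x v. frechet_derivative f (at x) v + frechet_derivative g (at x) v"])
      (use Suc assms(1) in \<open>auto intro!: has_derivative_add Ck_on_has_derivative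
        Ck_on_frechet_derivative\<close>)
qed

lemma Ck_on_sum:
  assumes "open S" "\<And>i. i \<in> A \<Longrightarrow> Ck_on k S (f i)"
  shows "Ck_on k S (\<lambda>x. \<Sum>i\<in>A. f i x)"
  using assms(2)
  by (induction A rule: infinite_finite_induct) (auto intro: Ck_on_add Ck_on_const assms(1))

text \<open>In the product rule each factor also occurs undifferentiated, so the induction needs
  that C^(k+1) functions are C^k.\<close>

lemma Ck_on_scaleR:
  fixes u :: "'a::finite_dim_normed \<Rightarrow> real"
  assumes "open S" "Ck_on k S u" "Ck_on k S f"
  shows "Ck_on k S (\<lambda>x. u x *\<^sub>R f x)"
  using assms(2,3)
proof (induction k arbitrary: u f)
  case 0
  then show ?case
    by (simp add: continuous_on_scaleR)
next
  case (Suc k)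
  show ?case
    by (rule Ck_on_SucI[where
          f' = "\<lambda>x v. u x *\<^sub>R frechet_derivative f (at x) v + frechet_derivative u (at x) v *\<^sub>R f x"])
      (use Suc assms(1) Suc.prems[THEN Ck_on_Suc_imp] in \<open>auto intro!: has_derivative_scaleR
        Ck_on_add Ck_on_has_derivative Ck_on_frechet_derivative\<close>)
qed

text \<open>Expanding the inner derivative in coordinates turns the chain rule into a finite sum of products,
  to which the induction hypothesis applies.\<close>

lemma Ck_on_compose:
  fixes f :: "'b::finite_dim_normed \<Rightarrow> 'c::finite_dim_normed"
  assumes "open S" "open T" "Ck_on k S g" "Ck_on k T f" "g ` S \<subseteq> T"
  shows "Ck_on k S (\<lambda>x. f (g x))"
  using assms(3,4)
proof (induction k arbitrary: f)
  case 0
  then show ?case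
    using assms(5) by (auto intro: continuous_on_compose2)
next
  case (Suc k)
  obtain B :: "'b set" and c where B: "finite B" "\<And>b. bounded_linear (c b)"
    "\<And>x. (\<Sum>b\<in>B. c b x *\<^sub>R b) = x"
    using finite_dim_normed_coordinates by blast
  show ?case
  proof (rule Ck_on_SucI[where f' = "\<lambda>x v. \<Sum>b\<in>B. c b (frechet_derivative g (at x) v) *\<^sub>R
        frechet_derivative f (at (g x)) b"])
    fix x assume x: "x \<in> S"
    have f: "(f has_derivative frechet_derivative f (at (g x))) (at (g x))"
      using Ck_on_has_derivative[OF Suc.prems(2)] x assms(5) by blast
    then interpret f: bounded_linear "frechet_derivative f (at (g x))"
      by (rule has_derivative_bounded_linear)
    have "(\<Sum>b\<in>B. c b v *\<^sub>R frechet_derivative f (at (g x)) b) = frechet_derivative f (at (g x)) v" for v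
      by (subst (2) B(3)[of v, symmetric]) (simp add: f.sum f.scaleR)
    then show "((\<lambda>x. f (g x)) has_derivative (\<lambda>v. \<Sum>b\<in>B. c b (frechet_derivative g (at x) v) *\<^sub>R
        frechet_derivative f (at (g x)) b)) (at x)"
      using has_derivative_compose[OF Ck_on_has_derivative[OF Suc.prems(1) x] f] by simp
  next
    fix v
    have "Ck_on k S (\<lambda>x. c b (frechet_derivative g (at x) v))" for b
      by (rule Ck_on_bounded_linear_compose[OF B(2) assms(1)
            Ck_on_frechet_derivative[OF Suc.prems(1)]])
    moreover have "Ck_on k S (\<lambda>x. frechet_derivative f (at (g x)) b)" for b
      by (rule Suc.IH[OF Ck_on_Suc_imp[OF Suc.prems(1)] Ck_on_frechet_derivative[OF Suc.prems(2)]])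
    ultimately show "Ck_on k S (\<lambda>x. \<Sum>b\<in>B. c b (frechet_derivative g (at x) v) *\<^sub>R
        frechet_derivative f (at (g x)) b)"
      by (intro Ck_on_sum Ck_on_scaleR assms(1))
  qed (use assms(1) in auto)
qed

lemma Ck_on_Pair:
  assumes "open S" "Ck_on k S f" "Ck_on k S g"
  shows "Ck_on k S (\<lambda>x. (f x, g x))"
  using assms(2,3)
proof (induction k arbitrary: f g)
  case 0
  then show ?case
    by (simp add: continuous_on_Pair)
next
  case (Suc k)
  show ?case
    by (rule Ck_on_SucI[where
          f' = "\<lambda>x v. (frechet_derivative f (at x) v, frechet_derivative g (at x) v)"])
      (use Suc assms(1) in \<open>auto intro!: has_derivative_Pair Ck_on_has_derivative
        Ck_on_frechet_derivative\<close>)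
qed

section \<open>Smooth maps, all orders at once\<close>

lemma smooth_on_cong:
  "open S \<Longrightarrow> (\<And>x. x \<in> S \<Longrightarrow> f x = g x) \<Longrightarrow> smooth_on S f \<Longrightarrow> smooth_on S g"
  unfolding smooth_on_def using Ck_on_cong by blast

lemma smooth_on_subset: "smooth_on S f \<Longrightarrow> T \<subseteq> S \<Longrightarrow> smooth_on T f"
  unfolding smooth_on_def using Ck_on_subset by blast

lemma smooth_on_imp_continuous_on: "smooth_on S f \<Longrightarrow> continuous_on S f"
  unfolding smooth_on_def using Ck_on_imp_continuous_on by blast

lemma smooth_on_bounded_linear: "bounded_linear L \<Longrightarrow> open S \<Longrightarrow> smooth_on S L"
  unfolding smooth_on_def using Ck_on_bounded_linear by blast

lemma smooth_on_compose:
  "open S \<Longrightarrow> open T \<Longrightarrow> smooth_on S g \<Longrightarrow> smooth_on T f \<Longrightarrow> g ` S \<subseteq> T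
    \<Longrightarrow> smooth_on S (\<lambda>x. f (g x))"
  unfolding smooth_on_def using Ck_on_compose by blast

lemma smooth_on_const: "open S \<Longrightarrow> smooth_on S (\<lambda>x. c)"
  unfolding smooth_on_def using Ck_on_const by blast

lemma smooth_on_Pair:
  "open S \<Longrightarrow> smooth_on S f \<Longrightarrow> smooth_on S g \<Longrightarrow> smooth_on S (\<lambda>x. (f x, g x))"
  unfolding smooth_on_def using Ck_on_Pair by blast

section \<open>Smooth manifolds through their charts\<close>

text \<open>A homeomorphism from an open set onto an open set, expressed by open sets of the ambient
  space alone. Restriction, disjoint union and product of charts then become computations with
  images and preimages, without subspace topologies on either side.\<close>

definition chart :: "'a topology \<Rightarrow> 'a set \<Rightarrow> ('a \<Rightarrow> 'e::topological_space) \<Rightarrow> bool" where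
  "chart X U \<phi> \<longleftrightarrow> openin X U \<and> inj_on \<phi> U \<and>
     (\<forall>A. openin X A \<longrightarrow> open (\<phi> ` (U \<inter> A))) \<and>
     (\<forall>W. open W \<longrightarrow> openin X {p \<in> U. \<phi> p \<in> W})"

lemma chart_iff_homeomorphic_map:
  "chart X U \<phi> \<longleftrightarrow>
     openin X U \<and> open (\<phi> ` U) \<and> homeomorphic_map (subtopology X U) (top_of_set (\<phi> ` U)) \<phi>"
proof
  assume *: "chart X U \<phi>"
  then have U: "openin X U" and sub: "topspace X \<inter> U = U"
    using openin_subset by (auto simp: chart_def)
  have "open (\<phi> ` U)"
    using * U unfolding chart_def by (metis Int_absorb)
  moreover have "homeomorphic_map (subtopology X U) (top_of_set (\<phi> ` U)) \<phi>"
  proof (rule bijective_open_imp_homeomorphic_map)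
    show "continuous_map (subtopology X U) (top_of_set (\<phi> ` U)) \<phi>"
      unfolding continuous_map_in_subtopology
    proof
      show "continuous_map (subtopology X U) euclidean \<phi>"
        unfolding continuous_map_def
      proof (intro conjI allI impI)
        fix W :: "'b set" assume "openin euclidean W"
        then have "openin X {p \<in> U. \<phi> p \<in> W}"
          using * by (simp add: chart_def)
        then show "openin (subtopology X U) {p \<in> topspace (subtopology X U). \<phi> p \<in> W}"
          by (simp add: sub openin_open_subtopology[OF U] Collect_conj_eq)
      qed auto
    qed (auto simp: sub)
    show "open_map (subtopology X U) (top_of_set (\<phi> ` U)) \<phi>"
      unfolding open_map_def
    proof (intro allI impI)
      fix A assume "openin (subtopology X U) A"
      then have A: "openin X A" "A \<subseteq> U"
        using U by (auto simp: openin_open_subtopology)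
      then have "open (\<phi> ` (U \<inter> A))" "U \<inter> A = A"
        using * by (auto simp: chart_def)
      then show "openin (top_of_set (\<phi> ` U)) (\<phi> ` A)"
        using A by (intro open_subset) auto
    qed
  qed (use * in \<open>auto simp: chart_def sub\<close>)
  ultimately show "openin X U \<and> open (\<phi> ` U) \<and>
      homeomorphic_map (subtopology X U) (top_of_set (\<phi> ` U)) \<phi>"
    using U by blast
next
  assume *: "openin X U \<and> open (\<phi> ` U) \<and>
      homeomorphic_map (subtopology X U) (top_of_set (\<phi> ` U)) \<phi>"
  then have U: "openin X U" and sub: "topspace X \<inter> U = U" and op: "open (\<phi> ` U)"
    using openin_subset by auto
  have inj: "inj_on \<phi> U"
    using * homeomorphic_imp_injective_map sub by (metis topspace_subtopology)
  have om: "open_map (subtopology X U) (top_of_set (\<phi> ` U)) \<phi>"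
    using * homeomorphic_imp_open_map by blast
  have cm: "continuous_map (subtopology X U) (top_of_set (\<phi> ` U)) \<phi>"
    using * homeomorphic_imp_continuous_map by blast
  show "chart X U \<phi>"
    unfolding chart_def
  proof (intro conjI allI impI U inj)
    fix A assume "openin X A"
    then have "openin (subtopology X U) (U \<inter> A)"
      using openin_subtopology_Int2 by blast
    then have "openin (top_of_set (\<phi> ` U)) (\<phi> ` (U \<inter> A))"
      using om by (simp add: open_map_def)
    then show "open (\<phi> ` (U \<inter> A))"
      using op openin_open_trans by blast
  next
    fix W :: "'b set" assume "open W"
    then have "openin (subtopology X U) {p \<in> topspace (subtopology X U). \<phi> p \<in> \<phi> ` U \<inter> W}"
      using cm by (intro openin_continuous_map_preimage) (auto simp: openin_open)
    then have "openin X {p \<in> topspace (subtopology X U). \<phi> p \<in> \<phi> ` U \<inter> W}"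
      using U openin_trans_full by blast
    moreover have "{p \<in> topspace (subtopology X U). \<phi> p \<in> \<phi> ` U \<inter> W} = {p \<in> U. \<phi> p \<in> W}"
      using sub by auto
    ultimately show "openin X {p \<in> U. \<phi> p \<in> W}" by simp
  qed
qed

lemma smooth_manifold_iff:
  "smooth_manifold M \<longleftrightarrow>
     Hausdorff_space (mtop M) \<and>
     (\<forall>(U, \<phi>) \<in> atlas M. chart (mtop M) U \<phi>) \<and>
     \<Union> (fst ` atlas M) = points M \<and>
     (\<forall>(U, \<phi>) \<in> atlas M. \<forall>(V, \<psi>) \<in> atlas M.
        \<exists>T. smooth_on (\<phi> ` (U \<inter> V)) T \<and> (\<forall>q \<in> U \<inter> V. T (\<phi> q) = \<psi> q))"
proof -
  have key: "smooth_on (\<phi> ` (U \<inter> V)) (\<psi> \<circ> inv_into U \<phi>) \<longleftrightarrow>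
      (\<exists>T. smooth_on (\<phi> ` (U \<inter> V)) T \<and> (\<forall>q \<in> U \<inter> V. T (\<phi> q) = \<psi> q))"
    if "chart (mtop M) U \<phi>" "chart (mtop M) V \<psi>" for U V \<phi> \<psi>
  proof -
    have inj: "inj_on \<phi> U" and op: "open (\<phi> ` (U \<inter> V))"
      using that by (auto simp: chart_def)
    show ?thesis
    proof
      assume "smooth_on (\<phi> ` (U \<inter> V)) (\<psi> \<circ> inv_into U \<phi>)"
      then show "\<exists>T. smooth_on (\<phi> ` (U \<inter> V)) T \<and> (\<forall>q \<in> U \<inter> V. T (\<phi> q) = \<psi> q)"
        using inj by (intro exI[of _ "\<psi> \<circ> inv_into U \<phi>"]) auto
    next
      assume "\<exists>T. smooth_on (\<phi> ` (U \<inter> V)) T \<and> (\<forall>q \<in> U \<inter> V. T (\<phi> q) = \<psi> q)"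
      then obtain T where T: "smooth_on (\<phi> ` (U \<inter> V)) T" "\<forall>q \<in> U \<inter> V. T (\<phi> q) = \<psi> q" by blast
      show "smooth_on (\<phi> ` (U \<inter> V)) (\<psi> \<circ> inv_into U \<phi>)"
        by (rule smooth_on_cong[OF op _ T(1)]) (use T(2) inj in auto)
    qed
  qed
  have "(\<forall>(U, \<phi>) \<in> atlas M. \<forall>(V, \<psi>) \<in> atlas M.
        smooth_on (\<phi> ` (U \<inter> V)) (\<psi> \<circ> inv_into U \<phi>)) \<longleftrightarrow>
      (\<forall>(U, \<phi>) \<in> atlas M. \<forall>(V, \<psi>) \<in> atlas M.
        \<exists>T. smooth_on (\<phi> ` (U \<inter> V)) T \<and> (\<forall>q \<in> U \<inter> V. T (\<phi> q) = \<psi> q))"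
    if "\<forall>(U, \<phi>) \<in> atlas M. chart (mtop M) U \<phi>"
    unfolding split_beta by (intro ball_cong refl key) (use that in auto)
  then show ?thesis
    unfolding smooth_manifold_def chart_iff_homeomorphic_map[symmetric]
    by (intro conj_cong refl) blast+
qed

lemma atlas_chart:
  assumes M: "smooth_manifold M" and U: "(U, \<phi>) \<in> atlas M"
  shows "chart (mtop M) U \<phi>"
proof -
  from M[unfolded smooth_manifold_iff] have "\<forall>(U, \<phi>) \<in> atlas M. chart (mtop M) U \<phi>"
    by (elim conjE)
  from bspec[OF this U] show ?thesis by simp
qed

lemma atlas_subset_points: "smooth_manifold M \<Longrightarrow> (U, \<phi>) \<in> atlas M \<Longrightarrow> U \<subseteq> points M"
  by (meson atlas_chart chart_def openin_subset)

lemma chart_openin: "chart X U \<phi> \<Longrightarrow> openin X U"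
  and chart_inj_on: "chart X U \<phi> \<Longrightarrow> inj_on \<phi> U"
  and chart_open_image_Int: "chart X U \<phi> \<Longrightarrow> openin X A \<Longrightarrow> open (\<phi> ` (U \<inter> A))"
  and chart_preimage: "chart X U \<phi> \<Longrightarrow> open W \<Longrightarrow> openin X {p \<in> U. \<phi> p \<in> W}"
  by (auto simp: chart_def)

lemma chart_open_image: "chart X U \<phi> \<Longrightarrow> open (\<phi> ` U)"
  using chart_iff_homeomorphic_map by blast

lemma atlas_transition:
  assumes M: "smooth_manifold M" and U: "(U, \<phi>) \<in> atlas M" and V: "(V, \<psi>) \<in> atlas M"
  obtains T where "smooth_on (\<phi> ` (U \<inter> V)) T" "\<And>q. q \<in> U \<Longrightarrow> q \<in> V \<Longrightarrow> T (\<phi> q) = \<psi> q"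
proof -
  from M[unfolded smooth_manifold_iff] have "\<forall>(U, \<phi>) \<in> atlas M. \<forall>(V, \<psi>) \<in> atlas M.
      \<exists>T. smooth_on (\<phi> ` (U \<inter> V)) T \<and> (\<forall>q \<in> U \<inter> V. T (\<phi> q) = \<psi> q)"
    by (elim conjE)
  from bspec[OF this U, unfolded prod.case, THEN bspec, OF V, unfolded prod.case] that
  show thesis by blast
qed

lemma atlas_covers:
  assumes "smooth_manifold M" "p \<in> points M"
  obtains U \<phi> where "(U, \<phi>) \<in> atlas M" "p \<in> U"
proof -
  have "p \<in> \<Union> (fst ` atlas M)"
    using assms by (simp add: smooth_manifold_def)
  then show thesis
    using that by auto
qed

lemma smooth_manifoldI:
  assumes "Hausdorff_space (mtop M)"
    and "\<And>U \<phi>. (U, \<phi>) \<in> atlas M \<Longrightarrow> chart (mtop M) U \<phi>"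
    and "\<And>p. p \<in> points M \<Longrightarrow> \<exists>U \<phi>. (U, \<phi>) \<in> atlas M \<and> p \<in> U"
    and trans: "\<And>U \<phi> V \<psi>. (U, \<phi>) \<in> atlas M \<Longrightarrow> (V, \<psi>) \<in> atlas M \<Longrightarrow>
      \<exists>T. smooth_on (\<phi> ` (U \<inter> V)) T \<and> (\<forall>q \<in> U \<inter> V. T (\<phi> q) = \<psi> q)"
  shows "smooth_manifold M"
  unfolding smooth_manifold_iff
proof (intro conjI)
  have "U \<subseteq> points M" if "(U, \<phi>) \<in> atlas M" for U \<phi>
    using assms(2)[OF that] openin_subset unfolding chart_def by blast
  moreover have "p \<in> \<Union> (fst ` atlas M)" if "p \<in> points M" for p
    using assms(3)[OF that] by force
  ultimately show "\<Union> (fst ` atlas M) = points M"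
    by (intro equalityI subsetI) (fastforce simp: image_iff)+
  show "\<forall>(U, \<phi>) \<in> atlas M. \<forall>(V, \<psi>) \<in> atlas M.
      \<exists>T. smooth_on (\<phi> ` (U \<inter> V)) T \<and> (\<forall>q \<in> U \<inter> V. T (\<phi> q) = \<psi> q)"
    by (intro ballI, clarify, rule trans)
qed (use assms in auto)

lemma smooth_on_empty: "smooth_on {} f"
proof -
  have "Ck_on k {} f" for k and f :: "'a \<Rightarrow> 'b"
    by (induction k arbitrary: f) (auto simp: Ck_on.simps(2))
  then show ?thesis by (simp add: smooth_on_def)
qed

section \<open>Open subsets, disjoint unions and products of manifolds\<close>

lemma atlas_open_submanifold_iff:
  "(V, \<phi>) \<in> atlas (open_submanifold M A) \<longleftrightarrow> (\<exists>V'. V = V' \<inter> A \<and> (V', \<phi>) \<in> atlas M)"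
  by (auto simp: open_submanifold_def)

lemma atlas_sum_manifold_iff:
  "(V, \<phi>) \<in> atlas (sum_manifold I M) \<longleftrightarrow>
     (\<exists>i V' \<phi>'. V = {i} \<times> V' \<and> \<phi> = \<phi>' \<circ> snd \<and> i \<in> I \<and> (V', \<phi>') \<in> atlas (M i))"
  by (auto simp: sum_manifold_def)

lemma atlas_prod_manifold_iff:
  "(W, \<xi>) \<in> atlas (prod_manifold M N) \<longleftrightarrow>
     (\<exists>U \<phi> V \<psi>. W = U \<times> V \<and> \<xi> = map_prod \<phi> \<psi> \<and> (U, \<phi>) \<in> atlas M \<and> (V, \<psi>) \<in> atlas N)"
  by (auto simp: prod_manifold_def)

lemma chart_open_subset:
  assumes V: "chart X V \<phi>" and A: "openin X A"
  shows "chart (subtopology X A) (V \<inter> A) \<phi>"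
  unfolding chart_def
proof (intro conjI allI impI)
  show "openin (subtopology X A) (V \<inter> A)"
    using chart_openin[OF V] openin_subtopology_Int by blast
  show "inj_on \<phi> (V \<inter> A)"
    using inj_on_subset[OF chart_inj_on[OF V]] by blast
next
  fix B assume "openin (subtopology X A) B"
  then have "openin X (A \<inter> B)"
    using A by (simp add: openin_open_subtopology inf.absorb2)
  then show "open (\<phi> ` (V \<inter> A \<inter> B))"
    using chart_open_image_Int[OF V] by (simp add: inf_assoc)
next
  fix W :: "'b set" assume "open W"
  moreover have "{p \<in> V \<inter> A. \<phi> p \<in> W} = {p \<in> V. \<phi> p \<in> W} \<inter> A" by auto
  ultimately show "openin (subtopology X A) {p \<in> V \<inter> A. \<phi> p \<in> W}"
    using chart_preimage[OF V] by (simp add: openin_subtopology_Int)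
qed

lemma smooth_manifold_open_submanifold:
  assumes M: "smooth_manifold M" and A: "openin (mtop M) A"
  shows "smooth_manifold (open_submanifold M A)"
proof (rule smooth_manifoldI)
  show "Hausdorff_space (mtop (open_submanifold M A))"
    using M by (simp add: smooth_manifold_def open_submanifold_def Hausdorff_space_subtopology)
next
  fix V \<phi> assume "(V, \<phi>) \<in> atlas (open_submanifold M A)"
  then obtain V' where "V = V' \<inter> A" "(V', \<phi>) \<in> atlas M"
    by (auto simp: atlas_open_submanifold_iff)
  then show "chart (mtop (open_submanifold M A)) V \<phi>"
    using chart_open_subset[OF atlas_chart[OF M] A] by (simp add: open_submanifold_def)
next
  fix p assume "p \<in> points (open_submanifold M A)"
  then have p: "p \<in> points M" "p \<in> A"
    by (auto simp: open_submanifold_def)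
  obtain V \<phi> where "(V, \<phi>) \<in> atlas M" "p \<in> V"
    using atlas_covers[OF M p(1)] by blast
  then show "\<exists>V \<phi>. (V, \<phi>) \<in> atlas (open_submanifold M A) \<and> p \<in> V"
    using p(2) unfolding atlas_open_submanifold_iff
    by (intro exI[of _ "V \<inter> A"] exI[of _ \<phi>]) blast
next
  fix U \<phi> V \<psi>
  assume "(U, \<phi>) \<in> atlas (open_submanifold M A)" "(V, \<psi>) \<in> atlas (open_submanifold M A)"
  then obtain U' V' where U: "U = U' \<inter> A" "(U', \<phi>) \<in> atlas M" and V: "V = V' \<inter> A" "(V', \<psi>) \<in> atlas M"
    unfolding atlas_open_submanifold_iff by blast
  obtain T where T: "smooth_on (\<phi> ` (U' \<inter> V')) T" "\<And>q. q \<in> U' \<Longrightarrow> q \<in> V' \<Longrightarrow> T (\<phi> q) = \<psi> q"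
    using atlas_transition[OF M U(2) V(2)] by blast
  show "\<exists>T. smooth_on (\<phi> ` (U \<inter> V)) T \<and> (\<forall>q \<in> U \<inter> V. T (\<phi> q) = \<psi> q)"
    by (rule exI[of _ T]) (use T(2) U(1) V(1) in \<open>auto intro: smooth_on_subset[OF T(1)]\<close>)
qed

lemma openin_sum_topology_piece:
  assumes "i \<in> I" "openin (X i) A"
  shows "openin (sum_topology X I) ({i} \<times> A)"
proof -
  have "{i} \<times> A = (\<lambda>x. (i, x)) ` A" by auto
  then show ?thesis
    using open_map_component_injection[OF assms(1), of X] assms(2) by (simp add: open_map_def)
qed

lemma chart_sum_topology:
  assumes i: "i \<in> I" and V: "chart (X i) V \<phi>"
  shows "chart (sum_topology X I) ({i} \<times> V) (\<phi> \<circ> snd)"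
  unfolding chart_def
proof (intro conjI allI impI)
  show "openin (sum_topology X I) ({i} \<times> V)"
    using openin_sum_topology_piece i chart_openin[OF V] by metis
  show "inj_on (\<phi> \<circ> snd) ({i} \<times> V)"
    using chart_inj_on[OF V] by (auto simp: inj_on_def)
next
  fix A assume "openin (sum_topology X I) A"
  then have "openin (X i) {x. (i, x) \<in> A}"
    using i by (simp add: openin_sum_topology)
  moreover have "(\<phi> \<circ> snd) ` (({i} \<times> V) \<inter> A) = \<phi> ` (V \<inter> {x. (i, x) \<in> A})"
    by force
  ultimately show "open ((\<phi> \<circ> snd) ` (({i} \<times> V) \<inter> A))"
    using chart_open_image_Int[OF V] by simp
next
  fix W :: "'c set" assume "open W"
  moreover have "{p \<in> {i} \<times> V. (\<phi> \<circ> snd) p \<in> W} = {i} \<times> {p \<in> V. \<phi> p \<in> W}" by auto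
  ultimately show "openin (sum_topology X I) {p \<in> {i} \<times> V. (\<phi> \<circ> snd) p \<in> W}"
    using openin_sum_topology_piece[of i I X] i chart_preimage[OF V] by simp
qed

lemma Hausdorff_space_sum_topology:
  assumes "\<And>i. i \<in> I \<Longrightarrow> Hausdorff_space (X i)"
  shows "Hausdorff_space (sum_topology X I)"
  unfolding Hausdorff_space_def
proof (intro allI impI)
  fix p q
  assume *: "p \<in> topspace (sum_topology X I) \<and> q \<in> topspace (sum_topology X I) \<and> p \<noteq> q"
  obtain i x where p: "p = (i, x)" "i \<in> I" "x \<in> topspace (X i)"
    using * by auto
  obtain k y where q: "q = (k, y)" "k \<in> I" "y \<in> topspace (X k)"
    using * by auto
  show "\<exists>A B. openin (sum_topology X I) A \<and> openin (sum_topology X I) B \<and>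
      p \<in> A \<and> q \<in> B \<and> disjnt A B"
  proof (cases "i = k")
    case True
    then obtain A B where "openin (X i) A" "openin (X i) B" "x \<in> A" "y \<in> B" "disjnt A B"
      using assms[OF p(2), unfolded Hausdorff_space_def, rule_format, of x y] * p q by auto
    then show ?thesis
      using p q True openin_sum_topology_piece[of i I X]
      by (intro exI[of _ "{i} \<times> A"] exI[of _ "{i} \<times> B"]) (auto simp: disjnt_def)
  next
    case False
    then show ?thesis
      using p q openin_sum_topology_piece[of _ I X]
      by (intro exI[of _ "{i} \<times> topspace (X i)"] exI[of _ "{k} \<times> topspace (X k)"])
        (auto simp: disjnt_def)
  qed
qed

lemma smooth_manifold_sum_manifold:
  assumes M: "\<And>i. i \<in> I \<Longrightarrow> smooth_manifold (M i)"
  shows "smooth_manifold (sum_manifold I M)"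
proof (rule smooth_manifoldI)
  show "Hausdorff_space (mtop (sum_manifold I M))"
    using M by (simp add: sum_manifold_def Hausdorff_space_sum_topology smooth_manifold_def)
next
  fix V \<phi> assume "(V, \<phi>) \<in> atlas (sum_manifold I M)"
  then obtain i V' \<phi>' where "V = {i} \<times> V'" "\<phi> = \<phi>' \<circ> snd" "i \<in> I" "(V', \<phi>') \<in> atlas (M i)"
    unfolding atlas_sum_manifold_iff by blast
  then show "chart (mtop (sum_manifold I M)) V \<phi>"
    using chart_sum_topology[of i I "\<lambda>i. mtop (M i)" V' \<phi>'] atlas_chart[OF M, of i V' \<phi>']
    by (simp add: sum_manifold_def)
next
  fix p assume "p \<in> points (sum_manifold I M)"
  then obtain i x where p: "p = (i, x)" "i \<in> I" "x \<in> points (M i)"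
    by (auto simp: sum_manifold_def)
  obtain V \<phi> where "(V, \<phi>) \<in> atlas (M i)" "x \<in> V"
    using atlas_covers[OF M[OF p(2)] p(3)] by blast
  then show "\<exists>V \<phi>. (V, \<phi>) \<in> atlas (sum_manifold I M) \<and> p \<in> V"
    using p unfolding atlas_sum_manifold_iff
    by (intro exI[of _ "{i} \<times> V"] exI[of _ "\<phi> \<circ> snd"]) blast
next
  fix U \<phi> V \<psi>
  assume "(U, \<phi>) \<in> atlas (sum_manifold I M)" "(V, \<psi>) \<in> atlas (sum_manifold I M)"
  then obtain i U' \<phi>' k V' \<psi>' where
    U: "U = {i} \<times> U'" "\<phi> = \<phi>' \<circ> snd" "i \<in> I" "(U', \<phi>') \<in> atlas (M i)" and
    V: "V = {k} \<times> V'" "\<psi> = \<psi>' \<circ> snd" "k \<in> I" "(V', \<psi>') \<in> atlas (M k)"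
    unfolding atlas_sum_manifold_iff by blast
  show "\<exists>T. smooth_on (\<phi> ` (U \<inter> V)) T \<and> (\<forall>q \<in> U \<inter> V. T (\<phi> q) = \<psi> q)"
  proof (cases "i = k")
    case True
    then have V': "(V', \<psi>') \<in> atlas (M i)" using V by simp
    obtain T where T: "smooth_on (\<phi>' ` (U' \<inter> V')) T"
      "\<And>q. q \<in> U' \<Longrightarrow> q \<in> V' \<Longrightarrow> T (\<phi>' q) = \<psi>' q"
      using atlas_transition[OF M[OF U(3)] U(4) V'] by blast
    show ?thesis
      by (rule exI[of _ T]) (use T(2) U V in \<open>auto intro!: smooth_on_subset[OF T(1)]\<close>)
  next
    case False
    \<comment> \<open>Charts of different components do not overlap, so every map is a transition
      between them.\<close>
    then have "U \<inter> V = {}" using U V by auto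
    then show ?thesis
      by (simp add: smooth_on_empty)
  qed
qed

lemma chart_map_prod:
  assumes U: "chart X U \<phi>" and V: "chart Y V \<psi>"
  shows "chart (prod_topology X Y) (U \<times> V) (map_prod \<phi> \<psi>)"
  unfolding chart_def
proof (intro conjI allI impI)
  show "openin (prod_topology X Y) (U \<times> V)"
    using U V by (simp add: openin_prod_Times_iff chart_openin)
  show "inj_on (map_prod \<phi> \<psi>) (U \<times> V)"
    using U V by (intro map_prod_inj_on chart_inj_on)
next
  fix A assume A: "openin (prod_topology X Y) A"
  show "open (map_prod \<phi> \<psi> ` ((U \<times> V) \<inter> A))"
    unfolding open_prod_def
  proof
    fix z assume "z \<in> map_prod \<phi> \<psi> ` ((U \<times> V) \<inter> A)"
    then obtain p q where pq: "p \<in> U" "q \<in> V" "(p, q) \<in> A" "z = (\<phi> p, \<psi> q)" by auto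
    then obtain C D where CD: "openin X C" "openin Y D" "p \<in> C" "q \<in> D" "C \<times> D \<subseteq> A"
      using A[unfolded openin_prod_topology_alt, rule_format, OF pq(3)] by blast
    show "\<exists>C D. open C \<and> open D \<and> z \<in> C \<times> D \<and> C \<times> D \<subseteq> map_prod \<phi> \<psi> ` ((U \<times> V) \<inter> A)"
    proof (intro exI conjI)
      show "open (\<phi> ` (U \<inter> C))" "open (\<psi> ` (V \<inter> D))"
        using chart_open_image_Int U V CD by blast+
      show "\<phi> ` (U \<inter> C) \<times> \<psi> ` (V \<inter> D) \<subseteq> map_prod \<phi> \<psi> ` ((U \<times> V) \<inter> A)"
        using CD(5) by (auto intro: rev_image_eqI)
    qed (use pq CD in auto)
  qed
next
  fix W :: "('b \<times> 'd) set" assume W: "open W"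
  show "openin (prod_topology X Y) {p \<in> U \<times> V. map_prod \<phi> \<psi> p \<in> W}"
    unfolding openin_prod_topology_alt
  proof (intro allI impI)
    fix p q assume pq: "(p, q) \<in> {p \<in> U \<times> V. map_prod \<phi> \<psi> p \<in> W}"
    then have "(\<phi> p, \<psi> q) \<in> W" by auto
    then obtain C D where CD: "open C" "open D" "(\<phi> p, \<psi> q) \<in> C \<times> D" "C \<times> D \<subseteq> W"
      using open_prod_elim[OF W] by metis
    show "\<exists>C D. openin X C \<and> openin Y D \<and> p \<in> C \<and> q \<in> D \<and>
        C \<times> D \<subseteq> {p \<in> U \<times> V. map_prod \<phi> \<psi> p \<in> W}"
      using pq CD chart_preimage[OF U CD(1)] chart_preimage[OF V CD(2)]
      by (intro exI[of _ "{p \<in> U. \<phi> p \<in> C}"] exI[of _ "{p \<in> V. \<psi> p \<in> D}"]) auto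
  qed
qed

lemma smooth_manifold_prod_manifold:
  assumes M: "smooth_manifold M" and N: "smooth_manifold N"
  shows "smooth_manifold (prod_manifold M N)"
proof (rule smooth_manifoldI)
  show "Hausdorff_space (mtop (prod_manifold M N))"
    using M N by (simp add: smooth_manifold_def prod_manifold_def Hausdorff_space_prod_topology)
next
  fix W \<xi> assume "(W, \<xi>) \<in> atlas (prod_manifold M N)"
  then obtain U \<phi> V \<psi> where "W = U \<times> V" "\<xi> = map_prod \<phi> \<psi>" "(U, \<phi>) \<in> atlas M" "(V, \<psi>) \<in> atlas N"
    unfolding atlas_prod_manifold_iff by blast
  then show "chart (mtop (prod_manifold M N)) W \<xi>"
    using chart_map_prod[OF atlas_chart[OF M] atlas_chart[OF N]] by (simp add: prod_manifold_def)
next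
  fix p assume "p \<in> points (prod_manifold M N)"
  then have p: "fst p \<in> points M" "snd p \<in> points N"
    by (auto simp: prod_manifold_def)
  obtain U \<phi> where "(U, \<phi>) \<in> atlas M" "fst p \<in> U"
    using atlas_covers[OF M p(1)] by blast
  moreover obtain V \<psi> where "(V, \<psi>) \<in> atlas N" "snd p \<in> V"
    using atlas_covers[OF N p(2)] by blast
  ultimately show "\<exists>W \<xi>. (W, \<xi>) \<in> atlas (prod_manifold M N) \<and> p \<in> W"
    unfolding atlas_prod_manifold_iff
    by (intro exI[of _ "U \<times> V"] exI[of _ "map_prod \<phi> \<psi>"]) (auto simp: mem_Times_iff)
next
  fix W \<xi> W' \<xi>'
  assume "(W, \<xi>) \<in> atlas (prod_manifold M N)" "(W', \<xi>') \<in> atlas (prod_manifold M N)"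
  then obtain U \<phi> U' \<phi>' V \<psi> V' \<psi>' where
    W: "W = U \<times> U'" "\<xi> = map_prod \<phi> \<phi>'" and W': "W' = V \<times> V'" "\<xi>' = map_prod \<psi> \<psi>'" and
    UV: "(U, \<phi>) \<in> atlas M" "(V, \<psi>) \<in> atlas M" and UV': "(U', \<phi>') \<in> atlas N" "(V', \<psi>') \<in> atlas N"
    unfolding atlas_prod_manifold_iff by blast
  obtain T where T: "smooth_on (\<phi> ` (U \<inter> V)) T" "\<And>q. q \<in> U \<Longrightarrow> q \<in> V \<Longrightarrow> T (\<phi> q) = \<psi> q"
    using atlas_transition[OF M UV] by blast
  obtain T' where T': "smooth_on (\<phi>' ` (U' \<inter> V')) T'"
    "\<And>q. q \<in> U' \<Longrightarrow> q \<in> V' \<Longrightarrow> T' (\<phi>' q) = \<psi>' q"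
    using atlas_transition[OF N UV'] by blast
  let ?S = "\<phi> ` (U \<inter> V)" and ?S' = "\<phi>' ` (U' \<inter> V')"
  have op: "open ?S" "open ?S'"
    using chart_open_image_Int[OF atlas_chart[OF M UV(1)] chart_openin[OF atlas_chart[OF M UV(2)]]]
      chart_open_image_Int[OF atlas_chart[OF N UV'(1)] chart_openin[OF atlas_chart[OF N UV'(2)]]]
    by auto
  have "smooth_on (?S \<times> ?S') (\<lambda>z. T (fst z))"
    by (rule smooth_on_compose[OF _ op(1) _ T(1)])
      (auto intro!: smooth_on_bounded_linear bounded_linear_fst open_Times op)
  moreover have "smooth_on (?S \<times> ?S') (\<lambda>z. T' (snd z))"
    by (rule smooth_on_compose[OF _ op(2) _ T'(1)])
      (auto intro!: smooth_on_bounded_linear bounded_linear_snd open_Times op)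
  ultimately have "smooth_on (?S \<times> ?S') (\<lambda>z. (T (fst z), T' (snd z)))"
    by (intro smooth_on_Pair open_Times op)
  moreover have "\<xi> ` (W \<inter> W') \<subseteq> ?S \<times> ?S'"
    using W W' by auto
  ultimately have "smooth_on (\<xi> ` (W \<inter> W')) (\<lambda>z. (T (fst z), T' (snd z)))"
    by (rule smooth_on_subset)
  then show "\<exists>T. smooth_on (\<xi> ` (W \<inter> W')) T \<and> (\<forall>q \<in> W \<inter> W'. T (\<xi> q) = \<xi>' q)"
    using T(2) T'(2) W W' by (intro exI[of _ "\<lambda>z. (T (fst z), T' (snd z))"]) auto
qed

section \<open>Smooth maps between manifolds\<close>

lemma smooth_on_subset_points:
  "smooth_on_subset M S N f \<Longrightarrow> S \<subseteq> points M" "smooth_on_subset M S N f \<Longrightarrow> f ` S \<subseteq> points N"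
  unfolding smooth_on_subset_def by blast+

lemma smooth_on_subsetI:
  assumes "S \<subseteq> points M" "f ` S \<subseteq> points N"
    and "\<And>p. p \<in> S \<Longrightarrow> \<exists>U \<phi> V \<psi> W F. (U, \<phi>) \<in> atlas M \<and> (V, \<psi>) \<in> atlas N \<and>
        p \<in> U \<and> open W \<and> \<phi> p \<in> W \<and> W \<subseteq> \<phi> ` U \<and> smooth_on W F \<and>
        (\<forall>q \<in> S \<inter> U. \<phi> q \<in> W \<longrightarrow> f q \<in> V \<and> \<psi> (f q) = F (\<phi> q))"
  shows "smooth_on_subset M S N f"
  unfolding smooth_on_subset_def
proof (intro conjI ballI assms(1,2))
  fix p assume "p \<in> S"
  from assms(3)[OF this] obtain U \<phi> V \<psi> W F where *: "(U, \<phi>) \<in> atlas M" "(V, \<psi>) \<in> atlas N"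
    "p \<in> U \<and> open W \<and> \<phi> p \<in> W \<and> W \<subseteq> \<phi> ` U \<and> smooth_on W F \<and>
        (\<forall>q \<in> S \<inter> U. \<phi> q \<in> W \<longrightarrow> f q \<in> V \<and> \<psi> (f q) = F (\<phi> q))" by blast
  show "\<exists>(U, \<phi>) \<in> atlas M. \<exists>(V, \<psi>) \<in> atlas N. \<exists>W F.
        p \<in> U \<and> open W \<and> \<phi> p \<in> W \<and> W \<subseteq> \<phi> ` U \<and> smooth_on W F \<and>
        (\<forall>q \<in> S \<inter> U. \<phi> q \<in> W \<longrightarrow> f q \<in> V \<and> \<psi> (f q) = F (\<phi> q))"
    by (rule bexI[OF _ *(1)], unfold prod.case, rule bexI[OF _ *(2)], unfold prod.case)
      (intro exI, rule *(3))
qed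

lemma smooth_on_subsetE:
  assumes "smooth_on_subset M S N f" "p \<in> S"
  obtains U \<phi> V \<psi> W F where "(U, \<phi>) \<in> atlas M" "(V, \<psi>) \<in> atlas N"
    "p \<in> U" "open W" "\<phi> p \<in> W" "W \<subseteq> \<phi> ` U" "smooth_on W F"
    "\<And>q. q \<in> S \<Longrightarrow> q \<in> U \<Longrightarrow> \<phi> q \<in> W \<Longrightarrow> f q \<in> V \<and> \<psi> (f q) = F (\<phi> q)"
proof -
  from assms have "\<exists>(U, \<phi>) \<in> atlas M. \<exists>(V, \<psi>) \<in> atlas N. \<exists>W F.
        p \<in> U \<and> open W \<and> \<phi> p \<in> W \<and> W \<subseteq> \<phi> ` U \<and> smooth_on W F \<and>
        (\<forall>q \<in> S \<inter> U. \<phi> q \<in> W \<longrightarrow> f q \<in> V \<and> \<psi> (f q) = F (\<phi> q))"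
    unfolding smooth_on_subset_def by (elim conjE) (erule bspec)
  then obtain UU VV W F where "UU \<in> atlas M" "VV \<in> atlas N" "p \<in> fst UU" "open W"
    "snd UU p \<in> W" "W \<subseteq> snd UU ` fst UU" "smooth_on W F"
    "\<forall>q \<in> S \<inter> fst UU. snd UU q \<in> W \<longrightarrow> f q \<in> fst VV \<and> snd VV (f q) = F (snd UU q)"
    unfolding split_beta by (elim bexE exE conjE)
  then show thesis
    by (intro that[of "fst UU" "snd UU" "fst VV" "snd VV" W F]) simp_all
qed

text \<open>The definition of smoothness offers one unknown pair of charts at \<open>p\<close>;
  conjugating its local extension \<open>F'\<close> with the transition maps \<open>T\<close> and
  \<open>R\<close> and shrinking the domain moves it to any prescribed pair. Composition and pairing
  depend on this freedom of choice.\<close>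

lemma smooth_on_subset_in_charts:
  assumes M: "smooth_manifold M" and N: "smooth_manifold N" and f: "smooth_on_subset M S N f"
    and p: "p \<in> S" and U: "(U, \<phi>) \<in> atlas M" "p \<in> U" and V: "(V, \<psi>) \<in> atlas N" "f p \<in> V"
  obtains W F where "open W" "\<phi> p \<in> W" "W \<subseteq> \<phi> ` U" "smooth_on W F"
    "\<And>q. q \<in> S \<Longrightarrow> q \<in> U \<Longrightarrow> \<phi> q \<in> W \<Longrightarrow> f q \<in> V \<and> \<psi> (f q) = F (\<phi> q)"
proof -
  obtain U' \<phi>' V' \<psi>' W' F' where
    U': "(U', \<phi>') \<in> atlas M" and V': "(V', \<psi>') \<in> atlas N" and pU': "p \<in> U'" and
    W': "open W'" "\<phi>' p \<in> W'" "W' \<subseteq> \<phi>' ` U'" "smooth_on W' F'" and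
    F': "\<And>q. q \<in> S \<Longrightarrow> q \<in> U' \<Longrightarrow> \<phi>' q \<in> W' \<Longrightarrow> f q \<in> V' \<and> \<psi>' (f q) = F' (\<phi>' q)"
    using smooth_on_subsetE[OF f p] by metis
  note cU = atlas_chart[OF M U(1)] and cU' = atlas_chart[OF M U']
  note cV = atlas_chart[OF N V(1)] and cV' = atlas_chart[OF N V']
  obtain T where T: "smooth_on (\<phi> ` (U \<inter> U')) T" "\<And>q. q \<in> U \<Longrightarrow> q \<in> U' \<Longrightarrow> T (\<phi> q) = \<phi>' q"
    using atlas_transition[OF M U(1) U'] by blast
  obtain R where R: "smooth_on (\<psi>' ` (V' \<inter> V)) R" "\<And>q. q \<in> V' \<Longrightarrow> q \<in> V \<Longrightarrow> R (\<psi>' q) = \<psi> q"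
    using atlas_transition[OF N V' V(1)] by blast
  have oU: "open (\<phi> ` (U \<inter> U'))" and oV: "open (\<psi>' ` (V' \<inter> V))"
    using chart_open_image_Int cU cU' cV cV' chart_openin by blast+
  define A where "A = W' \<inter> F' -` (\<psi>' ` (V' \<inter> V))"
  define W where "W = \<phi> ` (U \<inter> U') \<inter> T -` A"
  have oA: "open A"
    unfolding A_def using continuous_on_open_vimage[OF W'(1)] smooth_on_imp_continuous_on[OF W'(4)] oV
    by (metis Int_commute)
  have oW: "open W"
    unfolding W_def using continuous_on_open_vimage[OF oU] smooth_on_imp_continuous_on[OF T(1)] oA
    by (metis Int_commute)
  have "smooth_on A (\<lambda>z. R (F' z))"
    by (rule smooth_on_compose[OF oA oV smooth_on_subset[OF W'(4)] R(1)]) (auto simp: A_def)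
  then have "smooth_on W (\<lambda>y. R (F' (T y)))"
    by (intro smooth_on_compose[OF oW oA smooth_on_subset[OF T(1)]]) (auto simp: W_def)
  moreover have "f q \<in> V \<and> \<psi> (f q) = R (F' (T (\<phi> q)))" if q: "q \<in> S" "q \<in> U" "\<phi> q \<in> W" for q
  proof -
    have "q \<in> U'"
      using q chart_inj_on[OF cU] unfolding W_def inj_on_def by blast
    then have Tq: "T (\<phi> q) = \<phi>' q"
      using T(2) q by blast
    then have "\<phi>' q \<in> A"
      using q by (simp add: W_def)
    then have fq: "f q \<in> V'" "\<psi>' (f q) = F' (\<phi>' q)" and "F' (\<phi>' q) \<in> \<psi>' ` (V' \<inter> V)"
      using F'[OF q(1) \<open>q \<in> U'\<close>] by (auto simp: A_def)
    then have "f q \<in> V"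
      using chart_inj_on[OF cV'] unfolding inj_on_def by (metis Int_iff image_iff)
    then show ?thesis
      using R(2) fq Tq by metis
  qed
  moreover have "\<phi> p \<in> W"
  proof -
    have "T (\<phi> p) = \<phi>' p"
      using T(2) U(2) pU' by blast
    moreover have "\<phi>' p \<in> A"
      using F'[OF p pU' W'(2)] W'(2) V(2) unfolding A_def by (metis IntI image_eqI vimageI)
    ultimately show ?thesis
      using U(2) pU' by (simp add: W_def)
  qed
  moreover have "W \<subseteq> \<phi> ` U"
    by (auto simp: W_def)
  ultimately show thesis
    using that oW by blast
qed

lemma smooth_on_subset_cong:
  assumes f: "smooth_on_subset M S N f" and eq: "\<And>p. p \<in> S \<Longrightarrow> f p = g p"
  shows "smooth_on_subset M S N g"
proof (rule smooth_on_subsetI)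
  show "S \<subseteq> points M" "g ` S \<subseteq> points N"
    using smooth_on_subset_points[OF f] eq by force+
next
  fix p assume "p \<in> S"
  from smooth_on_subsetE[OF f this] obtain U \<phi> V \<psi> W F where
    U: "(U, \<phi>) \<in> atlas M" and V: "(V, \<psi>) \<in> atlas N" and pU: "p \<in> U" and
    W: "open W" "\<phi> p \<in> W" "W \<subseteq> \<phi> ` U" "smooth_on W F" and
    F: "\<And>q. q \<in> S \<Longrightarrow> q \<in> U \<Longrightarrow> \<phi> q \<in> W \<Longrightarrow> f q \<in> V \<and> \<psi> (f q) = F (\<phi> q)" by metis
  have *: "\<forall>q \<in> S \<inter> U. \<phi> q \<in> W \<longrightarrow> g q \<in> V \<and> \<psi> (g q) = F (\<phi> q)"
    using F eq by (metis IntD1 IntD2)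
  show "\<exists>U \<phi> V \<psi> W F. (U, \<phi>) \<in> atlas M \<and> (V, \<psi>) \<in> atlas N \<and>
        p \<in> U \<and> open W \<and> \<phi> p \<in> W \<and> W \<subseteq> \<phi> ` U \<and> smooth_on W F \<and>
        (\<forall>q \<in> S \<inter> U. \<phi> q \<in> W \<longrightarrow> g q \<in> V \<and> \<psi> (g q) = F (\<phi> q))"
    by (intro exI conjI, rule U, rule V, rule pU, rule W(1), rule W(2), rule W(3), rule W(4), rule *)
qed

text \<open>One chart at \<open>f p\<close> is used both as target chart for \<open>f\<close> and as
  source chart for \<open>g\<close>, so that the two local extensions compose on the preimage of the
  second domain.\<close>

lemma smooth_on_subset_compose:
  assumes M: "smooth_manifold M" and N: "smooth_manifold N" and L: "smooth_manifold L"
    and f: "smooth_on_subset M S N f" and g: "smooth_on_subset N T L g" and ST: "f ` S \<subseteq> T"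
  shows "smooth_on_subset M S L (\<lambda>x. g (f x))"
proof (rule smooth_on_subsetI)
  show "S \<subseteq> points M"
    using smooth_on_subset_points(1)[OF f] .
  show "(\<lambda>x. g (f x)) ` S \<subseteq> points L"
    using smooth_on_subset_points(2)[OF g] ST by blast
next
  fix p assume p: "p \<in> S"
  then have fp: "f p \<in> T" using ST by blast
  obtain U \<phi> where U: "(U, \<phi>) \<in> atlas M" "p \<in> U"
    using atlas_covers[OF M] smooth_on_subset_points(1)[OF f] p by blast
  obtain V \<psi> where V: "(V, \<psi>) \<in> atlas N" "f p \<in> V"
    using atlas_covers[OF N] smooth_on_subset_points(2)[OF f] p by blast
  obtain Z \<zeta> where Z: "(Z, \<zeta>) \<in> atlas L" "g (f p) \<in> Z"
    using atlas_covers[OF L] smooth_on_subset_points(2)[OF g] fp by blast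
  obtain W F where W: "open W" "\<phi> p \<in> W" "W \<subseteq> \<phi> ` U" "smooth_on W F"
    and F: "\<And>q. q \<in> S \<Longrightarrow> q \<in> U \<Longrightarrow> \<phi> q \<in> W \<Longrightarrow> f q \<in> V \<and> \<psi> (f q) = F (\<phi> q)"
    using smooth_on_subset_in_charts[OF M N f p U V] by blast
  obtain W' F' where W': "open W'" "\<psi> (f p) \<in> W'" "W' \<subseteq> \<psi> ` V" "smooth_on W' F'"
    and F': "\<And>q. q \<in> T \<Longrightarrow> q \<in> V \<Longrightarrow> \<psi> q \<in> W' \<Longrightarrow> g q \<in> Z \<and> \<zeta> (g q) = F' (\<psi> q)"
    using smooth_on_subset_in_charts[OF N L g fp V Z] by blast
  define A where "A = W \<inter> F -` W'"
  have oA: "open A"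
    unfolding A_def using continuous_on_open_vimage[OF W(1)] smooth_on_imp_continuous_on[OF W(4)] W'(1)
    by (metis Int_commute)
  have sA: "smooth_on A (\<lambda>y. F' (F y))"
    by (rule smooth_on_compose[OF oA W'(1) smooth_on_subset[OF W(4)] W'(4)]) (auto simp: A_def)
  have pA: "\<phi> p \<in> A"
    using W(2) W'(2) F[OF p U(2) W(2)] by (simp add: A_def)
  have eA: "\<forall>q\<in>S \<inter> U. \<phi> q \<in> A \<longrightarrow> g (f q) \<in> Z \<and> \<zeta> (g (f q)) = F' (F (\<phi> q))"
  proof (intro ballI impI)
    fix q assume q: "q \<in> S \<inter> U" "\<phi> q \<in> A"
    then have "f q \<in> V" "\<psi> (f q) = F (\<phi> q)" "f q \<in> T"
      using F ST by (auto simp: A_def)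
    then show "g (f q) \<in> Z \<and> \<zeta> (g (f q)) = F' (F (\<phi> q))"
      using F'[of "f q"] q by (simp add: A_def)
  qed
  show "\<exists>U \<phi> V \<psi> W F. (U, \<phi>) \<in> atlas M \<and> (V, \<psi>) \<in> atlas L \<and>
        p \<in> U \<and> open W \<and> \<phi> p \<in> W \<and> W \<subseteq> \<phi> ` U \<and> smooth_on W F \<and>
        (\<forall>q \<in> S \<inter> U. \<phi> q \<in> W \<longrightarrow> g (f q) \<in> V \<and> \<psi> (g (f q)) = F (\<phi> q))"
    by (intro exI conjI, rule U(1), rule Z(1), rule U(2), rule oA, rule pA, use W(3) in \<open>simp add: A_def le_infI1\<close>,
        rule sA, rule eA)
qed

lemma smooth_on_subset_Pair:
  assumes M: "smooth_manifold M" and N: "smooth_manifold N" and L: "smooth_manifold L"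
    and f: "smooth_on_subset M S N f" and g: "smooth_on_subset M S L g"
  shows "smooth_on_subset M S (prod_manifold N L) (\<lambda>x. (f x, g x))"
proof (rule smooth_on_subsetI)
  show "S \<subseteq> points M"
    using smooth_on_subset_points(1)[OF f] .
  show "(\<lambda>x. (f x, g x)) ` S \<subseteq> points (prod_manifold N L)"
    using smooth_on_subset_points(2)[OF f] smooth_on_subset_points(2)[OF g]
    by (auto simp: prod_manifold_def)
next
  fix p assume p: "p \<in> S"
  obtain U \<phi> where U: "(U, \<phi>) \<in> atlas M" "p \<in> U"
    using atlas_covers[OF M] smooth_on_subset_points(1)[OF f] p by blast
  obtain V \<psi> where V: "(V, \<psi>) \<in> atlas N" "f p \<in> V"
    using atlas_covers[OF N] smooth_on_subset_points(2)[OF f] p by blast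
  obtain Z \<zeta> where Z: "(Z, \<zeta>) \<in> atlas L" "g p \<in> Z"
    using atlas_covers[OF L] smooth_on_subset_points(2)[OF g] p by blast
  obtain W F where W: "open W" "\<phi> p \<in> W" "W \<subseteq> \<phi> ` U" "smooth_on W F"
    and F: "\<And>q. q \<in> S \<Longrightarrow> q \<in> U \<Longrightarrow> \<phi> q \<in> W \<Longrightarrow> f q \<in> V \<and> \<psi> (f q) = F (\<phi> q)"
    using smooth_on_subset_in_charts[OF M N f p U V] by blast
  obtain W' F' where W': "open W'" "\<phi> p \<in> W'" "W' \<subseteq> \<phi> ` U" "smooth_on W' F'"
    and F': "\<And>q. q \<in> S \<Longrightarrow> q \<in> U \<Longrightarrow> \<phi> q \<in> W' \<Longrightarrow> g q \<in> Z \<and> \<zeta> (g q) = F' (\<phi> q)"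
    using smooth_on_subset_in_charts[OF M L g p U Z] by blast
  have 1: "(V \<times> Z, map_prod \<psi> \<zeta>) \<in> atlas (prod_manifold N L)"
    using V(1) Z(1) by (auto simp: prod_manifold_def)
  have 2: "smooth_on (W \<inter> W') (\<lambda>y. (F y, F' y))"
    using W W' by (intro smooth_on_Pair) (auto intro: smooth_on_subset)
  have 3: "\<forall>q\<in>S \<inter> U. \<phi> q \<in> W \<inter> W' \<longrightarrow> (f q, g q) \<in> V \<times> Z \<and>
      map_prod \<psi> \<zeta> (f q, g q) = (F (\<phi> q), F' (\<phi> q))"
    using F F' by simp
  show "\<exists>U \<phi> V \<psi> W F. (U, \<phi>) \<in> atlas M \<and> (V, \<psi>) \<in> atlas (prod_manifold N L) \<and>
        p \<in> U \<and> open W \<and> \<phi> p \<in> W \<and> W \<subseteq> \<phi> ` U \<and> smooth_on W F \<and>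
        (\<forall>q \<in> S \<inter> U. \<phi> q \<in> W \<longrightarrow> (f q, g q) \<in> V \<and> \<psi> (f q, g q) = F (\<phi> q))"
    by (intro exI conjI, rule U(1), rule 1, rule U(2), rule open_Int[OF W(1) W'(1)],
        rule IntI[OF W(2) W'(2)], rule le_infI1[OF W(3)], rule 2, rule 3)
qed

text \<open>Serves projections, the identity and the forgetting of an index: in matching charts
  these are restrictions of bounded linear maps, so the local extension can be the linear map
  itself.\<close>

lemma smooth_on_subset_linear_charts:
  assumes M: "smooth_manifold M" and S: "S \<subseteq> points M" "f ` S \<subseteq> points N"
    and charts: "\<And>p. p \<in> S \<Longrightarrow> \<exists>U \<phi> V \<psi> L. (U, \<phi>) \<in> atlas M \<and> (V, \<psi>) \<in> atlas N \<and> p \<in> U \<and>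
      bounded_linear L \<and> (\<forall>q\<in>S \<inter> U. f q \<in> V \<and> \<psi> (f q) = L (\<phi> q))"
  shows "smooth_on_subset M S N f"
proof (rule smooth_on_subsetI[OF S])
  fix p assume "p \<in> S"
  from charts[OF this] obtain U \<phi> V \<psi> L where U: "(U, \<phi>) \<in> atlas M" "p \<in> U" and V: "(V, \<psi>) \<in> atlas N"
    and L: "bounded_linear L" "\<forall>q\<in>S \<inter> U. f q \<in> V \<and> \<psi> (f q) = L (\<phi> q)" by blast
  note op = chart_open_image[OF atlas_chart[OF M U(1)]]
  have 1: "\<forall>q\<in>S \<inter> U. \<phi> q \<in> \<phi> ` U \<longrightarrow> f q \<in> V \<and> \<psi> (f q) = L (\<phi> q)"
    using L(2) by blast
  show "\<exists>U \<phi> V \<psi> W F. (U, \<phi>) \<in> atlas M \<and> (V, \<psi>) \<in> atlas N \<and>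
        p \<in> U \<and> open W \<and> \<phi> p \<in> W \<and> W \<subseteq> \<phi> ` U \<and> smooth_on W F \<and>
        (\<forall>q \<in> S \<inter> U. \<phi> q \<in> W \<longrightarrow> f q \<in> V \<and> \<psi> (f q) = F (\<phi> q))"
    by (intro exI conjI, rule U(1), rule V, rule U(2), rule op, rule imageI[OF U(2)],
        rule order_refl, rule smooth_on_bounded_linear[OF L(1) op], rule 1)
qed

text \<open>The chart representative agrees with \<open>L\<close> on the open chart image, hence has
  derivative \<open>L\<close> at every point there; surjectivity of the derivative is that of
  \<open>L\<close>.\<close>

lemma surjective_submersion_linear_charts:
  assumes M: "smooth_manifold M" and surj: "f ` points M = points N"
    and charts: "\<And>p. p \<in> points M \<Longrightarrow> \<exists>U \<phi> V \<psi> L. (U, \<phi>) \<in> atlas M \<and> (V, \<psi>) \<in> atlas N \<and> p \<in> U \<and>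
      bounded_linear L \<and> surj L \<and> (\<forall>q\<in>U. f q \<in> V \<and> \<psi> (f q) = L (\<phi> q))"
  shows "surjective_submersion M N f"
  unfolding surjective_submersion_def
proof (intro conjI ballI)
  show "smooth_map M N f"
  proof (rule smooth_on_subset_linear_charts[OF M order_refl])
    fix p assume "p \<in> points M"
    from charts[OF this] show "\<exists>U \<phi> V \<psi> L. (U, \<phi>) \<in> atlas M \<and> (V, \<psi>) \<in> atlas N \<and> p \<in> U \<and>
        bounded_linear L \<and> (\<forall>q\<in>points M \<inter> U. f q \<in> V \<and> \<psi> (f q) = L (\<phi> q))"
      by blast
  qed (use surj in simp)
  show "f ` points M = points N" by (rule surj)
next
  fix p assume "p \<in> points M"
  from charts[OF this] obtain U \<phi> V \<psi> L where U: "(U, \<phi>) \<in> atlas M" "p \<in> U" and V: "(V, \<psi>) \<in> atlas N"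
    and L: "bounded_linear L" "surj L" "\<And>q. q \<in> U \<Longrightarrow> f q \<in> V \<and> \<psi> (f q) = L (\<phi> q)" by blast
  note c = atlas_chart[OF M U(1)]
  have "(L has_derivative L) (at (\<phi> p))"
    by (rule bounded_linear_imp_has_derivative[OF L(1)])
  then have "(\<psi> \<circ> f \<circ> inv_into U \<phi> has_derivative L) (at (\<phi> p))"
  proof (rule has_derivative_transform_within_open[OF _ chart_open_image[OF c]])
    show "\<phi> p \<in> \<phi> ` U" using U by blast
  next
    fix y assume "y \<in> \<phi> ` U"
    then obtain q where q: "q \<in> U" "y = \<phi> q" by blast
    then show "L y = (\<psi> \<circ> f \<circ> inv_into U \<phi>) y"
      using L(3)[of q] chart_inj_on[OF c] by simp
  qed
  then have "frechet_derivative (\<psi> \<circ> f \<circ> inv_into U \<phi>) (at (\<phi> p)) = L"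
    by (rule frechet_derivative_at[symmetric])
  then have *: "p \<in> U \<and> f p \<in> V \<and> surj (frechet_derivative (\<psi> \<circ> f \<circ> inv_into U \<phi>) (at (\<phi> p)))"
    using L(2) L(3)[OF U(2)] U(2) by simp
  show "\<exists>(U, \<phi>) \<in> atlas M. \<exists>(V, \<psi>) \<in> atlas N. p \<in> U \<and> f p \<in> V \<and>
        surj (frechet_derivative (\<psi> \<circ> f \<circ> inv_into U \<phi>) (at (\<phi> p)))"
    by (rule bexI[OF _ U(1)], unfold prod.case, rule bexI[OF _ V], unfold prod.case, rule *)
qed

lemma smooth_on_subset_id:
  assumes M: "smooth_manifold M" and S: "S \<subseteq> points M"
  shows "smooth_on_subset M S M (\<lambda>x. x)"
proof (rule smooth_on_subset_linear_charts[OF M S])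
  fix p assume "p \<in> S"
  then obtain U \<phi> where U: "(U, \<phi>) \<in> atlas M" "p \<in> U"
    using atlas_covers[OF M] S by blast
  show "\<exists>U \<phi> V \<psi> L. (U, \<phi>) \<in> atlas M \<and> (V, \<psi>) \<in> atlas M \<and> p \<in> U \<and>
      bounded_linear L \<and> (\<forall>q\<in>S \<inter> U. q \<in> V \<and> \<psi> q = L (\<phi> q))"
    by (intro exI conjI, rule U(1), rule U(1), rule U(2), rule bounded_linear_ident) simp
qed (use S in simp)

lemma smooth_on_subset_const:
  assumes M: "smooth_manifold M" and N: "smooth_manifold N" and S: "S \<subseteq> points M" and c: "c \<in> points N"
  shows "smooth_on_subset M S N (\<lambda>x. c)"
proof (rule smooth_on_subsetI)
  fix p assume "p \<in> S"
  then obtain U \<phi> where U: "(U, \<phi>) \<in> atlas M" "p \<in> U"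
    using atlas_covers[OF M] S by blast
  obtain V \<psi> where V: "(V, \<psi>) \<in> atlas N" "c \<in> V"
    using atlas_covers[OF N c] by blast
  note op = chart_open_image[OF atlas_chart[OF M U(1)]]
  show "\<exists>U \<phi> V \<psi> W F. (U, \<phi>) \<in> atlas M \<and> (V, \<psi>) \<in> atlas N \<and>
        p \<in> U \<and> open W \<and> \<phi> p \<in> W \<and> W \<subseteq> \<phi> ` U \<and> smooth_on W F \<and>
        (\<forall>q \<in> S \<inter> U. \<phi> q \<in> W \<longrightarrow> c \<in> V \<and> \<psi> c = F (\<phi> q))"
    by (intro exI conjI, rule U(1), rule V(1), rule U(2), rule op, rule imageI[OF U(2)],
        rule order_refl, rule smooth_on_const[OF op, of "\<psi> c"]) (use V(2) in simp)
qed (use S c in auto)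

lemma points_prod_manifold [simp]: "points (prod_manifold M N) = points M \<times> points N"
  by (simp add: prod_manifold_def)

lemma prod_manifold_charts:
  assumes M: "smooth_manifold M" and N: "smooth_manifold N" and p: "p \<in> points M \<times> points N"
  obtains U \<phi> V \<psi> where "(U, \<phi>) \<in> atlas M" "(V, \<psi>) \<in> atlas N" "p \<in> U \<times> V"
    "(U \<times> V, map_prod \<phi> \<psi>) \<in> atlas (prod_manifold M N)"
proof -
  have "fst p \<in> points M" "snd p \<in> points N"
    using p by auto
  obtain U \<phi> where U: "(U, \<phi>) \<in> atlas M" "fst p \<in> U"
    using atlas_covers[OF M \<open>fst p \<in> points M\<close>] by blast
  obtain V \<psi> where V: "(V, \<psi>) \<in> atlas N" "snd p \<in> V"
    using atlas_covers[OF N \<open>snd p \<in> points N\<close>] by blast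
  show thesis
    by (rule that[OF U(1) V(1)]) (use U V in \<open>auto simp: prod_manifold_def mem_Times_iff\<close>)
qed

lemma smooth_on_subset_fst:
  assumes M: "smooth_manifold M" and N: "smooth_manifold N" and S: "S \<subseteq> points M \<times> points N"
  shows "smooth_on_subset (prod_manifold M N) S M fst"
proof (rule smooth_on_subset_linear_charts[OF smooth_manifold_prod_manifold[OF M N]])
  fix p assume "p \<in> S"
  then have "p \<in> points M \<times> points N" using S by blast
  then obtain U \<phi> V \<psi> where U: "(U, \<phi>) \<in> atlas M" "(V, \<psi>) \<in> atlas N" "p \<in> U \<times> V"
    "(U \<times> V, map_prod \<phi> \<psi>) \<in> atlas (prod_manifold M N)"
    by (rule prod_manifold_charts[OF M N])
  show "\<exists>U \<phi> V \<psi> L. (U, \<phi>) \<in> atlas (prod_manifold M N) \<and> (V, \<psi>) \<in> atlas M \<and> p \<in> U \<and>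
      bounded_linear L \<and> (\<forall>q\<in>S \<inter> U. fst q \<in> V \<and> \<psi> (fst q) = L (\<phi> q))"
    by (intro exI conjI, rule U(4), rule U(1), rule U(3), rule bounded_linear_fst) auto
qed (use S in auto)

lemma smooth_on_subset_snd:
  assumes M: "smooth_manifold M" and N: "smooth_manifold N" and S: "S \<subseteq> points M \<times> points N"
  shows "smooth_on_subset (prod_manifold M N) S N snd"
proof (rule smooth_on_subset_linear_charts[OF smooth_manifold_prod_manifold[OF M N]])
  fix p assume "p \<in> S"
  then have "p \<in> points M \<times> points N" using S by blast
  then obtain U \<phi> V \<psi> where U: "(U, \<phi>) \<in> atlas M" "(V, \<psi>) \<in> atlas N" "p \<in> U \<times> V"
    "(U \<times> V, map_prod \<phi> \<psi>) \<in> atlas (prod_manifold M N)"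
    by (rule prod_manifold_charts[OF M N])
  show "\<exists>U \<phi> V \<psi> L. (U, \<phi>) \<in> atlas (prod_manifold M N) \<and> (V, \<psi>) \<in> atlas N \<and> p \<in> U \<and>
      bounded_linear L \<and> (\<forall>q\<in>S \<inter> U. snd q \<in> V \<and> \<psi> (snd q) = L (\<phi> q))"
    by (intro exI conjI, rule U(4), rule U(2), rule U(3), rule bounded_linear_snd) auto
qed (use S in auto)

text \<open>Continuity on \<open>S\<close>, with its subspace topology, into a discrete space,
  stated so that the index type needs no topology.\<close>

definition locally_constant_on :: "'a topology \<Rightarrow> 'a set \<Rightarrow> ('a \<Rightarrow> 'c) \<Rightarrow> bool" where
  "locally_constant_on X S c \<longleftrightarrow>
     (\<forall>p\<in>S. \<exists>A. openin X A \<and> p \<in> A \<and> (\<forall>q\<in>S \<inter> A. c q = c p))"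

lemma locally_constant_on_compose:
  "locally_constant_on X S c \<Longrightarrow> locally_constant_on X S (\<lambda>q. h (c q))"
  unfolding locally_constant_on_def by metis

lemma locally_constant_on_Pair:
  assumes "locally_constant_on X S c" "locally_constant_on X S d"
  shows "locally_constant_on X S (\<lambda>q. (c q, d q))"
  unfolding locally_constant_on_def
proof
  fix p assume "p \<in> S"
  then obtain A B where A: "openin X A" "p \<in> A" "\<forall>q\<in>S \<inter> A. c q = c p"
    and B: "openin X B" "p \<in> B" "\<forall>q\<in>S \<inter> B. d q = d p"
    using assms unfolding locally_constant_on_def by metis
  then show "\<exists>A. openin X A \<and> p \<in> A \<and> (\<forall>q\<in>S \<inter> A. (c q, d q) = (c p, d p))"
    by (intro exI[of _ "A \<inter> B"]) auto
qed

text \<open>This is continuity of smooth maps in the form required: an open set \<open>A\<close> on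
  which \<open>c\<close> is constant is carried to coordinates, pulled back by the local extension
  \<open>F\<close>, and returned to \<open>M\<close> by a chart.\<close>

lemma locally_constant_on_pullback:
  assumes M: "smooth_manifold M" and N: "smooth_manifold N" and f: "smooth_on_subset M S N f"
    and c: "locally_constant_on (mtop N) T c" and ST: "f ` S \<subseteq> T"
  shows "locally_constant_on (mtop M) S (\<lambda>q. c (f q))"
  unfolding locally_constant_on_def
proof
  fix p assume p: "p \<in> S"
  then obtain A where A: "openin (mtop N) A" "f p \<in> A" "\<forall>q\<in>T \<inter> A. c q = c (f p)"
    using c ST unfolding locally_constant_on_def by blast
  obtain U \<phi> where U: "(U, \<phi>) \<in> atlas M" "p \<in> U"
    using atlas_covers[OF M] smooth_on_subset_points(1)[OF f] p by blast
  obtain V \<psi> where V: "(V, \<psi>) \<in> atlas N" "f p \<in> V"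
    using atlas_covers[OF N] smooth_on_subset_points(2)[OF f] p by blast
  obtain W F where W: "open W" "\<phi> p \<in> W" "W \<subseteq> \<phi> ` U" "smooth_on W F"
    and F: "\<And>q. q \<in> S \<Longrightarrow> q \<in> U \<Longrightarrow> \<phi> q \<in> W \<Longrightarrow> f q \<in> V \<and> \<psi> (f q) = F (\<phi> q)"
    using smooth_on_subset_in_charts[OF M N f p U V] by blast
  note cV = atlas_chart[OF N V(1)]
  let ?W = "W \<inter> F -` (\<psi> ` (V \<inter> A))"
  have "open ?W"
    using continuous_on_open_vimage[OF W(1)] smooth_on_imp_continuous_on[OF W(4)]
      chart_open_image_Int[OF cV A(1)] by (metis Int_commute)
  then have "openin (mtop M) {q \<in> U. \<phi> q \<in> ?W}"
    by (rule chart_preimage[OF atlas_chart[OF M U(1)]])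
  moreover have "p \<in> {q \<in> U. \<phi> q \<in> ?W}"
    using U(2) W(2) F[OF p U(2) W(2)] V(2) A(2) by (auto intro: rev_image_eqI)
  moreover have "c (f q) = c (f p)" if q: "q \<in> S" "q \<in> U" "\<phi> q \<in> ?W" for q
  proof -
    have "f q \<in> V" "\<psi> (f q) \<in> \<psi> ` (V \<inter> A)"
      using F[of q] q by auto
    then have "f q \<in> A"
      using chart_inj_on[OF cV] unfolding inj_on_def by (metis Int_iff image_iff)
    then show ?thesis
      using A(3) ST q(1) by blast
  qed
  ultimately show "\<exists>A. openin (mtop M) A \<and> p \<in> A \<and> (\<forall>q\<in>S \<inter> A. c (f q) = c (f p))"
    by (intro exI[of _ "{q \<in> U. \<phi> q \<in> ?W}"] conjI ballI) auto
qed

section \<open>Disjoint unions of open subsets of a manifold\<close>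

text \<open>The common shape of the disjoint unions of the U_i, U_ij and U_ijk, so that each fact
  about them is proved once for an arbitrary index set.\<close>

abbreviation pieces :: "('x, 'e) manifold \<Rightarrow> 'j set \<Rightarrow> ('j \<Rightarrow> 'x set) \<Rightarrow> ('j \<times> 'x, 'e) manifold" where
  "pieces N J V \<equiv> sum_manifold J (\<lambda>k. open_submanifold N (V k))"

lemma points_pieces:
  assumes "\<And>k. k \<in> J \<Longrightarrow> openin (mtop N) (V k)"
  shows "points (pieces N J V) = Sigma J V"
proof -
  have "points N \<inter> V k = V k" if "k \<in> J" for k
    using openin_subset[OF assms[OF that]] by blast
  then show ?thesis
    by (auto simp: sum_manifold_def open_submanifold_def)
qed

lemma smooth_manifold_pieces:
  assumes "smooth_manifold N" "\<And>k. k \<in> J \<Longrightarrow> openin (mtop N) (V k)"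
  shows "smooth_manifold (pieces N J V)"
  using assms by (intro smooth_manifold_sum_manifold smooth_manifold_open_submanifold)

lemma atlas_pieces:
  "k \<in> J \<Longrightarrow> (A, \<phi>) \<in> atlas N \<Longrightarrow> ({k} \<times> (A \<inter> V k), \<phi> \<circ> snd) \<in> atlas (pieces N J V)"
  by (auto simp: sum_manifold_def open_submanifold_def)

lemma smooth_on_subset_pieces_snd:
  assumes N: "smooth_manifold N" and V: "\<And>k. k \<in> J \<Longrightarrow> openin (mtop N) (V k)" and S: "S \<subseteq> Sigma J V"
  shows "smooth_on_subset (pieces N J V) S N snd"
proof (rule smooth_on_subset_linear_charts[OF smooth_manifold_pieces[of N J V, OF N V]])
  fix p assume p: "p \<in> S"
  then obtain k x where p': "p = (k, x)" "k \<in> J" "x \<in> V k" using S by auto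
  then have "x \<in> points N"
    using openin_subset[OF V] by blast
  then obtain A \<phi> where A: "(A, \<phi>) \<in> atlas N" "x \<in> A"
    using atlas_covers[OF N] by blast
  show "\<exists>U \<phi> B \<psi> L. (U, \<phi>) \<in> atlas (pieces N J V) \<and> (B, \<psi>) \<in> atlas N \<and> p \<in> U \<and>
      bounded_linear L \<and> (\<forall>q\<in>S \<inter> U. snd q \<in> B \<and> \<psi> (snd q) = L (\<phi> q))"
    by (intro exI conjI, rule atlas_pieces[OF p'(2) A(1)], rule A(1), use A p' in simp,
        rule bounded_linear_ident) auto
next
  show "S \<subseteq> points (pieces N J V)"
    using S points_pieces[of J N V, OF V] by simp
  show "snd ` S \<subseteq> points N"
    using S openin_subset[OF V] by fastforce
qed

lemma locally_constant_on_pieces_fst: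
  assumes V: "\<And>k. k \<in> J \<Longrightarrow> openin (mtop N) (V k)" and S: "S \<subseteq> Sigma J V"
  shows "locally_constant_on (mtop (pieces N J V)) S fst"
  unfolding locally_constant_on_def
proof
  fix p assume "p \<in> S"
  then obtain k x where p: "p = (k, x)" "k \<in> J" "x \<in> V k" using S by auto
  have "openin (subtopology (mtop N) (V k)) (V k)"
    using V[OF p(2)] by (simp add: openin_open_subtopology)
  then have "openin (mtop (pieces N J V)) ({k} \<times> V k)"
    unfolding sum_manifold_def using openin_sum_topology_piece[OF p(2)]
    by (simp add: open_submanifold_def)
  then show "\<exists>A. openin (mtop (pieces N J V)) A \<and> p \<in> A \<and> (\<forall>q\<in>S \<inter> A. fst q = fst p)"
    using p by (intro exI[of _ "{k} \<times> V k"]) auto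
qed

text \<open>Near \<open>p\<close> the index keeps its value \<open>?k\<close>, so \<open>f\<close>
  stays in one component, whose charts are those of \<open>N\<close> restricted to
  \<open>V ?k\<close>. Smoothness of the point of \<open>N\<close> in such a chart is therefore
  smoothness of \<open>f\<close>.\<close>

lemma smooth_on_subset_into_pieces:
  assumes M: "smooth_manifold M" and N: "smooth_manifold N"
    and V: "\<And>k. k \<in> J \<Longrightarrow> openin (mtop N) (V k)"
    and f: "smooth_on_subset M S N (\<lambda>q. snd (f q))"
    and c: "locally_constant_on (mtop M) S (\<lambda>q. fst (f q))"
    and fS: "\<And>q. q \<in> S \<Longrightarrow> f q \<in> Sigma J V"
  shows "smooth_on_subset M S (pieces N J V) f"
proof (rule smooth_on_subsetI)
  show S: "S \<subseteq> points M"
    using smooth_on_subset_points(1)[OF f] .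
  show "f ` S \<subseteq> points (pieces N J V)"
    using fS points_pieces[of J N V, OF V] by blast
  fix p assume p: "p \<in> S"
  then obtain A where A: "openin (mtop M) A" "p \<in> A" "\<forall>q\<in>S \<inter> A. fst (f q) = fst (f p)"
    using c unfolding locally_constant_on_def by blast
  obtain U \<phi> where U: "(U, \<phi>) \<in> atlas M" "p \<in> U"
    using atlas_covers[OF M] S p by blast
  obtain B \<psi> where B: "(B, \<psi>) \<in> atlas N" "snd (f p) \<in> B"
    using atlas_covers[OF N] smooth_on_subset_points(2)[OF f] p by blast
  obtain W F where W: "open W" "\<phi> p \<in> W" "W \<subseteq> \<phi> ` U" "smooth_on W F"
    and F: "\<And>q. q \<in> S \<Longrightarrow> q \<in> U \<Longrightarrow> \<phi> q \<in> W \<Longrightarrow> snd (f q) \<in> B \<and> \<psi> (snd (f q)) = F (\<phi> q)"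
    using smooth_on_subset_in_charts[OF M N f p U B] by blast
  note cU = atlas_chart[OF M U(1)]
  let ?k = "fst (f p)" and ?W = "W \<inter> \<phi> ` (U \<inter> A)"
  have k: "?k \<in> J" using fS[OF p] by auto
  have oW: "open ?W"
    using W(1) chart_open_image_Int[OF cU A(1)] by blast
  have pW: "\<phi> p \<in> ?W"
    using W(2) U(2) A(2) by blast
  have eq: "\<forall>q\<in>S \<inter> U. \<phi> q \<in> ?W \<longrightarrow> f q \<in> {?k} \<times> (B \<inter> V ?k) \<and> (\<psi> \<circ> snd) (f q) = F (\<phi> q)"
  proof (intro ballI impI)
    fix q assume q: "q \<in> S \<inter> U" "\<phi> q \<in> ?W"
    then have "q \<in> A"
      using chart_inj_on[OF cU] unfolding inj_on_def by blast
    then have "fst (f q) = ?k"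
      using A(3) q(1) by blast
    then show "f q \<in> {?k} \<times> (B \<inter> V ?k) \<and> (\<psi> \<circ> snd) (f q) = F (\<phi> q)"
      using F[of q] q fS[of q] by (auto simp: mem_Times_iff)
  qed
  show "\<exists>U \<phi> B \<psi> W F. (U, \<phi>) \<in> atlas M \<and> (B, \<psi>) \<in> atlas (pieces N J V) \<and>
        p \<in> U \<and> open W \<and> \<phi> p \<in> W \<and> W \<subseteq> \<phi> ` U \<and> smooth_on W F \<and>
        (\<forall>q \<in> S \<inter> U. \<phi> q \<in> W \<longrightarrow> f q \<in> B \<and> \<psi> (f q) = F (\<phi> q))"
    by (intro exI conjI, rule U(1), rule atlas_pieces[OF k B(1)], rule U(2), rule oW, rule pW,
        use W(3) in blast, rule smooth_on_subset[OF W(4) Int_lower1], rule eq)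
qed

section \<open>Explicit inverses, binary operations and model submersions\<close>

lemma diffeo_onI:
  assumes "smooth_on_subset M S N f" "smooth_on_subset N T M g"
    and "\<And>x. x \<in> S \<Longrightarrow> f x \<in> T" "\<And>y. y \<in> T \<Longrightarrow> g y \<in> S"
    and "\<And>x. x \<in> S \<Longrightarrow> g (f x) = x" "\<And>y. y \<in> T \<Longrightarrow> f (g y) = y"
  shows "diffeo_on M S N T f"
proof -
  have bij: "bij_betw f S T"
    using assms(3-6) by (intro bij_betw_byWitness[where f' = g]) auto
  then have "inv_into S f y = g y" if "y \<in> T" for y
    using assms(4)[OF that] assms(6)[OF that] by (metis bij_betw_inv_into_left)
  then show ?thesis
    unfolding diffeo_on_def using bij assms(1) smooth_on_subset_cong[OF assms(2)] by simp
qed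

lemma smooth_on_subset_compose2:
  assumes "smooth_manifold M" "smooth_manifold A" "smooth_manifold B" "smooth_manifold C"
    and b: "smooth_on_subset (prod_manifold A B) T C (\<lambda>(x, y). b x y)"
    and f: "smooth_on_subset M S A f" and g: "smooth_on_subset M S B g"
    and ST: "\<And>q. q \<in> S \<Longrightarrow> (f q, g q) \<in> T"
  shows "smooth_on_subset M S C (\<lambda>q. b (f q) (g q))"
proof -
  have "smooth_on_subset M S C (\<lambda>q. (\<lambda>(x, y). b x y) (f q, g q))"
    by (rule smooth_on_subset_compose[OF assms(1) _ assms(4) smooth_on_subset_Pair[OF assms(1-3) f g] b])
      (use assms(2,3) ST in \<open>auto intro: smooth_manifold_prod_manifold\<close>)
  then show ?thesis by simp
qed

lemma smooth_on_subset_fst_compose: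
  assumes M: "smooth_manifold M" and A: "smooth_manifold A" and B: "smooth_manifold B"
    and f: "smooth_on_subset M S (prod_manifold A B) f"
  shows "smooth_on_subset M S A (\<lambda>q. fst (f q))"
  by (rule smooth_on_subset_compose[OF M smooth_manifold_prod_manifold[OF A B] A f
        smooth_on_subset_fst[OF A B order_refl]])
    (use smooth_on_subset_points(2)[OF f] in simp)

lemma smooth_on_subset_snd_compose:
  assumes M: "smooth_manifold M" and A: "smooth_manifold A" and B: "smooth_manifold B"
    and f: "smooth_on_subset M S (prod_manifold A B) f"
  shows "smooth_on_subset M S B (\<lambda>q. snd (f q))"
  by (rule smooth_on_subset_compose[OF M smooth_manifold_prod_manifold[OF A B] B f
        smooth_on_subset_snd[OF A B order_refl]])
    (use smooth_on_subset_points(2)[OF f] in simp)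

lemma surjective_submersion_fst:
  assumes M: "smooth_manifold M" and N: "smooth_manifold N" and ne: "points N \<noteq> {}"
  shows "surjective_submersion (prod_manifold M N) M fst"
proof (rule surjective_submersion_linear_charts[OF smooth_manifold_prod_manifold[OF M N]])
  show "fst ` points (prod_manifold M N) = points M"
    using ne by simp
next
  fix p assume "p \<in> points (prod_manifold M N)"
  then have "p \<in> points M \<times> points N" by simp
  then obtain U \<phi> V \<psi> where U: "(U, \<phi>) \<in> atlas M" "(V, \<psi>) \<in> atlas N" "p \<in> U \<times> V"
    "(U \<times> V, map_prod \<phi> \<psi>) \<in> atlas (prod_manifold M N)"
    by (rule prod_manifold_charts[OF M N])
  show "\<exists>U \<phi> V \<psi> L. (U, \<phi>) \<in> atlas (prod_manifold M N) \<and> (V, \<psi>) \<in> atlas M \<and> p \<in> U \<and>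
      bounded_linear L \<and> surj L \<and> (\<forall>q\<in>U. fst q \<in> V \<and> \<psi> (fst q) = L (\<phi> q))"
    by (intro exI conjI, rule U(4), rule U(1), rule U(3), rule bounded_linear_fst, rule surjI[where f = "\<lambda>x. (x, 0)"], rule fst_conv) auto
qed

text \<open>A map that changes the index by \<open>h\<close> and keeps the point is the identity in
  coordinates, provided the same chart of \<open>N\<close> is restricted to \<open>V k\<close> in
  the source and to \<open>W (h k)\<close> in the target.\<close>

lemma surjective_submersion_pieces:
  assumes N: "smooth_manifold N" and V: "\<And>k. k \<in> J \<Longrightarrow> openin (mtop N) (V k)"
    and h: "\<And>k. k \<in> J \<Longrightarrow> h k \<in> K" "\<And>k. k \<in> J \<Longrightarrow> V k \<subseteq> W (h k)"
    and f: "f ` points (pieces N J V) = points (pieces N K W)"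
    "\<And>k x. k \<in> J \<Longrightarrow> x \<in> V k \<Longrightarrow> f (k, x) = (h k, x)"
  shows "surjective_submersion (pieces N J V) (pieces N K W) f"
proof (rule surjective_submersion_linear_charts[OF smooth_manifold_pieces[of N J V, OF N V]])
  fix p assume "p \<in> points (pieces N J V)"
  then obtain k x where p: "p = (k, x)" "k \<in> J" "x \<in> V k"
    by (auto simp: points_pieces[of J N V, OF V])
  then have "x \<in> points N"
    using openin_subset[OF V] by blast
  then obtain A \<phi> where A: "(A, \<phi>) \<in> atlas N" "x \<in> A"
    using atlas_covers[OF N] by blast
  have *: "\<forall>q\<in>{k} \<times> (A \<inter> V k). f q \<in> {h k} \<times> (A \<inter> W (h k)) \<and> (\<phi> \<circ> snd) (f q) = (\<phi> \<circ> snd) q"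
    using f(2) h(2)[OF p(2)] p(2) by auto
  show "\<exists>U \<phi> B \<psi> L. (U, \<phi>) \<in> atlas (pieces N J V) \<and> (B, \<psi>) \<in> atlas (pieces N K W) \<and> p \<in> U \<and>
      bounded_linear L \<and> surj L \<and> (\<forall>q\<in>U. f q \<in> B \<and> \<psi> (f q) = L (\<phi> q))"
    by (intro exI conjI, rule atlas_pieces[OF p(2) A(1)], rule atlas_pieces[OF h(1)[OF p(2)] A(1)],
        use A p in simp, rule bounded_linear_ident, rule surj_id[unfolded id_def], rule *)
qed (assumption | rule f(1))+

text \<open>With an additional factor \<open>M\<close> to be forgotten, the coordinate expression is
  the second projection, with right inverse \<open>\<lambda>x. (0, x)\<close>.\<close>

lemma surjective_submersion_prod_pieces:
  assumes M: "smooth_manifold M" and N: "smooth_manifold N"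
    and V: "\<And>k. k \<in> J \<Longrightarrow> openin (mtop N) (V k)"
    and h: "\<And>k. k \<in> J \<Longrightarrow> h k \<in> K" "\<And>k. k \<in> J \<Longrightarrow> V k \<subseteq> W (h k)"
    and f: "f ` points (prod_manifold M (pieces N J V)) = points (pieces N K W)"
    "\<And>g k x. g \<in> points M \<Longrightarrow> k \<in> J \<Longrightarrow> x \<in> V k \<Longrightarrow> f (g, (k, x)) = (h k, x)"
  shows "surjective_submersion (prod_manifold M (pieces N J V)) (pieces N K W) f"
proof (rule surjective_submersion_linear_charts[OF
      smooth_manifold_prod_manifold[OF M smooth_manifold_pieces[of N J V, OF N V]]])
  fix p assume "p \<in> points (prod_manifold M (pieces N J V))"
  then obtain g k x where p: "p = (g, (k, x))" "g \<in> points M" "k \<in> J" "x \<in> V k"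
    by (auto simp: points_pieces[of J N V, OF V])
  then have "x \<in> points N"
    using openin_subset[OF V] by blast
  then obtain A \<phi> where A: "(A, \<phi>) \<in> atlas N" "x \<in> A"
    using atlas_covers[OF N] by blast
  obtain B \<psi> where B: "(B, \<psi>) \<in> atlas M" "g \<in> B"
    using atlas_covers[OF M p(2)] by blast
  have 1: "(B \<times> ({k} \<times> (A \<inter> V k)), map_prod \<psi> (\<phi> \<circ> snd)) \<in> atlas (prod_manifold M (pieces N J V))"
    unfolding atlas_prod_manifold_iff using B(1) atlas_pieces[OF p(3) A(1)] by blast
  have *: "\<forall>q\<in>B \<times> ({k} \<times> (A \<inter> V k)). f q \<in> {h k} \<times> (A \<inter> W (h k)) \<and>
      (\<phi> \<circ> snd) (f q) = snd (map_prod \<psi> (\<phi> \<circ> snd) q)"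
    using f(2)[OF _ p(3)] h(2)[OF p(3)] subsetD[OF atlas_subset_points[OF M B(1)]] by auto
  show "\<exists>U \<phi> B \<psi> L. (U, \<phi>) \<in> atlas (prod_manifold M (pieces N J V)) \<and>
      (B, \<psi>) \<in> atlas (pieces N K W) \<and> p \<in> U \<and>
      bounded_linear L \<and> surj L \<and> (\<forall>q\<in>U. f q \<in> B \<and> \<psi> (f q) = L (\<phi> q))"
    by (intro exI conjI, rule 1, rule atlas_pieces[OF h(1)[OF p(3)] A(1)],
        use A B p in simp, rule bounded_linear_snd, rule surjI[where f = "\<lambda>x. (0, x)"], rule snd_conv, rule *)
qed (assumption | rule f(1))+

section \<open>Crossed modules\<close>

locale crossed_module_data =
  fixes G :: "('g, 'a::finite_dim_normed) lie_group_data"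
    and H :: "('h, 'b::finite_dim_normed) lie_group_data"
    and \<rho> :: "'g \<Rightarrow> 'h" and j :: "'h \<Rightarrow> 'g \<Rightarrow> 'g"
  assumes crossed: "crossed_module G H \<rho> j"
begin

lemma lie_groups: "lie_group G" "lie_group H"
  using crossed by (simp_all add: crossed_module_def)

sublocale G: group G
  using lie_groups by (simp add: lie_group_def)

sublocale H: group H
  using lie_groups by (simp add: lie_group_def)

lemma manifold_G: "smooth_manifold (mfd G)" and manifold_H: "smooth_manifold (mfd H)"
  and points_G [simp]: "points (mfd G) = carrier G" and points_H [simp]: "points (mfd H) = carrier H"
  using lie_groups by (simp_all add: lie_group_def)

lemma rho_hom: "\<rho> \<in> hom G H"
  using crossed by (simp add: crossed_module_def)

sublocale \<rho>: group_hom G H \<rho>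
  using rho_hom by unfold_locales

lemma j_mem: "h \<in> carrier H \<Longrightarrow> j h \<in> carrier (lie_Aut G)"
  using crossed by (auto simp: crossed_module_def hom_def)

lemma j_auto: "h \<in> carrier H \<Longrightarrow> j h \<in> auto G"
  using j_mem by (auto simp: lie_Aut_def)

lemma j_closed [simp]: "h \<in> carrier H \<Longrightarrow> g \<in> carrier G \<Longrightarrow> j h g \<in> carrier G"
  using j_auto by (auto simp: auto_def hom_def)

lemma j_mult: "h \<in> carrier H \<Longrightarrow> g \<in> carrier G \<Longrightarrow> g' \<in> carrier G \<Longrightarrow>
    j h (g \<otimes>\<^bsub>G\<^esub> g') = j h g \<otimes>\<^bsub>G\<^esub> j h g'"
  using j_auto by (auto simp: auto_def hom_def)

lemma j_compose: "h \<in> carrier H \<Longrightarrow> h' \<in> carrier H \<Longrightarrow> j (h \<otimes>\<^bsub>H\<^esub> h') = compose (carrier G) (j h) (j h')"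
proof -
  assume h: "h \<in> carrier H" "h' \<in> carrier H"
  have "j \<in> hom H (lie_Aut G)"
    using crossed by (simp add: crossed_module_def)
  then have "j (h \<otimes>\<^bsub>H\<^esub> h') = j h \<otimes>\<^bsub>lie_Aut G\<^esub> j h'"
    using h by (simp add: hom_def)
  also have "\<dots> = compose (carrier G) (j h) (j h')"
    using j_auto[OF h(1)] j_auto[OF h(2)]
    by (simp add: lie_Aut_def AutoGroup_def BijGroup_def auto_def)
  finally show ?thesis .
qed

lemma j_apply_mult: "h \<in> carrier H \<Longrightarrow> h' \<in> carrier H \<Longrightarrow> g \<in> carrier G \<Longrightarrow>
    j (h \<otimes>\<^bsub>H\<^esub> h') g = j h (j h' g)"
  by (simp add: j_compose compose_def)

text \<open>Multiplicativity makes \<open>j \<one>\<close> idempotent, and an injective idempotent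
  map is the identity; this argues with functions on the carrier and never with the group laws of
  \<open>lie_Aut G\<close>.\<close>

lemma j_one [simp]: assumes "g \<in> carrier G" shows "j \<one>\<^bsub>H\<^esub> g = g"
proof -
  have "j \<one>\<^bsub>H\<^esub> (j \<one>\<^bsub>H\<^esub> g) = j \<one>\<^bsub>H\<^esub> g"
    using j_apply_mult[of "\<one>\<^bsub>H\<^esub>" "\<one>\<^bsub>H\<^esub>" g] assms by simp
  moreover have "inj_on (j \<one>\<^bsub>H\<^esub>) (carrier G)"
    using j_auto[of "\<one>\<^bsub>H\<^esub>"] by (auto simp: auto_def Bij_def bij_betw_def)
  ultimately show ?thesis
    using assms by (simp add: inj_on_eq_iff)
qed

lemma j_unit [simp]: "h \<in> carrier H \<Longrightarrow> j h \<one>\<^bsub>G\<^esub> = \<one>\<^bsub>G\<^esub>"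
  using j_mult[of h "\<one>\<^bsub>G\<^esub>" "\<one>\<^bsub>G\<^esub>"] by (metis G.l_cancel_one G.one_closed G.l_one j_closed)

lemma j_j_inv [simp]: "h \<in> carrier H \<Longrightarrow> g \<in> carrier G \<Longrightarrow> j h (j (inv\<^bsub>H\<^esub> h) g) = g"
  and j_inv_j [simp]: "h \<in> carrier H \<Longrightarrow> g \<in> carrier G \<Longrightarrow> j (inv\<^bsub>H\<^esub> h) (j h g) = g"
  by (simp_all add: j_apply_mult[symmetric])

lemma rho_j: "h \<in> carrier H \<Longrightarrow> g \<in> carrier G \<Longrightarrow> \<rho> (j h g) = h \<otimes>\<^bsub>H\<^esub> \<rho> g \<otimes>\<^bsub>H\<^esub> inv\<^bsub>H\<^esub> h"
  using crossed by (simp add: crossed_module_def)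

lemma j_rho: "g \<in> carrier G \<Longrightarrow> g' \<in> carrier G \<Longrightarrow> j (\<rho> g) g' = g \<otimes>\<^bsub>G\<^esub> g' \<otimes>\<^bsub>G\<^esub> inv\<^bsub>G\<^esub> g"
  using crossed by (simp add: crossed_module_def)

section \<open>Smoothness of expressions built from the group operations, \<rho> and j\<close>

lemma smooth_G_mult:
  assumes M: "smooth_manifold M" and f: "smooth_on_subset M S (mfd G) f" and g: "smooth_on_subset M S (mfd G) g"
  shows "smooth_on_subset M S (mfd G) (\<lambda>q. f q \<otimes>\<^bsub>G\<^esub> g q)"
  by (rule smooth_on_subset_compose2[OF M manifold_G manifold_G manifold_G _ f g,
        where T = "points (prod_manifold (mfd G) (mfd G))"])
    (use lie_groups smooth_on_subset_points(2)[OF f] smooth_on_subset_points(2)[OF g]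
      in \<open>auto simp: lie_group_def\<close>)

lemma smooth_H_mult:
  assumes M: "smooth_manifold M" and f: "smooth_on_subset M S (mfd H) f" and g: "smooth_on_subset M S (mfd H) g"
  shows "smooth_on_subset M S (mfd H) (\<lambda>q. f q \<otimes>\<^bsub>H\<^esub> g q)"
  by (rule smooth_on_subset_compose2[OF M manifold_H manifold_H manifold_H _ f g,
        where T = "points (prod_manifold (mfd H) (mfd H))"])
    (use lie_groups smooth_on_subset_points(2)[OF f] smooth_on_subset_points(2)[OF g]
      in \<open>auto simp: lie_group_def\<close>)

lemma smooth_G_inv:
  assumes M: "smooth_manifold M" and f: "smooth_on_subset M S (mfd G) f"
  shows "smooth_on_subset M S (mfd G) (\<lambda>q. inv\<^bsub>G\<^esub> (f q))"
  by (rule smooth_on_subset_compose[OF M manifold_G manifold_G f _ smooth_on_subset_points(2)[OF f]])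
    (use lie_groups in \<open>simp add: lie_group_def\<close>)

lemma smooth_H_inv:
  assumes M: "smooth_manifold M" and f: "smooth_on_subset M S (mfd H) f"
  shows "smooth_on_subset M S (mfd H) (\<lambda>q. inv\<^bsub>H\<^esub> (f q))"
  by (rule smooth_on_subset_compose[OF M manifold_H manifold_H f _ smooth_on_subset_points(2)[OF f]])
    (use lie_groups in \<open>simp add: lie_group_def\<close>)

lemma smooth_rho:
  assumes M: "smooth_manifold M" and f: "smooth_on_subset M S (mfd G) f"
  shows "smooth_on_subset M S (mfd H) (\<lambda>q. \<rho> (f q))"
  by (rule smooth_on_subset_compose[OF M manifold_G manifold_H f _ smooth_on_subset_points(2)[OF f]])
    (use crossed in \<open>simp add: crossed_module_def\<close>)

lemma smooth_j:
  assumes M: "smooth_manifold M" and f: "smooth_on_subset M S (mfd H) f" and g: "smooth_on_subset M S (mfd G) g"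
  shows "smooth_on_subset M S (mfd G) (\<lambda>q. j (f q) (g q))"
  by (rule smooth_on_subset_compose2[OF M manifold_H manifold_G manifold_G _ f g,
        where T = "points (prod_manifold (mfd H) (mfd G))"])
    (use crossed smooth_on_subset_points(2)[OF f] smooth_on_subset_points(2)[OF g]
      in \<open>auto simp: crossed_module_def smooth_family_def\<close>)

end

section \<open>The manifolds of an open cover\<close>

locale manifold_cover =
  fixes N :: "('x, 'e::finite_dim_normed) manifold" and I :: "'i set" and U :: "'i \<Rightarrow> 'x set"
  assumes manifold_N: "smooth_manifold N" and cover: "open_cover N I U"
begin

lemma open_U: "i \<in> I \<Longrightarrow> openin (mtop N) (U i)"
  using cover by (simp add: open_cover_def)

abbreviation U2 :: "'i \<times> 'i \<Rightarrow> 'x set" where "U2 \<equiv> \<lambda>(i, k). U i \<inter> U k"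
abbreviation U3 :: "'i \<times> 'i \<times> 'i \<Rightarrow> 'x set" where "U3 \<equiv> \<lambda>(i, k, l). U i \<inter> U k \<inter> U l"

lemma open_U2: "p \<in> I \<times> I \<Longrightarrow> openin (mtop N) (U2 p)"
  using open_U by auto

lemma open_U3: "p \<in> I \<times> I \<times> I \<Longrightarrow> openin (mtop N) (U3 p)"
  using open_U by auto

text \<open>Moves the case distinction on the index from the manifold to the open set, which is the
  form covered by the lemmas on \<open>pieces\<close>.\<close>

lemma cover1_pieces: "cover1 N I U = pieces N I U"
  and cover2_pieces: "cover2 N I U = pieces N (I \<times> I) U2"
  and cover3_pieces: "cover3 N I U = pieces N (I \<times> I \<times> I) U3"
  unfolding cover1_def cover2_def cover3_def
  by (rule refl, (rule arg_cong[of _ _ "sum_manifold _"], rule ext, simp split: prod.split)+)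

lemma points_cover1: "points (cover1 N I U) = Sigma I U"
  and points_cover2: "points (cover2 N I U) = Sigma (I \<times> I) U2"
  and points_cover3: "points (cover3 N I U) = Sigma (I \<times> I \<times> I) U3"
  unfolding cover1_pieces cover2_pieces cover3_pieces
  by (rule points_pieces; erule open_U open_U2 open_U3)+

lemma mem_cover1 [simp]: "(i, x) \<in> points (cover1 N I U) \<longleftrightarrow> i \<in> I \<and> x \<in> U i"
  and mem_cover2 [simp]: "((i, k), x) \<in> points (cover2 N I U) \<longleftrightarrow> i \<in> I \<and> k \<in> I \<and> x \<in> U i \<and> x \<in> U k"
  and mem_cover3 [simp]: "((i, k, l), x) \<in> points (cover3 N I U) \<longleftrightarrow>
    i \<in> I \<and> k \<in> I \<and> l \<in> I \<and> x \<in> U i \<and> x \<in> U k \<and> x \<in> U l"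
  by (auto simp: points_cover1 points_cover2 points_cover3)

lemma manifold_cover1: "smooth_manifold (cover1 N I U)"
  and manifold_cover2: "smooth_manifold (cover2 N I U)"
  and manifold_cover3: "smooth_manifold (cover3 N I U)"
  unfolding cover1_pieces cover2_pieces cover3_pieces
  by (rule smooth_manifold_pieces[OF manifold_N]; erule open_U open_U2 open_U3)+

text \<open>Index \<open>c\<close> and point \<open>y\<close> are supplied separately because they
  usually have different origins: the point comes from one arrow, while the index may combine
  entries of several. The same holds for the two lemmas that follow.\<close>

lemma smooth_into_cover1:
  assumes "smooth_manifold M" "smooth_on_subset M S N y" "locally_constant_on (mtop M) S c"
    and f: "\<And>q. q \<in> S \<Longrightarrow> f q = (c q, y q)" "\<And>q. q \<in> S \<Longrightarrow> f q \<in> points (cover1 N I U)"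
  shows "smooth_on_subset M S (cover1 N I U) f"
proof -
  have "smooth_on_subset M S (cover1 N I U) (\<lambda>q. (c q, y q))"
    unfolding cover1_pieces
    by (rule smooth_on_subset_into_pieces[OF assms(1) manifold_N open_U])
      (use assms in \<open>auto simp: points_cover1\<close>)
  then show ?thesis
    by (rule smooth_on_subset_cong) (simp add: f(1))
qed

lemma smooth_into_cover2:
  assumes "smooth_manifold M" "smooth_on_subset M S N y" "locally_constant_on (mtop M) S c"
    and f: "\<And>q. q \<in> S \<Longrightarrow> f q = (c q, y q)" "\<And>q. q \<in> S \<Longrightarrow> f q \<in> points (cover2 N I U)"
  shows "smooth_on_subset M S (cover2 N I U) f"
proof -
  have "smooth_on_subset M S (cover2 N I U) (\<lambda>q. (c q, y q))"
    unfolding cover2_pieces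
    by (rule smooth_on_subset_into_pieces[OF assms(1) manifold_N open_U2])
      (use assms in \<open>auto simp: points_cover2\<close>)
  then show ?thesis
    by (rule smooth_on_subset_cong) (simp add: f(1))
qed

lemma smooth_into_cover3:
  assumes "smooth_manifold M" "smooth_on_subset M S N y" "locally_constant_on (mtop M) S c"
    and f: "\<And>q. q \<in> S \<Longrightarrow> f q = (c q, y q)" "\<And>q. q \<in> S \<Longrightarrow> f q \<in> points (cover3 N I U)"
  shows "smooth_on_subset M S (cover3 N I U) f"
proof -
  have "smooth_on_subset M S (cover3 N I U) (\<lambda>q. (c q, y q))"
    unfolding cover3_pieces
    by (rule smooth_on_subset_into_pieces[OF assms(1) manifold_N open_U3])
      (use assms in \<open>auto simp: points_cover3\<close>)
  then show ?thesis
    by (rule smooth_on_subset_cong) (simp add: f(1))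
qed

lemma smooth_cover1_point:
  assumes M: "smooth_manifold M" and f: "smooth_on_subset M S (cover1 N I U) f"
  shows "smooth_on_subset M S N (\<lambda>q. snd (f q))"
  by (rule smooth_on_subset_compose[OF M manifold_cover1 manifold_N f _ smooth_on_subset_points(2)[OF f]])
    (unfold points_cover1, unfold cover1_pieces,
     rule smooth_on_subset_pieces_snd[OF manifold_N open_U order_refl])

lemma smooth_cover2_point:
  assumes M: "smooth_manifold M" and f: "smooth_on_subset M S (cover2 N I U) f"
  shows "smooth_on_subset M S N (\<lambda>q. snd (f q))"
  by (rule smooth_on_subset_compose[OF M manifold_cover2 manifold_N f _ smooth_on_subset_points(2)[OF f]])
    (unfold points_cover2, unfold cover2_pieces,
     rule smooth_on_subset_pieces_snd[OF manifold_N open_U2 order_refl])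

lemma smooth_cover3_point:
  assumes M: "smooth_manifold M" and f: "smooth_on_subset M S (cover3 N I U) f"
  shows "smooth_on_subset M S N (\<lambda>q. snd (f q))"
  by (rule smooth_on_subset_compose[OF M manifold_cover3 manifold_N f _ smooth_on_subset_points(2)[OF f]])
    (unfold points_cover3, unfold cover3_pieces,
     rule smooth_on_subset_pieces_snd[OF manifold_N open_U3 order_refl])

text \<open>The function \<open>h\<close> absorbs the rearrangements of indices in structure maps,
  such as the passage from i to (i, i) in the unit.\<close>

lemma locally_constant_cover1_index:
  assumes M: "smooth_manifold M" and f: "smooth_on_subset M S (cover1 N I U) f"
  shows "locally_constant_on (mtop M) S (\<lambda>q. h (fst (f q)))"
  by (rule locally_constant_on_compose,
      rule locally_constant_on_pullback[OF M manifold_cover1 f _ smooth_on_subset_points(2)[OF f]])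
    (unfold points_cover1, unfold cover1_pieces,
     rule locally_constant_on_pieces_fst[OF open_U order_refl])

lemma locally_constant_cover2_index:
  assumes M: "smooth_manifold M" and f: "smooth_on_subset M S (cover2 N I U) f"
  shows "locally_constant_on (mtop M) S (\<lambda>q. h (fst (f q)))"
  by (rule locally_constant_on_compose,
      rule locally_constant_on_pullback[OF M manifold_cover2 f _ smooth_on_subset_points(2)[OF f]])
    (unfold points_cover2, unfold cover2_pieces,
     rule locally_constant_on_pieces_fst[OF open_U2 order_refl])

lemma locally_constant_cover3_index:
  assumes M: "smooth_manifold M" and f: "smooth_on_subset M S (cover3 N I U) f"
  shows "locally_constant_on (mtop M) S (\<lambda>q. h (fst (f q)))"
  by (rule locally_constant_on_compose,
      rule locally_constant_on_pullback[OF M manifold_cover3 f _ smooth_on_subset_points(2)[OF f]])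
    (unfold points_cover3, unfold cover3_pieces,
     rule locally_constant_on_pieces_fst[OF open_U3 order_refl])

end

section \<open>The Cech groupoid\<close>

context manifold_cover
begin

lemma cech_simps [simp]:
  "arrows (cech N I U) = cover2 N I U" "objects (cech N I U) = cover1 N I U"
  "src (cech N I U) ((i, k), x) = (i, x)" "tgt (cech N I U) ((i, k), x) = (k, x)"
  "gunit (cech N I U) (i, x) = ((i, i), x)" "ginv (cech N I U) ((i, k), x) = ((k, i), x)"
  "gmul (cech N I U) ((i, k), x) ((k', l), x') = ((i, l), x)"
  by (simp_all add: cech_def)

lemma surjective_submersion_cech:
  "surjective_submersion (cover2 N I U) (cover1 N I U) (src (cech N I U))"
  "surjective_submersion (cover2 N I U) (cover1 N I U) (tgt (cech N I U))"
proof -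
  have "(i, x) \<in> src (cech N I U) ` points (cover2 N I U)" "(i, x) \<in> tgt (cech N I U) ` points (cover2 N I U)"
    if "i \<in> I" "x \<in> U i" for i x
    using that by (auto intro!: image_eqI[of _ _ "((i, i), x)"])
  then have im: "src (cech N I U) ` points (cover2 N I U) = points (cover1 N I U)"
    "tgt (cech N I U) ` points (cover2 N I U) = points (cover1 N I U)"
    by (auto simp: points_cover1)
  show "surjective_submersion (cover2 N I U) (cover1 N I U) (src (cech N I U))"
    using im(1) unfolding cover1_pieces cover2_pieces
    by (intro surjective_submersion_pieces[where h = fst]) (auto intro: manifold_N open_U)
  show "surjective_submersion (cover2 N I U) (cover1 N I U) (tgt (cech N I U))"
    using im(2) unfolding cover1_pieces cover2_pieces
    by (intro surjective_submersion_pieces[where h = snd]) (auto intro: manifold_N open_U)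
qed

lemma lie_groupoid_cech: "lie_groupoid (cech N I U)"
  unfolding lie_groupoid_def cech_simps
proof (intro conjI manifold_cover1 manifold_cover2 surjective_submersion_cech)
  note id1 = smooth_on_subset_id[OF manifold_cover1 order_refl]
  note id2 = smooth_on_subset_id[OF manifold_cover2 order_refl]
  show "smooth_map (cover1 N I U) (cover2 N I U) (gunit (cech N I U))"
    by (rule smooth_into_cover2[OF manifold_cover1 smooth_cover1_point[OF manifold_cover1 id1]
          locally_constant_cover1_index[OF manifold_cover1 id1, of "\<lambda>i. (i, i)"]])
      (auto simp: points_cover1)
  show "smooth_map (cover2 N I U) (cover2 N I U) (ginv (cech N I U))"
    by (rule smooth_into_cover2[OF manifold_cover2 smooth_cover2_point[OF manifold_cover2 id2]
          locally_constant_cover2_index[OF manifold_cover2 id2, of "\<lambda>(i, k). (k, i)"]])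
      (auto simp: points_cover2)
  let ?M = "prod_manifold (cover2 N I U) (cover2 N I U)" and ?S = "composable (cech N I U)"
  have M: "smooth_manifold ?M"
    by (intro smooth_manifold_prod_manifold manifold_cover2)
  have S: "?S \<subseteq> points (cover2 N I U) \<times> points (cover2 N I U)"
    by (auto simp: composable_def)
  note f = smooth_on_subset_fst[OF manifold_cover2 manifold_cover2 S]
  note s = smooth_on_subset_snd[OF manifold_cover2 manifold_cover2 S]
  \<comment> \<open>The product takes its first index and its point from the left arrow and its last
    index from the right arrow.\<close>
  show "smooth_on_subset ?M ?S (cover2 N I U) (\<lambda>(x, y). gmul (cech N I U) x y)"
    by (rule smooth_into_cover2[OF M smooth_cover2_point[OF M f] locally_constant_on_Pair[OF
            locally_constant_cover2_index[OF M f, of fst] locally_constant_cover2_index[OF M s, of snd]]])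
      (auto simp: composable_def points_cover2)
qed (auto simp: composable_def points_cover1 points_cover2)

end

section \<open>From cocycles to extensions\<close>

locale cech_crossed_module = manifold_cover N I U + crossed_module_data G H \<rho> j
  for N :: "('x, 'e::finite_dim_normed) manifold" and I :: "'i set" and U :: "'i \<Rightarrow> 'x set"
    and G :: "('g, 'a::finite_dim_normed) lie_group_data"
    and H :: "('h, 'b::finite_dim_normed) lie_group_data"
    and \<rho> :: "'g \<Rightarrow> 'h" and j :: "'h \<Rightarrow> 'g \<Rightarrow> 'g"
begin

abbreviation RM :: "('g \<times> ('i \<times> 'i) \<times> 'x, 'a \<times> 'e) manifold" where
  "RM \<equiv> prod_manifold (mfd G) (cover2 N I U)"

abbreviation PM :: "(('i \<times> 'x) \<times> 'h, 'e \<times> 'b) manifold" where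
  "PM \<equiv> prod_manifold (cover1 N I U) (mfd H)"

lemma manifold_RM: "smooth_manifold RM" and manifold_PM: "smooth_manifold PM"
  by (intro smooth_manifold_prod_manifold manifold_G manifold_H manifold_cover1 manifold_cover2)+

end

locale cech_cocycle = cech_crossed_module N I U G H \<rho> j
  for N :: "('x, 'e::finite_dim_normed) manifold" and I :: "'i set" and U :: "'i \<Rightarrow> 'x set"
    and G :: "('g, 'a::finite_dim_normed) lie_group_data"
    and H :: "('h, 'b::finite_dim_normed) lie_group_data"
    and \<rho> :: "'g \<Rightarrow> 'h" and j :: "'h \<Rightarrow> 'g \<Rightarrow> 'g" +
  fixes lam :: "('i \<times> 'i) \<times> 'x \<Rightarrow> 'h" and \<gamma> :: "('i \<times> 'i \<times> 'i) \<times> 'x \<Rightarrow> 'g"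
  assumes cocycle: "nonabelian_cocycle G H \<rho> j N I U lam \<gamma>"
begin

section \<open>Consequences of the cocycle identities\<close>

lemma smooth_lam: "smooth_map (cover2 N I U) (mfd H) lam"
  and smooth_gamma: "smooth_map (cover3 N I U) (mfd G) \<gamma>"
  using cocycle by (simp_all add: nonabelian_cocycle_def)

lemma lam_closed [simp]: "i \<in> I \<Longrightarrow> k \<in> I \<Longrightarrow> x \<in> U i \<Longrightarrow> x \<in> U k \<Longrightarrow> lam ((i, k), x) \<in> carrier H"
  using smooth_on_subset_points(2)[OF smooth_lam] by (simp add: image_subset_iff points_cover2)

lemma gamma_closed [simp]: "i \<in> I \<Longrightarrow> k \<in> I \<Longrightarrow> l \<in> I \<Longrightarrow> x \<in> U i \<Longrightarrow> x \<in> U k \<Longrightarrow> x \<in> U l \<Longrightarrow>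
    \<gamma> ((i, k, l), x) \<in> carrier G"
  using smooth_on_subset_points(2)[OF smooth_gamma] by (simp add: image_subset_iff points_cover3)

lemma rho_gamma: "i \<in> I \<Longrightarrow> k \<in> I \<Longrightarrow> l \<in> I \<Longrightarrow> x \<in> U i \<Longrightarrow> x \<in> U k \<Longrightarrow> x \<in> U l \<Longrightarrow>
    \<rho> (\<gamma> ((i, k, l), x)) \<otimes>\<^bsub>H\<^esub> lam ((i, l), x) = lam ((i, k), x) \<otimes>\<^bsub>H\<^esub> lam ((k, l), x)"
  using cocycle by (simp add: nonabelian_cocycle_def)

lemma gamma_gamma: "i \<in> I \<Longrightarrow> k \<in> I \<Longrightarrow> l \<in> I \<Longrightarrow> n \<in> I \<Longrightarrow>
    x \<in> U i \<Longrightarrow> x \<in> U k \<Longrightarrow> x \<in> U l \<Longrightarrow> x \<in> U n \<Longrightarrow>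
    \<gamma> ((i, k, l), x) \<otimes>\<^bsub>G\<^esub> \<gamma> ((i, l, n), x)
      = j (lam ((i, k), x)) (\<gamma> ((k, l, n), x)) \<otimes>\<^bsub>G\<^esub> \<gamma> ((i, k, n), x)"
  using cocycle by (simp add: nonabelian_cocycle_def)

lemma gamma_left_unit [simp]: "i \<in> I \<Longrightarrow> k \<in> I \<Longrightarrow> x \<in> U i \<Longrightarrow> x \<in> U k \<Longrightarrow> \<gamma> ((i, i, k), x) = \<one>\<^bsub>G\<^esub>"
  using cocycle by (simp add: nonabelian_cocycle_def)

text \<open>Since g_iii = e, the first identity at (i, i, i) reads \<lambda>_ii = \<lambda>_ii
  \<lambda>_ii.\<close>

lemma lam_unit [simp]: "i \<in> I \<Longrightarrow> x \<in> U i \<Longrightarrow> lam ((i, i), x) = \<one>\<^bsub>H\<^esub>"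
  using rho_gamma[of i i i x] by simp

text \<open>The second identity at (i, k, k, k) reads g_ikk g_ikk = \<lambda>_ik(g_kkk) g_ikk, and
  g_kkk = e. This is the right unit law of the groupoid.\<close>

lemma gamma_right_unit [simp]:
  assumes "i \<in> I" "k \<in> I" "x \<in> U i" "x \<in> U k"
  shows "\<gamma> ((i, k, k), x) = \<one>\<^bsub>G\<^esub>"
  using gamma_gamma[of i k k k x] assms by simp

text \<open>Apply j to the first cocycle identity: j \<circ> \<rho> is conjugation, so \<lambda>
  respects composition of indices up to conjugation by g_ikl.\<close>

lemma j_lam_lam:
  assumes "i \<in> I" "k \<in> I" "l \<in> I" "x \<in> U i" "x \<in> U k" "x \<in> U l" "a \<in> carrier G"
  shows "j (lam ((i, k), x)) (j (lam ((k, l), x)) a)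
    = \<gamma> ((i, k, l), x) \<otimes>\<^bsub>G\<^esub> j (lam ((i, l), x)) a \<otimes>\<^bsub>G\<^esub> inv\<^bsub>G\<^esub> \<gamma> ((i, k, l), x)"
proof -
  have "j (lam ((i, k), x)) (j (lam ((k, l), x)) a) = j (\<rho> (\<gamma> ((i, k, l), x)) \<otimes>\<^bsub>H\<^esub> lam ((i, l), x)) a"
    using assms by (simp add: j_apply_mult rho_gamma)
  then show ?thesis
    using assms by (simp add: j_apply_mult j_rho)
qed

text \<open>The second identity at (i, k, i, k), in which g_iik and g_ikk are trivial. It relates
  the two corrections met when an arrow is multiplied by its inverse on either side.\<close>

lemma gamma_back:
  assumes "i \<in> I" "k \<in> I" "x \<in> U i" "x \<in> U k"
  shows "j (lam ((i, k), x)) (\<gamma> ((k, i, k), x)) = \<gamma> ((i, k, i), x)"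
  using gamma_gamma[of i k i k x] assms by simp

lemma inv_cancel: "a \<in> carrier G \<Longrightarrow> b \<in> carrier G \<Longrightarrow> inv\<^bsub>G\<^esub> a \<otimes>\<^bsub>G\<^esub> (a \<otimes>\<^bsub>G\<^esub> b) = b"
  by (simp add: G.m_assoc[symmetric])

abbreviation R where "R \<equiv> cocycle_groupoid G H j N I U lam \<gamma>"
abbreviation E where "E \<equiv> cocycle_extension G H \<rho> j N I U lam \<gamma>"
abbreviation C where "C \<equiv> cech N I U"

lemma R_simps [simp]:
  "arrows R = RM" "objects R = cover1 N I U"
  "src R (g, ((i, k), x)) = (i, x)" "tgt R (g, ((i, k), x)) = (k, x)"
  "gunit R (i, x) = (\<one>\<^bsub>G\<^esub>, ((i, i), x))"
  "ginv R (g, ((i, k), x)) =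
    (j (inv\<^bsub>H\<^esub> lam ((i, k), x)) (inv\<^bsub>G\<^esub> g \<otimes>\<^bsub>G\<^esub> inv\<^bsub>G\<^esub> \<gamma> ((i, k, i), x)), ((k, i), x))"
  "gmul R (g, ((i, k), x)) (g', ((k', l), x')) =
    (g \<otimes>\<^bsub>G\<^esub> j (lam ((i, k), x)) g' \<otimes>\<^bsub>G\<^esub> \<gamma> ((i, k, l), x), ((i, l), x))"
  by (simp_all add: cocycle_groupoid_def)

lemma E_simps [simp]:
  "ext_groupoid E = R" "ext_prj E = snd" "ext_bundle E = PM" "ext_bundle_prj E = fst"
  "ext_ract E ((i, x), h) h' = ((i, x), h \<otimes>\<^bsub>H\<^esub> h')"
  "ext_lact E (g, ((i, k), x)) ((k', x'), h) = ((i, x), \<rho> g \<otimes>\<^bsub>H\<^esub> lam ((i, k), x) \<otimes>\<^bsub>H\<^esub> h)"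
  "ext_chi E ((i, x), h) = ((i, x), \<lambda>g\<in>carrier G. (j h g, ((i, i), x)))"
  by (simp_all add: cocycle_extension_def)

lemma composable_R: "composable R = {((g, ((i, k), x)), (g', ((k', l), x'))) | g i k x g' k' l x'.
    g \<in> carrier G \<and> i \<in> I \<and> k \<in> I \<and> x \<in> U i \<and> x \<in> U k \<and> g' \<in> carrier G \<and> l \<in> I \<and> x \<in> U l \<and> k' = k \<and> x' = x}"
  by (auto simp: composable_def)

text \<open>Both sides have group component a \<lambda>_ik(b) g_ikl \<lambda>_il(c) g_iln. On the
  right this needs \<lambda>_ik(\<lambda>_kl(c)) as a conjugate of \<lambda>_il(c), after which the
  inverse of g_ikl cancels against \<lambda>_ik(g_kln) g_ikn = g_ikl g_iln.\<close>

lemma gmul_assoc: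
  assumes "i \<in> I" "k \<in> I" "l \<in> I" "n \<in> I" "x \<in> U i" "x \<in> U k" "x \<in> U l" "x \<in> U n"
    "a \<in> carrier G" "b \<in> carrier G" "c \<in> carrier G"
  shows "gmul R (gmul R (a, ((i, k), x)) (b, ((k, l), x))) (c, ((l, n), x))
    = gmul R (a, ((i, k), x)) (gmul R (b, ((k, l), x)) (c, ((l, n), x)))"
  using assms by (simp add: j_mult j_lam_lam gamma_gamma[symmetric] G.m_assoc inv_cancel)

lemma gmul_ginv:
  assumes "i \<in> I" "k \<in> I" "x \<in> U i" "x \<in> U k" "a \<in> carrier G"
  shows "gmul R (a, ((i, k), x)) (ginv R (a, ((i, k), x))) = (\<one>\<^bsub>G\<^esub>, ((i, i), x))"
  using assms by (simp add: G.m_assoc)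

text \<open>All three factors are brought into the image of \<lambda>_ik^{-1}. With c = g_iki they
  come from a^{-1} c^{-1}, c a c^{-1} and c, whose product is e.\<close>

lemma ginv_gmul:
  assumes "i \<in> I" "k \<in> I" "x \<in> U i" "x \<in> U k" "a \<in> carrier G"
  shows "gmul R (ginv R (a, ((i, k), x))) (a, ((i, k), x)) = (\<one>\<^bsub>G\<^esub>, ((k, k), x))"
proof -
  let ?l = "lam ((i, k), x)" and ?c = "\<gamma> ((i, k, i), x)" and ?d = "\<gamma> ((k, i, k), x)"
  have d: "?d = j (inv\<^bsub>H\<^esub> ?l) ?c"
    using gamma_back[of i k x] assms by (metis gamma_closed j_inv_j lam_closed)
  have "j ?l (j (lam ((k, i), x)) a) = ?c \<otimes>\<^bsub>G\<^esub> a \<otimes>\<^bsub>G\<^esub> inv\<^bsub>G\<^esub> ?c"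
    using j_lam_lam[of i k i x a] assms by simp
  then have la: "j (lam ((k, i), x)) a = j (inv\<^bsub>H\<^esub> ?l) (?c \<otimes>\<^bsub>G\<^esub> a \<otimes>\<^bsub>G\<^esub> inv\<^bsub>G\<^esub> ?c)"
    using assms by (metis j_closed j_inv_j lam_closed)
  show ?thesis
    using assms by (simp add: la d j_mult[symmetric] G.m_assoc inv_cancel)
qed

section \<open>Smoothness of the structure maps of the groupoid\<close>

lemma smooth_R_group: "smooth_manifold M \<Longrightarrow> smooth_on_subset M S RM f \<Longrightarrow>
    smooth_on_subset M S (mfd G) (\<lambda>q. fst (f q))"
  and smooth_R_cover: "smooth_manifold M \<Longrightarrow> smooth_on_subset M S RM f \<Longrightarrow>
    smooth_on_subset M S (cover2 N I U) (\<lambda>q. snd (f q))"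
  by (rule smooth_on_subset_fst_compose smooth_on_subset_snd_compose;
      simp add: manifold_G manifold_cover2)+

lemma smooth_lam_compose: "smooth_manifold M \<Longrightarrow> smooth_on_subset M S (cover2 N I U) f \<Longrightarrow>
    smooth_on_subset M S (mfd H) (\<lambda>q. lam (f q))"
  using smooth_on_subset_compose[OF _ manifold_cover2 manifold_H _ smooth_lam]
    smooth_on_subset_points(2) by blast

lemma smooth_gamma_compose: "smooth_manifold M \<Longrightarrow> smooth_on_subset M S (cover3 N I U) f \<Longrightarrow>
    smooth_on_subset M S (mfd G) (\<lambda>q. \<gamma> (f q))"
  using smooth_on_subset_compose[OF _ manifold_cover3 manifold_G _ smooth_gamma]
    smooth_on_subset_points(2) by blast

lemma smooth_gunit: "smooth_map (cover1 N I U) RM (gunit R)"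
proof -
  note id1 = smooth_on_subset_id[OF manifold_cover1 order_refl]
  have "smooth_on_subset (cover1 N I U) (points (cover1 N I U)) (cover2 N I U) (\<lambda>q. ((fst q, fst q), snd q))"
    by (rule smooth_into_cover2[OF manifold_cover1 smooth_cover1_point[OF manifold_cover1 id1]
          locally_constant_cover1_index[OF manifold_cover1 id1, of "\<lambda>i. (i, i)"]])
      (auto simp: points_cover1)
  then have "smooth_map (cover1 N I U) RM (\<lambda>q. (\<one>\<^bsub>G\<^esub>, ((fst q, fst q), snd q)))"
    by (intro smooth_on_subset_Pair smooth_on_subset_const manifold_cover1 manifold_cover2 manifold_G) auto
  then show ?thesis
    by (rule smooth_on_subset_cong) (auto simp: points_cover1)
qed

text \<open>The formula is rewritten with projections, since the smoothness rules work on
  compositions; it agrees with the pattern-matching definition on the points of \<open>RM\<close>.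
  The auxiliary maps \<open>2\<close> and \<open>3\<close> send (g, x_ik) to x_ki and to
  x_iki.\<close>

lemma smooth_ginv: "smooth_map RM RM (ginv R)"
proof -
  note id = smooth_on_subset_id[OF manifold_RM order_refl]
  note g = smooth_R_group[OF manifold_RM id] and c = smooth_R_cover[OF manifold_RM id]
  have 2: "smooth_map RM (cover2 N I U) (\<lambda>q. (prod.swap (fst (snd q)), snd (snd q)))"
    by (rule smooth_into_cover2[OF manifold_RM smooth_cover2_point[OF manifold_RM c]
          locally_constant_cover2_index[OF manifold_RM c]]) auto
  have 3: "smooth_map RM (cover3 N I U)
      (\<lambda>q. ((\<lambda>(i, k). (i, k, i)) (fst (snd q)), snd (snd q)))"
    by (rule smooth_into_cover3[OF manifold_RM smooth_cover2_point[OF manifold_RM c]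
          locally_constant_cover2_index[OF manifold_RM c]]) auto
  have "smooth_map RM RM (\<lambda>q. (j (inv\<^bsub>H\<^esub> lam (snd q)) (inv\<^bsub>G\<^esub> fst q \<otimes>\<^bsub>G\<^esub>
      inv\<^bsub>G\<^esub> \<gamma> ((\<lambda>(i, k). (i, k, i)) (fst (snd q)), snd (snd q))), (prod.swap (fst (snd q)), snd (snd q))))"
    by (intro smooth_on_subset_Pair smooth_j smooth_H_inv smooth_G_inv smooth_G_mult manifold_RM
        manifold_G manifold_cover2 smooth_lam_compose smooth_gamma_compose g c 2 3)
  then show ?thesis
    by (rule smooth_on_subset_cong) auto
qed

lemma smooth_gmul: "smooth_on_subset (prod_manifold RM RM) (composable R) RM (\<lambda>(r, r'). gmul R r r')"
proof -
  have M: "smooth_manifold (prod_manifold RM RM)"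
    by (intro smooth_manifold_prod_manifold[of RM RM] manifold_RM)
  have S: "composable R \<subseteq> points RM \<times> points RM"
    by (auto simp: composable_def)
  note r = smooth_on_subset_fst[OF manifold_RM manifold_RM S]
  note r' = smooth_on_subset_snd[OF manifold_RM manifold_RM S]
  note g = smooth_R_group[OF M r] and g' = smooth_R_group[OF M r']
  note c = smooth_R_cover[OF M r] and c' = smooth_R_cover[OF M r']
  \<comment> \<open>On a composable pair (g, x_ik), (g', x_kl) the maps \<open>2\<close> and
    \<open>3\<close> return x_il and x_ikl.\<close>
  have 2: "smooth_on_subset (prod_manifold RM RM) (composable R) (cover2 N I U)
      (\<lambda>q. ((fst (fst (snd (fst q))), snd (fst (snd (snd q)))), snd (snd (fst q))))"
    by (rule smooth_into_cover2[OF M smooth_cover2_point[OF M c] locally_constant_on_Pair[OF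
          locally_constant_cover2_index[OF M c, of fst] locally_constant_cover2_index[OF M c', of snd]]])
      (auto simp: composable_R)
  have 3: "smooth_on_subset (prod_manifold RM RM) (composable R) (cover3 N I U)
      (\<lambda>q. ((fst (fst (snd (fst q))), fst (snd (snd q))), snd (snd (fst q))))"
    by (rule smooth_into_cover3[OF M smooth_cover2_point[OF M c] locally_constant_on_Pair[OF
          locally_constant_cover2_index[OF M c, of fst] locally_constant_cover2_index[OF M c', of "\<lambda>i. i"]]])
      (auto simp: composable_R)
  have "smooth_on_subset (prod_manifold RM RM) (composable R) RM
      (\<lambda>q. (fst (fst q) \<otimes>\<^bsub>G\<^esub> j (lam (snd (fst q))) (fst (snd q)) \<otimes>\<^bsub>G\<^esub>
        \<gamma> ((fst (fst (snd (fst q))), fst (snd (snd q))), snd (snd (fst q))),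
        ((fst (fst (snd (fst q))), snd (fst (snd (snd q)))), snd (snd (fst q)))))"
    by (intro smooth_on_subset_Pair smooth_j smooth_G_mult M
        manifold_G manifold_cover2 smooth_lam_compose smooth_gamma_compose g g' c 2 3)
  then show ?thesis
    by (rule smooth_on_subset_cong) (auto simp: composable_R)
qed

lemma surjective_submersion_R:
  "surjective_submersion RM (cover1 N I U) (src R)"
  "surjective_submersion RM (cover1 N I U) (tgt R)"
  "surjective_submersion RM (cover2 N I U) snd"
proof -
  have "(i, x) \<in> src R ` points RM" "(i, x) \<in> tgt R ` points RM" if "i \<in> I" "x \<in> U i" for i x
    using that by (auto intro!: image_eqI[of _ _ "(\<one>\<^bsub>G\<^esub>, ((i, i), x))"])
  then have im: "src R ` points RM = points (cover1 N I U)" "tgt R ` points RM = points (cover1 N I U)"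
    "snd ` points RM = points (cover2 N I U)"
    by (auto simp: points_cover1)
  show "surjective_submersion RM (cover1 N I U) (src R)"
    using im(1) unfolding cover1_pieces cover2_pieces
    by (intro surjective_submersion_prod_pieces[where h = fst]) (auto intro: manifold_N manifold_G open_U)
  show "surjective_submersion RM (cover1 N I U) (tgt R)"
    using im(2) unfolding cover1_pieces cover2_pieces
    by (intro surjective_submersion_prod_pieces[where h = snd]) (auto intro: manifold_N manifold_G open_U)
  show "surjective_submersion RM (cover2 N I U) snd"
    using im(3) unfolding cover2_pieces
    by (intro surjective_submersion_prod_pieces[where h = "\<lambda>i. i"]) (auto intro: manifold_N manifold_G open_U)
qed

lemma lie_groupoid_R: "lie_groupoid R"
  unfolding lie_groupoid_def R_simps(1,2)
proof (intro conjI manifold_RM manifold_cover1 surjective_submersion_R smooth_gunit smooth_ginv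
    smooth_gmul allI impI ballI)
  fix r r' r'' assume "(r, r') \<in> composable R \<and> (r', r'') \<in> composable R"
  then show "gmul R (gmul R r r') r'' = gmul R r (gmul R r' r'')"
    \<comment> \<open>The restricted simplification keeps the products folded, so that
      \<open>gmul_assoc\<close> matches once the pairs are decomposed.\<close>
    using gmul_assoc by (auto simp only: composable_R mem_Collect_eq prod.inject)
next
  fix r assume "r \<in> points RM"
  then obtain g i k x where r: "r = (g, ((i, k), x))" "g \<in> carrier G" "i \<in> I" "k \<in> I" "x \<in> U i" "x \<in> U k"
    by auto
  show "gmul R (gunit R (src R r)) r = r" "gmul R r (gunit R (tgt R r)) = r"
    "src R (ginv R r) = tgt R r" "tgt R (ginv R r) = src R r"
    using r by simp_all
  show "gmul R r (ginv R r) = gunit R (src R r)" "gmul R (ginv R r) r = gunit R (tgt R r)"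
    unfolding r(1) gmul_ginv[OF r(3-6,2)] ginv_gmul[OF r(3-6,2)] by simp_all
qed (auto simp: composable_R points_cover1)

section \<open>The kernel as a trivial bundle of groups\<close>

lemma kernel_carrier:
  "i \<in> I \<Longrightarrow> x \<in> U i \<Longrightarrow> carrier (kernel_fibre R C snd (i, x)) = carrier G \<times> {((i, i), x)}"
  by (auto simp: kernel_fibre_def)

text \<open>Both \<lambda>_ii and g_iii are trivial, so the twisted product restricts to the
  multiplication of \<open>G\<close>.\<close>

lemma kernel_mult:
  "i \<in> I \<Longrightarrow> x \<in> U i \<Longrightarrow> g \<in> carrier G \<Longrightarrow> g' \<in> carrier G \<Longrightarrow>
    (g, ((i, i), x)) \<otimes>\<^bsub>kernel_fibre R C snd (i, x)\<^esub> (g', ((i, i), x)) = (g \<otimes>\<^bsub>G\<^esub> g', ((i, i), x))"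
  by (simp add: kernel_fibre_def)

lemma auto_iso_kernel:
  assumes "i \<in> I" "x \<in> U i" "a \<in> auto G"
  shows "(\<lambda>g\<in>carrier G. (a g, ((i, i), x))) \<in> iso G (kernel_fibre R C snd (i, x))"
proof (rule isoI)
  have a: "a \<in> hom G G" "bij_betw a (carrier G) (carrier G)"
    using assms(3) by (auto simp: auto_def Bij_def)
  show "(\<lambda>g\<in>carrier G. (a g, ((i, i), x))) \<in> hom G (kernel_fibre R C snd (i, x))"
    using a(1) assms(1,2) by (intro homI) (auto simp: kernel_carrier kernel_mult hom_def Pi_iff)
  show "bij_betw (\<lambda>g\<in>carrier G. (a g, ((i, i), x))) (carrier G) (carrier (kernel_fibre R C snd (i, x)))"
    using a(2) assms(1,2) by (auto simp: bij_betw_def kernel_carrier inj_on_def image_iff)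
qed

lemma lie_groupoid_extension_R: "lie_groupoid_extension R C snd"
  unfolding lie_groupoid_extension_def
  using lie_groupoid_R lie_groupoid_cech surjective_submersion_R(3) by (auto simp: composable_R)

text \<open>The kernel is globally trivial: \<open>V\<close> is the whole object manifold,
  \<open>\<Phi>\<close> sends (x_i, g) to (g, x_ii), and \<open>\<Psi>\<close> is its
  inverse.\<close>

lemma lie_groupoid_G_extension_R: "lie_groupoid_G_extension G R C snd"
  unfolding lie_groupoid_G_extension_def R_simps
proof (intro conjI lie_groupoid_extension_R ballI)
  let ?M = "prod_manifold (cover1 N I U) (mfd G)" and ?V = "points (cover1 N I U)"
  let ?K = "\<Union>v\<in>?V. carrier (kernel_fibre R C snd v)"
  define \<Phi> where "\<Phi> = (\<lambda>p :: ('i \<times> 'x) \<times> 'g. (snd p, ((fst (fst p), fst (fst p)), snd (fst p))))"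
  define \<Psi> where "\<Psi> = (\<lambda>r :: 'g \<times> ('i \<times> 'i) \<times> 'x. ((fst (fst (snd r)), snd (snd r)), fst r))"
  have K: "?K = {(g, ((i, i), x)) | g i x. g \<in> carrier G \<and> i \<in> I \<and> x \<in> U i}"
    by (auto simp: points_cover1 kernel_carrier)
  have M: "smooth_manifold ?M"
    by (intro smooth_manifold_prod_manifold manifold_cover1 manifold_G)
  note idM = smooth_on_subset_id[OF M order_refl]
  note c = smooth_on_subset_fst_compose[OF M manifold_cover1 manifold_G idM]
  note g = smooth_on_subset_snd_compose[OF M manifold_cover1 manifold_G idM]
  have "smooth_map ?M (cover2 N I U) (\<lambda>p. ((fst (fst p), fst (fst p)), snd (fst p)))"
    by (rule smooth_into_cover2[OF M smooth_cover1_point[OF M c]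
          locally_constant_cover1_index[OF M c, of "\<lambda>i. (i, i)"]]) auto
  then have smooth_Phi: "smooth_map ?M RM \<Phi>"
    unfolding \<Phi>_def by (intro smooth_on_subset_Pair M manifold_G manifold_cover2 g)
  have KRM: "?K \<subseteq> points RM"
    unfolding K by auto
  note idK = smooth_on_subset_id[OF manifold_RM KRM]
  note gK = smooth_R_group[OF manifold_RM idK] and cK = smooth_R_cover[OF manifold_RM idK]
  have "smooth_on_subset RM ?K (cover1 N I U) (\<lambda>r. (fst (fst (snd r)), snd (snd r)))"
    by (rule smooth_into_cover1[OF manifold_RM smooth_cover2_point[OF manifold_RM cK]
          locally_constant_cover2_index[OF manifold_RM cK, of fst]]) (auto simp: K)
  then have smooth_Psi: "smooth_on_subset RM ?K ?M \<Psi>"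
    unfolding \<Psi>_def by (intro smooth_on_subset_Pair manifold_RM manifold_cover1 manifold_G gK)
  have diffeo: "diffeo_on ?M (?V \<times> carrier G) RM ?K \<Phi>"
    by (rule diffeo_onI[OF _ smooth_Psi]) (use smooth_Phi in \<open>auto simp: K \<Phi>_def \<Psi>_def\<close>)
  have iso: "\<forall>v\<in>?V. (\<lambda>g. \<Phi> (v, g)) \<in> iso G (kernel_fibre R C snd v)"
  proof
    fix v assume "v \<in> ?V"
    then obtain i x where v: "v = (i, x)" "i \<in> I" "x \<in> U i"
      by (auto simp: points_cover1)
    then show "(\<lambda>g. \<Phi> (v, g)) \<in> iso G (kernel_fibre R C snd v)"
      by (intro isoI homI) (auto simp: \<Phi>_def kernel_carrier kernel_mult bij_betw_def inj_on_def image_iff)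
  qed
  fix m assume "m \<in> ?V"
  then show "\<exists>V \<Phi>. openin (mtop (cover1 N I U)) V \<and> m \<in> V \<and>
      diffeo_on ?M (V \<times> carrier G) RM (\<Union>v\<in>V. carrier (kernel_fibre R C snd v)) \<Phi> \<and>
      (\<forall>v\<in>V. (\<lambda>g. \<Phi> (v, g)) \<in> iso G (kernel_fibre R C snd v))"
    using diffeo iso by (intro exI[of _ ?V] exI[of _ \<Phi>]) simp
qed

section \<open>The trivial principal bundle with its left action\<close>

lemma principal_bundle_E: "principal_bundle H PM (cover1 N I U) fst (ext_ract E)"
  unfolding principal_bundle_def
proof (intro conjI manifold_PM manifold_cover1 ballI)
  note idP = smooth_on_subset_id[OF manifold_PM order_refl]
  show "smooth_map PM (cover1 N I U) fst"
    using smooth_on_subset_fst[OF manifold_cover1 manifold_H order_refl] by simp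
  have M: "smooth_manifold (prod_manifold PM (mfd H))"
    by (intro smooth_manifold_prod_manifold manifold_PM[unfolded points_prod_manifold] manifold_H manifold_cover1)
  note id = smooth_on_subset_id[OF M order_refl]
  note p = smooth_on_subset_fst_compose[OF M manifold_PM manifold_H id]
  have "smooth_map (prod_manifold PM (mfd H)) PM (\<lambda>q. (fst (fst q), snd (fst q) \<otimes>\<^bsub>H\<^esub> snd q))"
    by (intro smooth_on_subset_Pair smooth_H_mult M manifold_cover1 manifold_H
        smooth_on_subset_fst_compose[OF M manifold_cover1 manifold_H p]
        smooth_on_subset_snd_compose[OF M manifold_cover1 manifold_H p]
        smooth_on_subset_snd_compose[OF M manifold_PM manifold_H id])
  then show "smooth_map (prod_manifold PM (mfd H)) PM (\<lambda>(p, h). ext_ract E p h)"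
    by (rule smooth_on_subset_cong) auto
  fix m assume "m \<in> points (cover1 N I U)"
  \<comment> \<open>The total space is already a product, so the identity is a global
    trivialisation.\<close>
  moreover have "diffeo_on PM (points (cover1 N I U) \<times> carrier H) PM
      {p \<in> points PM. fst p \<in> points (cover1 N I U)} (\<lambda>p. p)"
    by (rule diffeo_onI) (auto intro!: smooth_on_subset_id manifold_PM)
  ultimately show "\<exists>V \<Psi>. openin (mtop (cover1 N I U)) V \<and> m \<in> V \<and>
      diffeo_on PM (V \<times> carrier H) PM {p \<in> points PM. fst p \<in> V} \<Psi> \<and>
      (\<forall>v\<in>V. \<forall>h\<in>carrier H. fst (\<Psi> (v, h)) = v \<and>
         (\<forall>h'\<in>carrier H. ext_ract E (\<Psi> (v, h)) h' = \<Psi> (v, h \<otimes>\<^bsub>H\<^esub> h')))"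
    by (intro exI[of _ "points (cover1 N I U)"] exI[of _ "\<lambda>p. p"]) auto
qed (auto simp: H.m_assoc)

lemma groupoid_action_E: "groupoid_action R PM fst (ext_lact E)"
  unfolding groupoid_action_def R_simps
proof (intro conjI)
  show "surjective_submersion PM (cover1 N I U) fst"
    using H.one_closed by (intro surjective_submersion_fst manifold_cover1 manifold_H) auto
  let ?M = "prod_manifold RM PM" and ?S = "{(r, p). r \<in> points RM \<and> p \<in> points PM \<and> tgt R r = fst p}"
  have M: "smooth_manifold ?M"
    by (intro smooth_manifold_prod_manifold[of RM PM] manifold_RM manifold_PM)
  have S: "?S \<subseteq> points RM \<times> points PM" by auto
  note r = smooth_on_subset_fst[OF manifold_RM manifold_PM S]
  note p = smooth_on_subset_snd[OF manifold_RM manifold_PM S]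
  note g = smooth_R_group[OF M r] and c = smooth_R_cover[OF M r]
  note h = smooth_on_subset_snd_compose[OF M manifold_cover1 manifold_H p]
  have 1: "smooth_on_subset ?M ?S (cover1 N I U) (\<lambda>q. (fst (fst (snd (fst q))), snd (snd (fst q))))"
    by (rule smooth_into_cover1[OF M smooth_cover2_point[OF M c]
          locally_constant_cover2_index[OF M c, of fst]]) auto
  have "smooth_on_subset ?M ?S PM (\<lambda>q. ((fst (fst (snd (fst q))), snd (snd (fst q))),
      \<rho> (fst (fst q)) \<otimes>\<^bsub>H\<^esub> lam (snd (fst q)) \<otimes>\<^bsub>H\<^esub> snd (snd q)))"
    by (intro smooth_on_subset_Pair smooth_H_mult M manifold_cover1 manifold_H 1 h
        smooth_rho g smooth_lam_compose c)
  then show "smooth_on_subset ?M ?S PM (\<lambda>(r, p). ext_lact E r p)"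
    by (rule smooth_on_subset_cong) auto
  have "ext_lact E (gmul R (g, ((i, k), x)) (g', ((k, l), x))) ((l, x), h)
      = ext_lact E (g, ((i, k), x)) (ext_lact E (g', ((k, l), x)) ((l, x), h))"
    if "i \<in> I" "k \<in> I" "l \<in> I" "x \<in> U i" "x \<in> U k" "x \<in> U l" "g \<in> carrier G" "g' \<in> carrier G"
      "h \<in> carrier H" for g i k x g' l h
  proof -
    let ?a = "lam ((i, k), x)" and ?b = "lam ((k, l), x)"
    \<comment> \<open>Expanding \<rho>(\<lambda>_ik(g')) by the crossed module law leaves
      \<lambda>_ik^{-1} in front of \<rho>(g_ikl) \<lambda>_il h. The first cocycle identity turns
      the latter into \<lambda>_ik \<lambda>_kl h, and \<lambda>_ik cancels.\<close>
    have "\<rho> (\<gamma> ((i, k, l), x)) \<otimes>\<^bsub>H\<^esub> (lam ((i, l), x) \<otimes>\<^bsub>H\<^esub> h) = ?a \<otimes>\<^bsub>H\<^esub> ?b \<otimes>\<^bsub>H\<^esub> h"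
      using rho_gamma[of i k l x] that by (simp add: H.m_assoc[symmetric])
    moreover have "inv\<^bsub>H\<^esub> ?a \<otimes>\<^bsub>H\<^esub> (?a \<otimes>\<^bsub>H\<^esub> (?b \<otimes>\<^bsub>H\<^esub> h)) = ?b \<otimes>\<^bsub>H\<^esub> h"
      using that by (simp add: H.m_assoc[symmetric])
    ultimately show ?thesis
      using that by (simp add: rho_j H.m_assoc)
  qed
  then show "\<forall>(r, r')\<in>composable R. \<forall>p\<in>points PM. tgt R r' = fst p \<longrightarrow>
      ext_lact E (gmul R r r') p = ext_lact E r (ext_lact E r' p)"
    by (auto simp only: composable_R mem_Collect_eq prod.inject points_prod_manifold mem_Times_iff
        R_simps fst_conv snd_conv points_H mem_cover1 split: prod.splits)
qed (auto simp: points_cover1)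

section \<open>The map \<chi> into the band\<close>

lemma chi_Band:
  assumes "i \<in> I" "x \<in> U i" "h \<in> carrier H"
  shows "ext_chi E ((i, x), h) \<in> Band G R C snd"
proof -
  let ?b = "\<lambda>g\<in>carrier G. (j h g, ((i, i), x))"
  let ?K = "carrier (kernel_fibre R C snd (i, x))"
  note K = kernel_carrier[OF assms(1,2)]
  note idG = smooth_on_subset_id[OF manifold_G order_refl]
  have "smooth_map (mfd G) RM (\<lambda>g. (j h g, ((i, i), x)))"
    using assms
    by (intro smooth_on_subset_Pair smooth_j smooth_on_subset_const idG manifold_G manifold_H manifold_cover2)
      auto
  then have 1: "smooth_on_subset (mfd G) (carrier G) RM ?b"
    unfolding points_G by (rule smooth_on_subset_cong) simp
  have S: "?K \<subseteq> points RM"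
    using assms by (auto simp: K)
  \<comment> \<open>The inverse of \<chi>(x_i, h) forgets x_ii and applies j(h^{-1}); it is smooth
    on the kernel fibre as a restriction from \<open>RM\<close>.\<close>
  have 2: "smooth_on_subset RM ?K (mfd G) (\<lambda>r. j (inv\<^bsub>H\<^esub> h) (fst r))"
    using assms S
    by (intro smooth_j smooth_on_subset_const smooth_R_group[OF manifold_RM] smooth_on_subset_id
        manifold_RM manifold_H) auto
  have "diffeo_on (mfd G) (carrier G) RM ?K ?b"
    by (rule diffeo_onI[OF 1 2]) (use assms in \<open>auto simp: K\<close>)
  then show ?thesis
    using assms auto_iso_kernel[OF assms(1,2) j_auto[OF assms(3)]] by (simp add: Band_def lie_Isom_def)
qed

lemma smooth_chi: "smooth_family PM G RM (\<lambda>p. snd (ext_chi E p))"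
proof -
  let ?M = "prod_manifold PM (mfd G)"
  have M: "smooth_manifold ?M"
    by (intro smooth_manifold_prod_manifold[of PM] manifold_PM manifold_G)
  note id = smooth_on_subset_id[OF M order_refl]
  note p = smooth_on_subset_fst_compose[OF M manifold_PM manifold_G id]
  note g = smooth_on_subset_snd_compose[OF M manifold_PM manifold_G id]
  note c = smooth_on_subset_fst_compose[OF M manifold_cover1 manifold_H p]
  note h = smooth_on_subset_snd_compose[OF M manifold_cover1 manifold_H p]
  have 2: "smooth_map ?M (cover2 N I U)
      (\<lambda>q. ((fst (fst (fst q)), fst (fst (fst q))), snd (fst (fst q))))"
    by (rule smooth_into_cover2[OF M smooth_cover1_point[OF M c]
          locally_constant_cover1_index[OF M c, of "\<lambda>i. (i, i)"]]) auto
  have "smooth_map ?M RM (\<lambda>q. (j (snd (fst q)) (snd q),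
      ((fst (fst (fst q)), fst (fst (fst q))), snd (fst (fst q)))))"
    by (intro smooth_on_subset_Pair smooth_j M manifold_G manifold_cover2 g h 2)
  then show ?thesis
    unfolding smooth_family_def by (rule smooth_on_subset_cong) auto
qed

text \<open>Since j is multiplicative and j \<circ> \<rho> is conjugation, the left side sends a to
  g \<lambda>_ik(h(h'(a))) g^{-1}. Conjugation by (g, x_ik) gives the same: g_ikk = e, and in the
  second product the factor g_iki cancels against its inverse inside the groupoid inverse.\<close>

lemma chi_equivariant:
  assumes "i \<in> I" "k \<in> I" "x \<in> U i" "x \<in> U k" "g \<in> carrier G" "h \<in> carrier H" "h' \<in> carrier H"
  shows "ext_chi E (ext_ract E (ext_lact E (g, ((i, k), x)) ((k, x), h)) h')
    = band_ract G (band_lact G R (g, ((i, k), x)) (ext_chi E ((k, x), h))) (j h')"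
proof -
  have "j (\<rho> g \<otimes>\<^bsub>H\<^esub> lam ((i, k), x) \<otimes>\<^bsub>H\<^esub> h \<otimes>\<^bsub>H\<^esub> h') a
      = g \<otimes>\<^bsub>G\<^esub> (j (lam ((i, k), x)) (j h (j h' a)) \<otimes>\<^bsub>G\<^esub> inv\<^bsub>G\<^esub> g)" if "a \<in> carrier G" for a
    using assms that by (simp add: j_apply_mult j_rho G.m_assoc)
  then show ?thesis
    using assms by (auto simp: band_ract_def band_lact_def compose_def G.m_assoc intro!: restrict_ext)
qed

lemma gh_extension_E: "gh_extension G H \<rho> j C E"
  unfolding gh_extension_def principal_bundle_over_groupoid_def E_simps(1-4) R_simps(1,2)
proof (intro conjI lie_groupoid_G_extension_R principal_bundle_E groupoid_action_E smooth_chi ballI impI)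
  fix r p h assume "r \<in> points RM" "p \<in> points PM" "h \<in> carrier H" "tgt R r = fst p"
  then obtain g i k x h' where "r = (g, ((i, k), x))" "p = ((k, x), h')" "g \<in> carrier G" "i \<in> I" "k \<in> I"
    "x \<in> U i" "x \<in> U k" "h' \<in> carrier H" by auto
  then show "ext_lact E r (ext_ract E p h) = ext_ract E (ext_lact E r p) h"
    "ext_chi E (ext_ract E (ext_lact E r p) h) = band_ract G (band_lact G R r (ext_chi E p)) (j h)"
    using chi_equivariant \<open>h \<in> carrier H\<close> by (simp_all only: ) (simp add: H.m_assoc)
next
  fix p assume "p \<in> points PM"
  then obtain i x h where p: "p = ((i, x), h)" "i \<in> I" "x \<in> U i" "h \<in> carrier H" by auto
  then show "ext_chi E p \<in> Band G R C snd" "fst (ext_chi E p) = fst p"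
    using chi_Band by auto
  fix g assume "g \<in> carrier G"
  \<comment> \<open>In the fibre this is h \<rho>(g) = \<rho>(h(g)) h, the first crossed module
    law.\<close>
  then show "ext_ract E p (\<rho> g) = ext_lact E (snd (ext_chi E p) g) p"
    using p by (simp add: rho_j H.m_assoc)
qed

lemma adapted_extension_E: "adapted_extension G H \<rho> j N I U E"
  unfolding adapted_extension_def using gh_extension_E by auto

text \<open>The second components of the formulas for \<star> and \<bullet> at neutral elements
  return \<lambda> and g themselves; agreement holds on the disjoint unions, the only places where
  these total functions carry meaning.\<close>

lemma cocycle_lambda_E: "c \<in> points (cover2 N I U) \<Longrightarrow> cocycle_lambda G H E c = lam c"
  by (auto simp: cocycle_lambda_def points_cover2)

lemma cocycle_g_E: "c \<in> points (cover3 N I U) \<Longrightarrow> cocycle_g G E c = \<gamma> c"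
  by (auto simp: cocycle_g_def points_cover3)

end

section \<open>From extensions to cocycles\<close>

text \<open>A left inverse \<open>a\<close> of \<open>r\<close> is the inverse, by associativity of
  the triple \<open>a\<close>, \<open>r\<close>, \<open>ginv Q r\<close>. It recovers the inverse of
  an arbitrary adapted extension from its product.\<close>

lemma lie_groupoid_ginv_unique:
  assumes Q: "lie_groupoid Q" and r: "r \<in> points (arrows Q)" and a: "a \<in> points (arrows Q)"
    and "tgt Q a = src Q r" "src Q a = tgt Q r" and ar: "gmul Q a r = gunit Q (tgt Q r)"
  shows "a = ginv Q r"
proof -
  have smooth: "smooth_map (arrows Q) (arrows Q) (ginv Q)"
    and assoc: "\<And>x y z. (x, y) \<in> composable Q \<Longrightarrow> (y, z) \<in> composable Q \<Longrightarrow>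
      gmul Q (gmul Q x y) z = gmul Q x (gmul Q y z)"
    and units: "\<And>x. x \<in> points (arrows Q) \<Longrightarrow> gmul Q (gunit Q (src Q x)) x = x \<and> gmul Q x (gunit Q (tgt Q x)) = x"
    and inv: "src Q (ginv Q r) = tgt Q r" "gmul Q r (ginv Q r) = gunit Q (src Q r)"
    using Q r unfolding lie_groupoid_def by blast+
  have b: "ginv Q r \<in> points (arrows Q)"
    using smooth_on_subset_points(2)[OF smooth] r by blast
  have "(a, r) \<in> composable Q" "(r, ginv Q r) \<in> composable Q"
    using assms b inv by (auto simp: composable_def)
  from assoc[OF this] have "gmul Q (gunit Q (src Q (ginv Q r))) (ginv Q r) = gmul Q a (gunit Q (tgt Q a))"
    using assms inv by simp
  then show ?thesis
    using units[OF a] units[OF b] by simp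
qed

locale adapted_cech_extension = cech_crossed_module N I U G H \<rho> j
  for N :: "('x, 'e::finite_dim_normed) manifold" and I :: "'i set" and U :: "'i \<Rightarrow> 'x set"
    and G :: "('g, 'a::finite_dim_normed) lie_group_data"
    and H :: "('h, 'b::finite_dim_normed) lie_group_data"
    and \<rho> :: "'g \<Rightarrow> 'h" and j :: "'h \<Rightarrow> 'g \<Rightarrow> 'g" +
  fixes X :: "('x, 'e, 'i, 'g, 'a, 'h, 'b) cech_extension"
  assumes adapted: "adapted_extension G H \<rho> j N I U X"
begin

abbreviation Q where "Q \<equiv> ext_groupoid X"
abbreviation lam where "lam \<equiv> cocycle_lambda G H X"
abbreviation \<gamma> where "\<gamma> \<equiv> cocycle_g G X"

lemma gh_extension_X: "gh_extension G H \<rho> j (cech N I U) X"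
  and arrows_Q: "arrows Q = RM"
  and prj_X: "\<forall>r\<in>points (arrows Q). ext_prj X r = snd r"
  and bundle_X: "ext_bundle X = PM"
  and bundle_prj_X: "\<forall>p\<in>points (ext_bundle X). ext_bundle_prj X p = fst p"
  and ract_X: "\<forall>i\<in>I. \<forall>x\<in>U i. \<forall>h\<in>carrier H. \<forall>h'\<in>carrier H.
        ext_ract X ((i, x), h) h' = ((i, x), h \<otimes>\<^bsub>H\<^esub> h')"
  and chi_X: "\<forall>i\<in>I. \<forall>x\<in>U i. \<forall>h\<in>carrier H.
        ext_chi X ((i, x), h) = ((i, x), \<lambda>g\<in>carrier G. (j h g, ((i, i), x)))"
  and gmul_kernel: "\<forall>i\<in>I. \<forall>k\<in>I. \<forall>x \<in> U i \<inter> U k. \<forall>g\<in>carrier G. \<forall>g'\<in>carrier G.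
        gmul Q (g, ((i, i), x)) (g', ((i, k), x)) = (g \<otimes>\<^bsub>G\<^esub> g', ((i, k), x))"
  using adapted unfolding adapted_extension_def by - (elim conjE, assumption)+

section \<open>What \<phi> and the kernel condition force on source, target, unit and
  product\<close>

lemma prj [simp]: "g \<in> carrier G \<Longrightarrow> i \<in> I \<Longrightarrow> k \<in> I \<Longrightarrow> x \<in> U i \<Longrightarrow> x \<in> U k \<Longrightarrow>
    ext_prj X (g, ((i, k), x)) = ((i, k), x)"
  using prj_X by (simp add: arrows_Q)

lemma bundle_prj [simp]: "i \<in> I \<Longrightarrow> x \<in> U i \<Longrightarrow> h \<in> carrier H \<Longrightarrow> ext_bundle_prj X ((i, x), h) = (i, x)"
  using bundle_prj_X by (simp add: bundle_X)

lemma extension_Q: "lie_groupoid_extension Q (cech N I U) (ext_prj X)"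
  using gh_extension_X unfolding gh_extension_def lie_groupoid_G_extension_def by (elim conjE)

lemma lie_groupoid_Q: "lie_groupoid Q" and objects_Q: "objects Q = cover1 N I U"
  using extension_Q by (simp_all add: lie_groupoid_extension_def)

lemma src_tgt_Q [simp]:
  assumes "g \<in> carrier G" "i \<in> I" "k \<in> I" "x \<in> U i" "x \<in> U k"
  shows "src Q (g, ((i, k), x)) = (i, x)" "tgt Q (g, ((i, k), x)) = (k, x)"
proof -
  have "\<forall>r\<in>points (arrows Q). src (cech N I U) (ext_prj X r) = src Q r \<and> tgt (cech N I U) (ext_prj X r) = tgt Q r"
    using extension_Q unfolding lie_groupoid_extension_def by (elim conjE)
  from bspec[OF this, of "(g, ((i, k), x))"] show "src Q (g, ((i, k), x)) = (i, x)"
    "tgt Q (g, ((i, k), x)) = (k, x)"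
    using assms by (simp_all add: arrows_Q)
qed

lemma composable_Q: "composable Q = {((g, ((i, k), x)), (g', ((k', l), x'))) | g i k x g' k' l x'.
    g \<in> carrier G \<and> i \<in> I \<and> k \<in> I \<and> x \<in> U i \<and> x \<in> U k \<and> g' \<in> carrier G \<and> l \<in> I \<and> x \<in> U l \<and> k' = k \<and> x' = x}"
  by (auto simp: composable_def arrows_Q)

text \<open>As \<phi> is multiplicative and equals the second projection, the Cech component of a
  product is that of the Cech groupoid; only the component in \<open>G\<close> remains
  unknown.\<close>

lemma gmul_mem:
  assumes "g \<in> carrier G" "g' \<in> carrier G" "i \<in> I" "k \<in> I" "l \<in> I" "x \<in> U i" "x \<in> U k" "x \<in> U l"
  obtains a where "a \<in> carrier G" "gmul Q (g, ((i, k), x)) (g', ((k, l), x)) = (a, ((i, l), x))"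
proof -
  let ?r = "(g, ((i, k), x))" and ?r' = "(g', ((k, l), x))"
  have c: "(?r, ?r') \<in> composable Q"
    using assms by (simp add: composable_Q)
  have "smooth_on_subset (prod_manifold (arrows Q) (arrows Q)) (composable Q) (arrows Q) (\<lambda>(x, y). gmul Q x y)"
    using lie_groupoid_Q unfolding lie_groupoid_def by (elim conjE)
  from smooth_on_subset_points(2)[OF this] c have mem: "gmul Q ?r ?r' \<in> points RM"
    by (auto simp: arrows_Q)
  have "\<forall>(r, r')\<in>composable Q. ext_prj X (gmul Q r r') = gmul (cech N I U) (ext_prj X r) (ext_prj X r')"
    using extension_Q unfolding lie_groupoid_extension_def by (elim conjE)
  from bspec[OF this c] have "ext_prj X (gmul Q ?r ?r') = ((i, l), x)"
    using assms by simp
  then have "snd (gmul Q ?r ?r') = ((i, l), x)"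
    using bspec[OF prj_X mem[folded arrows_Q]] by simp
  then show thesis
    using mem by (intro that[of "fst (gmul Q ?r ?r')"]) (auto simp: prod_eq_iff)
qed

lemma gamma_eq:
  assumes "i \<in> I" "k \<in> I" "l \<in> I" "x \<in> U i" "x \<in> U k" "x \<in> U l"
  shows "gmul Q (\<one>\<^bsub>G\<^esub>, ((i, k), x)) (\<one>\<^bsub>G\<^esub>, ((k, l), x)) = (\<gamma> ((i, k, l), x), ((i, l), x))"
    and "\<gamma> ((i, k, l), x) \<in> carrier G"
proof -
  obtain a where "a \<in> carrier G"
    "gmul Q (\<one>\<^bsub>G\<^esub>, ((i, k), x)) (\<one>\<^bsub>G\<^esub>, ((k, l), x)) = (a, ((i, l), x))"
    using gmul_mem[OF G.one_closed G.one_closed assms] by blast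
  then show "gmul Q (\<one>\<^bsub>G\<^esub>, ((i, k), x)) (\<one>\<^bsub>G\<^esub>, ((k, l), x)) = (\<gamma> ((i, k, l), x), ((i, l), x))"
    and "\<gamma> ((i, k, l), x) \<in> carrier G"
    by (simp_all add: cocycle_g_def)
qed

text \<open>The unit has source and target (i, x), hence is (u, x_ii) for some u. Multiplying it
  with (e, x_ii) gives (u, x_ii) by the kernel condition and (e, x_ii) by the unit law.\<close>

lemma gunit_Q:
  assumes "i \<in> I" "x \<in> U i"
  shows "gunit Q (i, x) = (\<one>\<^bsub>G\<^esub>, ((i, i), x))"
proof -
  have "smooth_map (objects Q) (arrows Q) (gunit Q)"
    using lie_groupoid_Q unfolding lie_groupoid_def by (elim conjE)
  from smooth_on_subset_points(2)[OF this] have "gunit Q (i, x) \<in> points RM"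
    using assms by (simp add: arrows_Q objects_Q image_subset_iff points_cover1)
  then obtain u k l y where u: "gunit Q (i, x) = (u, ((k, l), y))" "u \<in> carrier G" "k \<in> I" "l \<in> I"
    "y \<in> U k" "y \<in> U l" by (cases "gunit Q (i, x)") auto
  have "\<forall>m\<in>points (objects Q). src Q (gunit Q m) = m \<and> tgt Q (gunit Q m) = m"
    using lie_groupoid_Q unfolding lie_groupoid_def by (elim conjE)
  from bspec[OF this, of "(i, x)"] have eq: "k = i" "l = i" "y = x"
    using assms u by (simp_all add: objects_Q)
  have "\<forall>x\<in>points (arrows Q). gmul Q (gunit Q (src Q x)) x = x \<and> gmul Q x (gunit Q (tgt Q x)) = x"
    using lie_groupoid_Q unfolding lie_groupoid_def by (elim conjE)
  from bspec[OF this, of "(\<one>\<^bsub>G\<^esub>, ((i, i), x))"]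
  have "gmul Q (u, ((i, i), x)) (\<one>\<^bsub>G\<^esub>, ((i, i), x)) = (\<one>\<^bsub>G\<^esub>, ((i, i), x))"
    using assms u eq by (simp add: arrows_Q)
  then have "u = \<one>\<^bsub>G\<^esub>"
    using gmul_kernel assms u(2) by simp
  then show ?thesis
    using u(1) eq by simp
qed

lemma gmul_assoc_Q:
  assumes "g \<in> carrier G" "g' \<in> carrier G" "g'' \<in> carrier G" "i \<in> I" "k \<in> I" "l \<in> I" "n \<in> I"
    "x \<in> U i" "x \<in> U k" "x \<in> U l" "x \<in> U n"
  shows "gmul Q (gmul Q (g, ((i, k), x)) (g', ((k, l), x))) (g'', ((l, n), x))
    = gmul Q (g, ((i, k), x)) (gmul Q (g', ((k, l), x)) (g'', ((l, n), x)))"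
proof -
  have "\<forall>x y z. (x, y) \<in> composable Q \<and> (y, z) \<in> composable Q \<longrightarrow>
        gmul Q (gmul Q x y) z = gmul Q x (gmul Q y z)"
    using lie_groupoid_Q unfolding lie_groupoid_def by (elim conjE)
  then show ?thesis
    using assms by (simp add: composable_Q)
qed

section \<open>The action of the groupoid on the bundle\<close>

lemma bundle_over_Q:
  "principal_bundle_over_groupoid H Q PM (ext_bundle_prj X) (ext_ract X) (ext_lact X)"
  using gh_extension_X unfolding gh_extension_def bundle_X by (elim conjE)

lemma groupoid_action_Q: "groupoid_action Q PM (ext_bundle_prj X) (ext_lact X)"
  using bundle_over_Q unfolding principal_bundle_over_groupoid_def by (elim conjE)

text \<open>The action moves the base point from target to source, so only the component in
  \<open>H\<close> is left to determine.\<close>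

lemma lact_mem:
  assumes "g \<in> carrier G" "h \<in> carrier H" "i \<in> I" "k \<in> I" "x \<in> U i" "x \<in> U k"
  obtains h' where "h' \<in> carrier H" "ext_lact X (g, ((i, k), x)) ((k, x), h) = ((i, x), h')"
proof -
  let ?r = "(g, ((i, k), x))" and ?p = "((k, x), h)"
  let ?S = "{(r, p). r \<in> points (arrows Q) \<and> p \<in> points PM \<and> tgt Q r = ext_bundle_prj X p}"
  have c: "(?r, ?p) \<in> ?S"
    using assms by (simp add: arrows_Q)
  have "smooth_on_subset (prod_manifold (arrows Q) PM) ?S PM (\<lambda>(r, p). ext_lact X r p)"
    using groupoid_action_Q unfolding groupoid_action_def by (elim conjE)
  from smooth_on_subset_points(2)[OF this] c have mem: "ext_lact X ?r ?p \<in> points PM"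
    by (auto simp: image_subset_iff)
  have "\<forall>r\<in>points (arrows Q). \<forall>p\<in>points PM. tgt Q r = ext_bundle_prj X p \<longrightarrow>
      ext_bundle_prj X (ext_lact X r p) = src Q r"
    using groupoid_action_Q unfolding groupoid_action_def by (elim conjE)
  then have "ext_bundle_prj X (ext_lact X ?r ?p) = src Q ?r"
    using c by blast
  then have "fst (ext_lact X ?r ?p) = (i, x)"
    using bspec[OF bundle_prj_X mem[folded bundle_X]] assms by simp
  then show thesis
    using mem by (intro that[of "snd (ext_lact X ?r ?p)"]) (auto simp: prod_eq_iff)
qed

lemma lambda_eq:
  assumes "i \<in> I" "k \<in> I" "x \<in> U i" "x \<in> U k"
  shows "ext_lact X (\<one>\<^bsub>G\<^esub>, ((i, k), x)) ((k, x), \<one>\<^bsub>H\<^esub>) = ((i, x), lam ((i, k), x))"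
    and "lam ((i, k), x) \<in> carrier H"
proof -
  obtain h where "h \<in> carrier H" "ext_lact X (\<one>\<^bsub>G\<^esub>, ((i, k), x)) ((k, x), \<one>\<^bsub>H\<^esub>) = ((i, x), h)"
    using lact_mem[OF G.one_closed H.one_closed assms] by blast
  then show "ext_lact X (\<one>\<^bsub>G\<^esub>, ((i, k), x)) ((k, x), \<one>\<^bsub>H\<^esub>) = ((i, x), lam ((i, k), x))"
    and "lam ((i, k), x) \<in> carrier H"
    by (simp_all add: cocycle_lambda_def)
qed

lemma lact_ract:
  assumes "g \<in> carrier G" "h \<in> carrier H" "h' \<in> carrier H" "i \<in> I" "k \<in> I" "x \<in> U i" "x \<in> U k"
  shows "ext_lact X (g, ((i, k), x)) ((k, x), h \<otimes>\<^bsub>H\<^esub> h') = ext_ract X (ext_lact X (g, ((i, k), x)) ((k, x), h)) h'"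
proof -
  have "\<forall>r\<in>points (arrows Q). \<forall>p\<in>points PM. \<forall>h\<in>carrier H. tgt Q r = ext_bundle_prj X p \<longrightarrow>
      ext_lact X r (ext_ract X p h) = ext_ract X (ext_lact X r p) h"
    using bundle_over_Q unfolding principal_bundle_over_groupoid_def by (elim conjE)
  from this[rule_format, of "(g, ((i, k), x))" "((k, x), h)" h'] show ?thesis
    using assms ract_X by (simp add: arrows_Q)
qed

text \<open>The left action commutes with right translations, so its value at (x_k, e) determines it
  on the whole fibre.\<close>

lemma lact_one:
  assumes "h \<in> carrier H" "i \<in> I" "k \<in> I" "x \<in> U i" "x \<in> U k"
  shows "ext_lact X (\<one>\<^bsub>G\<^esub>, ((i, k), x)) ((k, x), h) = ((i, x), lam ((i, k), x) \<otimes>\<^bsub>H\<^esub> h)"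
  using lact_ract[of "\<one>\<^bsub>G\<^esub>" "\<one>\<^bsub>H\<^esub>" h i k x] lambda_eq[of i k x] assms ract_X by simp

lemma lact_kernel:
  assumes "g \<in> carrier G" "h \<in> carrier H" "i \<in> I" "x \<in> U i"
  shows "ext_lact X (g, ((i, i), x)) ((i, x), h) = ((i, x), \<rho> g \<otimes>\<^bsub>H\<^esub> h)"
proof -
  have "\<forall>p\<in>points PM. \<forall>g\<in>carrier G. ext_ract X p (\<rho> g) = ext_lact X (snd (ext_chi X p) g) p"
    using gh_extension_X unfolding gh_extension_def bundle_X by (elim conjE)
  \<comment> \<open>The argument h^{-1}(g) is chosen so that \<chi>(x_i, h) sends it to (g, x_ii);
    on the right side, h \<rho>(h^{-1}(g)) = \<rho>(g) h.\<close>
  from this[rule_format, of "((i, x), h)" "j (inv\<^bsub>H\<^esub> h) g"]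
  have "ext_lact X (g, ((i, i), x)) ((i, x), h) = ((i, x), h \<otimes>\<^bsub>H\<^esub> \<rho> (j (inv\<^bsub>H\<^esub> h) g))"
    using assms chi_X ract_X by simp
  then show ?thesis
    using assms by (simp add: rho_j H.m_assoc[symmetric])
qed

lemma lact_gmul:
  assumes "g \<in> carrier G" "g' \<in> carrier G" "h \<in> carrier H"
    "i \<in> I" "k \<in> I" "l \<in> I" "x \<in> U i" "x \<in> U k" "x \<in> U l"
  shows "ext_lact X (gmul Q (g, ((i, k), x)) (g', ((k, l), x))) ((l, x), h)
    = ext_lact X (g, ((i, k), x)) (ext_lact X (g', ((k, l), x)) ((l, x), h))"
proof -
  have "\<forall>(r, r')\<in>composable Q. \<forall>p\<in>points PM. tgt Q r' = ext_bundle_prj X p \<longrightarrow>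
      ext_lact X (gmul Q r r') p = ext_lact X r (ext_lact X r' p)"
    using groupoid_action_Q unfolding groupoid_action_def by (elim conjE)
  moreover have "((g, ((i, k), x)), (g', ((k, l), x))) \<in> composable Q"
    using assms by (simp add: composable_Q)
  ultimately have "\<forall>p\<in>points PM. tgt Q (g', ((k, l), x)) = ext_bundle_prj X p \<longrightarrow>
      ext_lact X (gmul Q (g, ((i, k), x)) (g', ((k, l), x))) p
        = ext_lact X (g, ((i, k), x)) (ext_lact X (g', ((k, l), x)) p)"
    by blast
  then show ?thesis
    using assms by simp
qed

text \<open>Factor (g, x_ik) as (g, x_ii) \<bullet> (e, x_ik): the second factor acts through
  \<lambda>_ik, and the kernel factor through \<rho>(g).\<close>

lemma lact_formula:
  assumes "g \<in> carrier G" "h \<in> carrier H" "i \<in> I" "k \<in> I" "x \<in> U i" "x \<in> U k"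
  shows "ext_lact X (g, ((i, k), x)) ((k, x), h) = ((i, x), \<rho> g \<otimes>\<^bsub>H\<^esub> lam ((i, k), x) \<otimes>\<^bsub>H\<^esub> h)"
proof -
  have "gmul Q (g, ((i, i), x)) (\<one>\<^bsub>G\<^esub>, ((i, k), x)) = (g, ((i, k), x))"
    using gmul_kernel assms by simp
  then show ?thesis
    using lact_gmul[of g "\<one>\<^bsub>G\<^esub>" h i i k x] assms lambda_eq(2)[of i k x]
    by (simp add: lact_one lact_kernel H.m_assoc)
qed

text \<open>Equivariance of \<open>\<chi>\<close> at \<open>(x\<^sub>k, e)\<close> says that conjugation by \<open>(e, x\<^sub>i\<^sub>k)\<close> acts on the kernel
  through \<open>\<lambda>\<^sub>i\<^sub>k\<close>.\<close>

lemma gmul_one_kernel: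
  assumes "g \<in> carrier G" "i \<in> I" "k \<in> I" "x \<in> U i" "x \<in> U k"
  shows "gmul Q (\<one>\<^bsub>G\<^esub>, ((i, k), x)) (g, ((k, k), x)) = (j (lam ((i, k), x)) g, ((i, k), x))"
proof -
  let ?r = "(\<one>\<^bsub>G\<^esub>, ((i, k), x))"
  note l = lambda_eq[OF assms(2-5)]
  obtain a where a: "a \<in> carrier G" "gmul Q ?r (g, ((k, k), x)) = (a, ((i, k), x))"
    using gmul_mem[of "\<one>\<^bsub>G\<^esub>" g i k k x] assms by auto
  have "smooth_map (arrows Q) (arrows Q) (ginv Q)"
    using lie_groupoid_Q unfolding lie_groupoid_def by (elim conjE)
  from smooth_on_subset_points(2)[OF this] have mem: "ginv Q ?r \<in> points RM"
    using assms by (auto simp: arrows_Q image_subset_iff)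
  have "\<forall>x\<in>points (arrows Q). src Q (ginv Q x) = tgt Q x \<and> tgt Q (ginv Q x) = src Q x \<and>
      gmul Q x (ginv Q x) = gunit Q (src Q x) \<and> gmul Q (ginv Q x) x = gunit Q (tgt Q x)"
    using lie_groupoid_Q unfolding lie_groupoid_def by (elim conjE)
  from bspec[OF this, of ?r] have inv: "src Q (ginv Q ?r) = (k, x)" "tgt Q (ginv Q ?r) = (i, x)"
    "gmul Q (ginv Q ?r) ?r = (\<one>\<^bsub>G\<^esub>, ((k, k), x))"
    using assms by (simp_all add: arrows_Q gunit_Q)
  obtain b where b: "b \<in> carrier G" "ginv Q ?r = (b, ((k, i), x))"
    using mem inv(1,2) by (cases "ginv Q ?r") auto
  have "\<forall>r\<in>points (arrows Q). \<forall>p\<in>points PM. \<forall>h\<in>carrier H. tgt Q r = ext_bundle_prj X p \<longrightarrow>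
      ext_chi X (ext_ract X (ext_lact X r p) h) = band_ract G (band_lact G Q r (ext_chi X p)) (j h)"
    using gh_extension_X unfolding gh_extension_def bundle_X by (elim conjE)
  from this[rule_format, of ?r "((k, x), \<one>\<^bsub>H\<^esub>)" "\<one>\<^bsub>H\<^esub>"]
  have "ext_chi X ((i, x), lam ((i, k), x))
      = band_ract G (band_lact G Q ?r (ext_chi X ((k, x), \<one>\<^bsub>H\<^esub>))) (j \<one>\<^bsub>H\<^esub>)"
    using assms ract_X l by (simp add: arrows_Q)
  then have "snd (ext_chi X ((i, x), lam ((i, k), x))) g
      = snd (band_ract G (band_lact G Q ?r (ext_chi X ((k, x), \<one>\<^bsub>H\<^esub>))) (j \<one>\<^bsub>H\<^esub>)) g"
    by simp
  then have conj: "gmul Q (a, ((i, k), x)) (b, ((k, i), x)) = (j (lam ((i, k), x)) g, ((i, i), x))"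
    using assms chi_X l a b by (simp add: band_ract_def band_lact_def compose_def)
  \<comment> \<open>Multiplying the conjugate by \<open>?r\<close> on the right removes the inverse
    and leaves \<open>?r\<close> times (g, x_kk), so the component \<open>a\<close> can be compared
    with \<lambda>_ik(g) by the kernel condition.\<close>
  have "gmul Q (gmul Q (a, ((i, k), x)) (b, ((k, i), x))) ?r = (a, ((i, k), x))"
  proof -
    have "\<forall>x\<in>points (arrows Q). gmul Q (gunit Q (src Q x)) x = x \<and> gmul Q x (gunit Q (tgt Q x)) = x"
      using lie_groupoid_Q unfolding lie_groupoid_def by (elim conjE)
    from bspec[OF this, of "(a, ((i, k), x))"]
    have "gmul Q (a, ((i, k), x)) (\<one>\<^bsub>G\<^esub>, ((k, k), x)) = (a, ((i, k), x))"
      using a assms by (simp add: arrows_Q gunit_Q)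
    then show ?thesis
      using gmul_assoc_Q[of a b "\<one>\<^bsub>G\<^esub>" i k i k x] inv(3) a b assms by simp
  qed
  then have "(a, ((i, k), x)) = (j (lam ((i, k), x)) g, ((i, k), x))"
    unfolding conj using gmul_kernel assms l by simp
  then show ?thesis
    using a(2) by simp
qed

text \<open>Split off kernel elements on the left of both arrows. Moving (g', x_kk) to the left past
  (e, x_ik) turns g' into \<lambda>_ik(g'), and the remaining product (e, x_ik) \<bullet> (e, x_kl)
  contributes g_ikl.\<close>

lemma gmul_formula:
  assumes "g \<in> carrier G" "g' \<in> carrier G" "i \<in> I" "k \<in> I" "l \<in> I" "x \<in> U i" "x \<in> U k" "x \<in> U l"
  shows "gmul Q (g, ((i, k), x)) (g', ((k, l), x))
    = (g \<otimes>\<^bsub>G\<^esub> j (lam ((i, k), x)) g' \<otimes>\<^bsub>G\<^esub> \<gamma> ((i, k, l), x), ((i, l), x))"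
proof -
  let ?e = "\<one>\<^bsub>G\<^esub>"
  note l = lambda_eq(2)[OF assms(3,4,6,7)] and c = gamma_eq[OF assms(3-8)]
  let ?m = "j (lam ((i, k), x)) g'"
  have m: "?m \<in> carrier G" using l assms by simp
  have "gmul Q (?e, ((i, k), x)) (g', ((k, l), x))
      = gmul Q (?e, ((i, k), x)) (gmul Q (g', ((k, k), x)) (?e, ((k, l), x)))"
    using gmul_kernel assms by simp
  also have "\<dots> = gmul Q (?m, ((i, k), x)) (?e, ((k, l), x))"
    using gmul_assoc_Q[of ?e g' ?e i k k l x] gmul_one_kernel assms by simp
  also have "\<dots> = gmul Q (gmul Q (?m, ((i, i), x)) (?e, ((i, k), x))) (?e, ((k, l), x))"
    using gmul_kernel assms m by simp
  also have "\<dots> = (?m \<otimes>\<^bsub>G\<^esub> \<gamma> ((i, k, l), x), ((i, l), x))"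
    using gmul_assoc_Q[of ?m ?e ?e i i k l x] gmul_kernel assms m c by simp
  finally have 1: "gmul Q (?e, ((i, k), x)) (g', ((k, l), x)) = (?m \<otimes>\<^bsub>G\<^esub> \<gamma> ((i, k, l), x), ((i, l), x))" .
  have "gmul Q (g, ((i, k), x)) (g', ((k, l), x))
      = gmul Q (gmul Q (g, ((i, i), x)) (?e, ((i, k), x))) (g', ((k, l), x))"
    using gmul_kernel assms by simp
  also have "\<dots> = gmul Q (g, ((i, i), x)) (?m \<otimes>\<^bsub>G\<^esub> \<gamma> ((i, k, l), x), ((i, l), x))"
    using gmul_assoc_Q[of g ?e g' i i k l x] assms 1 by simp
  also have "\<dots> = (g \<otimes>\<^bsub>G\<^esub> ?m \<otimes>\<^bsub>G\<^esub> \<gamma> ((i, k, l), x), ((i, l), x))"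
    using gmul_kernel assms m c by (simp add: G.m_assoc)
  finally show ?thesis .
qed

text \<open>The function is the action composed with the smooth map from x_ik to the pair (e, x_ik),
  (x_k, e) in the fibre product, followed by the projection to \<open>H\<close>.\<close>

lemma smooth_lambda: "smooth_map (cover2 N I U) (mfd H) lam"
proof -
  note id = smooth_on_subset_id[OF manifold_cover2 order_refl]
  have 1: "smooth_map (cover2 N I U) (cover1 N I U) (\<lambda>q. (snd (fst q), snd q))"
    by (rule smooth_into_cover1[OF manifold_cover2 smooth_cover2_point[OF manifold_cover2 id]
          locally_constant_cover2_index[OF manifold_cover2 id, of snd]]) auto
  let ?S = "{(r, p). r \<in> points (arrows Q) \<and> p \<in> points PM \<and> tgt Q r = ext_bundle_prj X p}"
  have "smooth_on_subset (prod_manifold (arrows Q) PM) ?S PM (\<lambda>(r, p). ext_lact X r p)"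
    using groupoid_action_Q unfolding groupoid_action_def by (elim conjE)
  then have act: "smooth_on_subset (prod_manifold RM PM) ?S PM (\<lambda>(r, p). ext_lact X r p)"
    unfolding arrows_Q .
  have r: "smooth_map (cover2 N I U) RM (\<lambda>q. (\<one>\<^bsub>G\<^esub>, q))"
    by (intro smooth_on_subset_Pair smooth_on_subset_const id manifold_cover2 manifold_G) auto
  have p: "smooth_map (cover2 N I U) PM (\<lambda>q. ((snd (fst q), snd q), \<one>\<^bsub>H\<^esub>))"
    by (intro smooth_on_subset_Pair smooth_on_subset_const 1 manifold_cover1 manifold_cover2 manifold_H) auto
  have "smooth_map (cover2 N I U) PM (\<lambda>q. ext_lact X (\<one>\<^bsub>G\<^esub>, q) ((snd (fst q), snd q), \<one>\<^bsub>H\<^esub>))"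
    by (rule smooth_on_subset_compose2[OF manifold_cover2 manifold_RM manifold_PM manifold_PM act r p])
      (auto simp: arrows_Q)
  from smooth_on_subset_snd_compose[OF manifold_cover2 manifold_cover1 manifold_H this]
  show ?thesis
    by (rule smooth_on_subset_cong) (auto simp: cocycle_lambda_def)
qed

text \<open>The same argument with the product: x_ikl goes smoothly to the composable pair (e,
  x_ik), (e, x_kl), and the component in \<open>G\<close> is extracted.\<close>

lemma smooth_g: "smooth_map (cover3 N I U) (mfd G) \<gamma>"
proof -
  note id = smooth_on_subset_id[OF manifold_cover3 order_refl]
  note x = smooth_cover3_point[OF manifold_cover3 id]
  have 1: "smooth_map (cover3 N I U) (cover2 N I U) (\<lambda>q. ((fst (fst q), fst (snd (fst q))), snd q))"
    by (rule smooth_into_cover2[OF manifold_cover3 x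
          locally_constant_cover3_index[OF manifold_cover3 id, of "\<lambda>t. (fst t, fst (snd t))"]]) auto
  have 2: "smooth_map (cover3 N I U) (cover2 N I U) (\<lambda>q. (snd (fst q), snd q))"
    by (rule smooth_into_cover2[OF manifold_cover3 x
          locally_constant_cover3_index[OF manifold_cover3 id, of snd]]) auto
  have mul: "smooth_on_subset (prod_manifold RM RM) (composable Q) RM (\<lambda>(x, y). gmul Q x y)"
    using lie_groupoid_Q unfolding lie_groupoid_def arrows_Q by (elim conjE)
  have r: "smooth_map (cover3 N I U) RM (\<lambda>q. (\<one>\<^bsub>G\<^esub>, ((fst (fst q), fst (snd (fst q))), snd q)))"
    and r': "smooth_map (cover3 N I U) RM (\<lambda>q. (\<one>\<^bsub>G\<^esub>, (snd (fst q), snd q)))"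
    by (intro smooth_on_subset_Pair smooth_on_subset_const 1 2 manifold_cover2 manifold_cover3 manifold_G; simp)+
  have "smooth_map (cover3 N I U) RM (\<lambda>q. gmul Q (\<one>\<^bsub>G\<^esub>, ((fst (fst q), fst (snd (fst q))), snd q))
      (\<one>\<^bsub>G\<^esub>, (snd (fst q), snd q)))"
    by (rule smooth_on_subset_compose2[OF manifold_cover3 manifold_RM manifold_RM manifold_RM mul r r'])
      (auto simp: composable_Q)
  from smooth_on_subset_fst_compose[OF manifold_cover3 manifold_G manifold_cover2 this]
  show ?thesis
    by (rule smooth_on_subset_cong) (auto simp: cocycle_g_def)
qed

section \<open>The cocycle of an adapted extension and the return to the extension\<close>

lemma nonabelian_cocycle_X: "nonabelian_cocycle G H \<rho> j N I U lam \<gamma>"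
  unfolding nonabelian_cocycle_def
proof (intro conjI ballI smooth_lambda smooth_g)
  fix i k l x assume ikl: "i \<in> I" "k \<in> I" "l \<in> I" "x \<in> U i \<inter> U k \<inter> U l"
  \<comment> \<open>Acting on (x_l, e) by the product (e, x_ik) \<bullet> (e, x_kl), at once or one
    factor after the other, gives the first identity.\<close>
  then have "ext_lact X (\<gamma> ((i, k, l), x), ((i, l), x)) ((l, x), \<one>\<^bsub>H\<^esub>)
      = ext_lact X (\<one>\<^bsub>G\<^esub>, ((i, k), x)) ((k, x), lam ((k, l), x))"
    using lact_gmul[of "\<one>\<^bsub>G\<^esub>" "\<one>\<^bsub>G\<^esub>" "\<one>\<^bsub>H\<^esub>" i k l x] by (simp add: gamma_eq lambda_eq)
  then show "\<rho> (\<gamma> ((i, k, l), x)) \<otimes>\<^bsub>H\<^esub> lam ((i, l), x) = lam ((i, k), x) \<otimes>\<^bsub>H\<^esub> lam ((k, l), x)"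
    using ikl by (simp add: lact_formula gamma_eq lambda_eq)
next
  fix i k l n x assume "i \<in> I" "k \<in> I" "l \<in> I" "n \<in> I" "x \<in> U i \<inter> U k \<inter> U l \<inter> U n"
  \<comment> \<open>Associativity for the arrows with neutral group component over x_ik, x_kl and
    x_ln: \<lambda>_ik enters only when (e, x_ik) is multiplied by the product of the other
    two.\<close>
  then show "\<gamma> ((i, k, l), x) \<otimes>\<^bsub>G\<^esub> \<gamma> ((i, l, n), x)
      = j (lam ((i, k), x)) (\<gamma> ((k, l, n), x)) \<otimes>\<^bsub>G\<^esub> \<gamma> ((i, k, n), x)"
    using gmul_assoc_Q[of "\<one>\<^bsub>G\<^esub>" "\<one>\<^bsub>G\<^esub>" "\<one>\<^bsub>G\<^esub>" i k l n x]
    by (simp add: gmul_formula gamma_eq lambda_eq)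
next
  fix i k x assume "i \<in> I" "k \<in> I" "x \<in> U i \<inter> U k"
  \<comment> \<open>The kernel condition with both group components neutral.\<close>
  then show "\<gamma> ((i, i, k), x) = \<one>\<^bsub>G\<^esub>"
    using gamma_eq(1)[of i i k x] gmul_kernel by simp
qed

text \<open>Makes the groupoid and extension rebuilt from the cocycle available next to the original
  ones, as \<open>cocycle.R\<close> and \<open>cocycle.E\<close>, for comparison.\<close>

sublocale cocycle: cech_cocycle N I U G H \<rho> j lam \<gamma>
  by unfold_locales (rule nonabelian_cocycle_X)

lemma same_groupoid_X: "same_groupoid cocycle.R Q"
  unfolding same_groupoid_def cocycle.R_simps(1,2)
proof (intro conjI ballI)
  show mul: "case z of (r, r') \<Rightarrow> gmul cocycle.R r r' = gmul Q r r'" if "z \<in> composable cocycle.R" for z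
    using that by (auto simp: cocycle.composable_R gmul_formula)
  fix r assume "r \<in> points RM"
  then obtain g i k x where r: "r = (g, ((i, k), x))" "g \<in> carrier G" "i \<in> I" "k \<in> I" "x \<in> U i" "x \<in> U k"
    by auto
  then show "src cocycle.R r = src Q r" "tgt cocycle.R r = tgt Q r"
    by simp_all
  let ?a = "j (inv\<^bsub>H\<^esub> lam ((i, k), x)) (inv\<^bsub>G\<^esub> g \<otimes>\<^bsub>G\<^esub> inv\<^bsub>G\<^esub> \<gamma> ((i, k, i), x))"
  have a: "ginv cocycle.R r = (?a, ((k, i), x))" "?a \<in> carrier G"
    using r by simp_all
  \<comment> \<open>The explicit inverse is a left inverse for the rebuilt product, which agrees
    with the product of \<open>Q\<close>; uniqueness then identifies it with the inverse in
    \<open>Q\<close>.\<close>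
  then have "gmul Q (ginv cocycle.R r) r = gmul cocycle.R (ginv cocycle.R r) r"
    using r gmul_formula[of ?a g k i k x] by simp
  also have "\<dots> = (\<one>\<^bsub>G\<^esub>, ((k, k), x))"
    using cocycle.ginv_gmul r by simp
  finally show "ginv cocycle.R r = ginv Q r"
    using a r by (intro lie_groupoid_ginv_unique[OF lie_groupoid_Q]) (simp_all add: arrows_Q gunit_Q)
qed (auto simp: arrows_Q objects_Q gunit_Q points_cover1)

lemma same_extension_X: "same_extension H cocycle.E X"
  unfolding same_extension_def cocycle.E_simps(1-4) cocycle.R_simps(1)
  using same_groupoid_X prj_X bundle_X bundle_prj_X chi_X ract_X
  by (auto simp: arrows_Q lact_formula)

end

theorem proposition2p14:
  fixes N :: "('x, 'e::finite_dim_normed) manifold"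
    and I :: "'i set" and U :: "'i \<Rightarrow> 'x set"
    and G :: "('g, 'a::finite_dim_normed) lie_group_data"
    and H :: "('h, 'b::finite_dim_normed) lie_group_data"
    and \<rho> :: "'g \<Rightarrow> 'h" and j :: "'h \<Rightarrow> 'g \<Rightarrow> 'g"
  assumes "smooth_manifold N" and "open_cover N I U" and "crossed_module G H \<rho> j"
  shows
    "(\<forall>E. adapted_extension G H \<rho> j N I U E \<longrightarrow>
        (\<forall>i\<in>I. \<forall>k\<in>I. \<forall>x \<in> U i \<inter> U k.
           ext_lact E (\<one>\<^bsub>G\<^esub>, ((i, k), x)) ((k, x), \<one>\<^bsub>H\<^esub>)
             = ((i, x), cocycle_lambda G H E ((i, k), x))) \<and>
        (\<forall>i\<in>I. \<forall>k\<in>I. \<forall>l\<in>I. \<forall>x \<in> U i \<inter> U k \<inter> U l.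
           gmul (ext_groupoid E) (\<one>\<^bsub>G\<^esub>, ((i, k), x)) (\<one>\<^bsub>G\<^esub>, ((k, l), x))
             = (cocycle_g G E ((i, k, l), x), ((i, l), x))) \<and>
        nonabelian_cocycle G H \<rho> j N I U (cocycle_lambda G H E) (cocycle_g G E))
   \<and> (\<forall>lam \<gamma>. nonabelian_cocycle G H \<rho> j N I U lam \<gamma> \<longrightarrow>
        adapted_extension G H \<rho> j N I U (cocycle_extension G H \<rho> j N I U lam \<gamma>))
   \<and> (\<forall>E. adapted_extension G H \<rho> j N I U E \<longrightarrow>
        same_extension H
          (cocycle_extension G H \<rho> j N I U (cocycle_lambda G H E) (cocycle_g G E)) E)
   \<and> (\<forall>lam \<gamma>. nonabelian_cocycle G H \<rho> j N I U lam \<gamma> \<longrightarrow>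
        (\<forall>c\<in>points (cover2 N I U).
           cocycle_lambda G H (cocycle_extension G H \<rho> j N I U lam \<gamma>) c = lam c) \<and>
        (\<forall>c\<in>points (cover3 N I U).
           cocycle_g G (cocycle_extension G H \<rho> j N I U lam \<gamma>) c = \<gamma> c))"
proof (intro conjI allI impI)
  interpret cech_crossed_module N I U G H \<rho> j
    using assms by unfold_locales
  fix E assume "adapted_extension G H \<rho> j N I U E"
  then interpret X: adapted_cech_extension N I U G H \<rho> j E
    by unfold_locales
  show "\<forall>i\<in>I. \<forall>k\<in>I. \<forall>x \<in> U i \<inter> U k.
      ext_lact E (\<one>\<^bsub>G\<^esub>, ((i, k), x)) ((k, x), \<one>\<^bsub>H\<^esub>) = ((i, x), cocycle_lambda G H E ((i, k), x))"
    using X.lambda_eq(1) by simp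
  show "\<forall>i\<in>I. \<forall>k\<in>I. \<forall>l\<in>I. \<forall>x \<in> U i \<inter> U k \<inter> U l.
      gmul (ext_groupoid E) (\<one>\<^bsub>G\<^esub>, ((i, k), x)) (\<one>\<^bsub>G\<^esub>, ((k, l), x))
        = (cocycle_g G E ((i, k, l), x), ((i, l), x))"
    using X.gamma_eq(1) by simp
  show "nonabelian_cocycle G H \<rho> j N I U (cocycle_lambda G H E) (cocycle_g G E)"
    by (rule X.nonabelian_cocycle_X)
  show "same_extension H (cocycle_extension G H \<rho> j N I U (cocycle_lambda G H E) (cocycle_g G E)) E"
    by (rule X.same_extension_X)
next
  interpret cech_crossed_module N I U G H \<rho> j
    using assms by unfold_locales
  fix lam \<gamma> assume "nonabelian_cocycle G H \<rho> j N I U lam \<gamma>"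
  then interpret X: cech_cocycle N I U G H \<rho> j lam \<gamma>
    by unfold_locales
  show "adapted_extension G H \<rho> j N I U (cocycle_extension G H \<rho> j N I U lam \<gamma>)"
    by (rule X.adapted_extension_E)
  show "\<forall>c\<in>points (cover2 N I U). cocycle_lambda G H (cocycle_extension G H \<rho> j N I U lam \<gamma>) c = lam c"
    "\<forall>c\<in>points (cover3 N I U). cocycle_g G (cocycle_extension G H \<rho> j N I U lam \<gamma>) c = \<gamma> c"
    using X.cocycle_lambda_E X.cocycle_g_E by blast+
qed

end
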